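(* If the Pick matrix $P$ of an interpolation data set is invertible and has $\kappa$ negative eigenvalues, then a function $\varphi\in\widetilde{\mathbf{N}}_0$ may satisfy conditions $\mathbf C_{4-6}\vee\widetilde{\mathbf C}_{4-6}$ at at most $\kappa$ interpolation nodes. Furthermore, if $\varphi\in\widetilde{\mathbf{N}}_0$ meets conditions $\mathbf C_{4-6}\vee\widetilde{\mathbf C}_{4-6}$ at exactly $k$ interpolation nodes, then the function $w=\mathbf{T}_\Theta[\varphi]$ belongs to the class $\widetilde{\mathbf{N}}_{\kappa-k}$.
   Context: Classes. $\mathbb{C}^+$ is the open upper half plane. For $w$ meromorphic on $\mathbb{C}^+$, $\rho(w)\subset\mathbb{C}^+$ is its domain of analyticity and $K_w(z,\zeta)=\frac{w(z)-\overline{w(\zeta)}}{z-\bar\zeta}$. For an integer $\kappa\ge 0$, $\mathbf{N}_\kappa$ is the set of $w$ meromorphic on $\mathbb{C}^+$ such that all matrices $[K_w(z_j,z_i)]_{i,j=1}^m$ ($m\ge1$, $z_i\in\rho(w)$) have at most $\kappa$ negative eigenvalues, and at least one has exactly $\kappa$; $\mathbf{N}_0$ is the Nevanlinna class. $\widetilde{\mathbf{N}}_\kappa=\mathbf{N}_\kappa\cup\{\infty\}$, where $\infty$ is the function identically $\infty$. Boundary limits. For $x\in\mathbb{R}$, $f(x)$, $f'(x)$, $f_{-1}(x)$ denote the nontangential limits as $z\to x$ of $f(z)$, $f'(z)$, $(z-x)f(z)$, when they exist. If $f\equiv\infty$, then $f_{-1}(x)=\infty$; $1/\infty=0$. Data.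 $x_1,\dots,x_n$ are distinct real numbers (nodes), $0\le\ell\le n$, $w_j,\gamma_j\in\mathbb{R}$ $(1\le j\le\ell)$, $\xi_k\in\mathbb{R}\setminus\{0\}$ $(\ell<k\le n)$. The Pick matrix $P=[p_{ij}]_{i,j=1}^n$ is the real symmetric matrix with: $p_{ij}=\frac{w_j-w_i}{x_j-x_i}$ for $i\ne j$ and $p_{ii}=\gamma_i$, for $i,j\le\ell$; $p_{ij}=p_{ji}=\frac{\xi_j}{x_j-x_i}$ for $i\le\ell<j$; $p_{ii}=-\xi_i$ and $p_{ij}=0$ $(i\neq j)$ for $i,j>\ell$. Also $X=\mathrm{diag}(x_1,\dots,x_n)$, $C=[w_1\ \cdots\ w_\ell\ \xi_{\ell+1}\ \cdots\ \xi_n]$, $E=[1\ \cdots\ 1\ 0\ \cdots\ 0]$ ($\ell$ ones), $J=\begin{bmatrix}0&-i\\ i&0\end{bmatrix}$. For $P$ invertible, $\Theta(z)=[\Theta_{ij}(z)]_{i,j=1}^2=I_2-i\begin{bmatrix}C\\ E\end{bmatrix}(zI-X)^{-1}P^{-1}\begin{bmatrix}C^*&E^*\end{bmatrix}J$ and $\mathbf{T}_\Theta[\varphi]=\frac{\Theta_{11}\varphi+\Theta_{12}}{\Theta_{21}\varphi+\Theta_{22}}$, with $\mathbf{T}_\Theta[\infty]=\Theta_{11}/\Theta_{21}$ ($\mathbf{T}_\Theta[\varphi]\equiv\infty$ if the denominator vanishes identically). Let $\tilde c_i$, $\tilde e_i$ be the $i$-th entries of the row vectors $CP^{-1}$, $EP^{-1}$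 (real, not both zero), $\eta_i=\tilde c_i/\tilde e_i$, and $\tilde p_{ii}$ the $i$-th diagonal entry of $P^{-1}$. $\varphi\in\widetilde{\mathbf{N}}_0$ satisfies $\mathbf C_{4-6}\vee\widetilde{\mathbf C}_{4-6}$ at $x_i$ if one of the following holds. When $\tilde e_i\neq0$: $\mathbf C_4$: $\varphi(x_i)=\eta_i$ and $0\le\varphi'(x_i)<-\tilde p_{ii}/\tilde e_i^2$; $\mathbf C_5$: $\varphi(x_i)=\eta_i$ and $\varphi'(x_i)=-\tilde p_{ii}/\tilde e_i^2>0$; $\mathbf C_6$: $\varphi(x_i)=\eta_i$ and $\varphi'(x_i)=\tilde p_{ii}=0$. When $\tilde e_i=0$: $\widetilde{\mathbf C}_4$: $\varphi(x_i)=\infty$ and $0\le-1/\varphi_{-1}(x_i)<-\tilde p_{ii}/\tilde c_i^2$; $\widetilde{\mathbf C}_5$: $\varphi(x_i)=\infty$ and $1/\varphi_{-1}(x_i)=\tilde p_{ii}/\tilde c_i^2<0$; $\widetilde{\mathbf C}_6$: $\varphi(x_i)=\infty$ and $1/\varphi_{-1}(x_i)=\tilde p_{ii}=0$. *)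

theory Defs
  imports
    "HOL-Complex_Analysis.Complex_Analysis"
    "Jordan_Normal_Form.Schur_Decomposition"
    "Jordan_Normal_Form.Gauss_Jordan_Elimination"
begin

section \<open>Generalized Nevanlinna classes\<close>

definition upper_half_plane :: "complex set" where
  "upper_half_plane = {z. Im z > 0}"

text \<open>
  Meromorphic functions are represented by functions that are
  \<^const>\<open>nicely_meromorphic_on\<close> the upper half plane: they have no removable singularities
  there and take the dummy value 0 at their poles. Values outside the upper half plane are
  irrelevant. The function that is identically infinity is added as a separate object.
\<close>

datatype ext_fun = Fin "complex \<Rightarrow> complex" | Infty

definition analyticity_domain :: "(complex \<Rightarrow> complex) \<Rightarrow> complex set" where
  "analyticity_domain w = {z \<in> upper_half_plane. w analytic_on {z}}"

definition nev_kernel :: "(complex \<Rightarrow> complex) \<Rightarrow> complex \<Rightarrow> complex \<Rightarrow> complex" where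
  "nev_kernel w z \<zeta> = (w z - cnj (w \<zeta>)) / (z - cnj \<zeta>)"

definition kernel_matrix :: "(complex \<Rightarrow> complex) \<Rightarrow> complex list \<Rightarrow> complex Matrix.mat" where
  "kernel_matrix w zs =
     Matrix.mat (length zs) (length zs) (\<lambda>(i, j). nev_kernel w (zs ! j) (zs ! i))"

text \<open>
  Negative eigenvalues are counted with multiplicity. The matrices below are Hermitian, so that
  algebraic and geometric multiplicities agree and all eigenvalues are real.
\<close>

definition num_neg_eigenvalues :: "complex Matrix.mat \<Rightarrow> nat" where
  "num_neg_eigenvalues A =
     (\<Sum>r \<in> {r::real. r < 0 \<and> eigenvalue A (complex_of_real r)}.
        Polynomial.order (complex_of_real r) (char_poly A))"

definition nev_class :: "nat \<Rightarrow> (complex \<Rightarrow> complex) set" where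
  "nev_class \<kappa> = {w. w nicely_meromorphic_on upper_half_plane \<and>
     (\<forall>zs. zs \<noteq> [] \<and> set zs \<subseteq> analyticity_domain w \<longrightarrow>
        num_neg_eigenvalues (kernel_matrix w zs) \<le> \<kappa>) \<and>
     (\<exists>zs. zs \<noteq> [] \<and> set zs \<subseteq> analyticity_domain w \<and>
        num_neg_eigenvalues (kernel_matrix w zs) = \<kappa>)}"

definition ext_nev_class :: "nat \<Rightarrow> ext_fun set" where
  "ext_nev_class \<kappa> = Fin ` nev_class \<kappa> \<union> {Infty}"


section \<open>Nontangential boundary limits\<close>

definition stolz_angle :: "real \<Rightarrow> real \<Rightarrow> complex set" where
  "stolz_angle M x = {z. Im z > 0 \<and> \<bar>Re z - x\<bar> \<le> M * Im z}"

text \<open>The target \<open>F\<close> is \<open>nhds L\<close> for a finite limit \<open>L\<close>, and \<open>at_infinity\<close> for the limit infinity.\<close>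

definition nt_limit :: "(complex \<Rightarrow> complex) \<Rightarrow> complex filter \<Rightarrow> real \<Rightarrow> bool" where
  "nt_limit f F x \<longleftrightarrow>
     (\<forall>M>0. filterlim f F (at (complex_of_real x) within stolz_angle M x))"

fun bd_value :: "ext_fun \<Rightarrow> real \<Rightarrow> complex \<Rightarrow> bool" where
  "bd_value (Fin f) x L \<longleftrightarrow> nt_limit f (nhds L) x"
| "bd_value Infty x L \<longleftrightarrow> False"

fun bd_value_infinite :: "ext_fun \<Rightarrow> real \<Rightarrow> bool" where
  "bd_value_infinite (Fin f) x \<longleftrightarrow> nt_limit f at_infinity x"
| "bd_value_infinite Infty x \<longleftrightarrow> True"

fun bd_deriv :: "ext_fun \<Rightarrow> real \<Rightarrow> complex \<Rightarrow> bool" where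
  "bd_deriv (Fin f) x L \<longleftrightarrow> nt_limit (deriv f) (nhds L) x"
| "bd_deriv Infty x L \<longleftrightarrow> False"

text \<open>
  \<open>bd_inv_residue f x r\<close> says that \<open>1 / f\<^sub>-\<^sub>1(x) = r\<close>, where \<open>f\<^sub>-\<^sub>1(x)\<close> is the nontangential limit of
  \<open>(z - x) f(z)\<close>. The reciprocal is taken in the extended sense: \<open>1 / \<infinity> = 0\<close>, whereas
  \<open>1 / 0\<close> is not a number, so no \<open>r\<close> qualifies if \<open>f\<^sub>-\<^sub>1(x) = 0\<close>.
\<close>

fun bd_inv_residue :: "ext_fun \<Rightarrow> real \<Rightarrow> real \<Rightarrow> bool" where
  "bd_inv_residue (Fin f) x r \<longleftrightarrow>
     (\<exists>L. nt_limit (\<lambda>z. (z - complex_of_real x) * f z) (nhds L) x \<and>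
          L \<noteq> 0 \<and> complex_of_real r = 1 / L) \<or>
     (nt_limit (\<lambda>z. (z - complex_of_real x) * f z) at_infinity x \<and> r = 0)"
| "bd_inv_residue Infty x r \<longleftrightarrow> r = 0"


section \<open>Interpolation data\<close>

text \<open>
  The data are \<open>n\<close>, \<open>l\<close> and sequences \<open>x\<close>, \<open>w\<close>, \<open>\<gamma>\<close>, \<open>\<xi>\<close>, all indexed from 0: the entries
  \<open>w i\<close> and \<open>\<gamma> i\<close> are relevant for \<open>i < l\<close>, and \<open>\<xi> i\<close> for \<open>l \<le> i < n\<close>.
\<close>

definition interpolation_data :: "nat \<Rightarrow> nat \<Rightarrow> (nat \<Rightarrow> real) \<Rightarrow> (nat \<Rightarrow> real) \<Rightarrow> bool" where
  "interpolation_data n l x \<xi> \<longleftrightarrow>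
     l \<le> n \<and> inj_on x {..<n} \<and> (\<forall>k. l \<le> k \<and> k < n \<longrightarrow> \<xi> k \<noteq> 0)"

definition pick_matrix :: "nat \<Rightarrow> nat \<Rightarrow> (nat \<Rightarrow> real) \<Rightarrow> (nat \<Rightarrow> real) \<Rightarrow> (nat \<Rightarrow> real) \<Rightarrow>
    (nat \<Rightarrow> real) \<Rightarrow> real Matrix.mat" where
  "pick_matrix n l x w \<gamma> \<xi> = Matrix.mat n n (\<lambda>(i, j).
     if i < l \<and> j < l then (if i = j then \<gamma> i else (w j - w i) / (x j - x i))
     else if i < l then \<xi> j / (x j - x i)
     else if j < l then \<xi> i / (x i - x j)
     else (if i = j then - \<xi> i else 0))"

definition node_matrix :: "nat \<Rightarrow> (nat \<Rightarrow> real) \<Rightarrow> real Matrix.mat" where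
  "node_matrix n x = mat_diag n x"

definition C_row :: "nat \<Rightarrow> nat \<Rightarrow> (nat \<Rightarrow> real) \<Rightarrow> (nat \<Rightarrow> real) \<Rightarrow> real Matrix.mat" where
  "C_row n l w \<xi> = Matrix.mat 1 n (\<lambda>(_, j). if j < l then w j else \<xi> j)"

definition E_row :: "nat \<Rightarrow> nat \<Rightarrow> real Matrix.mat" where
  "E_row n l = Matrix.mat 1 n (\<lambda>(_, j). if j < l then 1 else 0)"

definition J_mat :: "complex Matrix.mat" where
  "J_mat = mat_of_rows_list 2 [[0, - \<i>], [\<i>, 0]]"

text \<open>Meaningful for invertible arguments only.\<close>

abbreviation mat_inv :: "'a::field Matrix.mat \<Rightarrow> 'a Matrix.mat" where
  "mat_inv A \<equiv> the (mat_inverse A)"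

abbreviation of_real_mat :: "real Matrix.mat \<Rightarrow> complex Matrix.mat" where
  "of_real_mat \<equiv> map_mat complex_of_real"

definition Theta :: "nat \<Rightarrow> nat \<Rightarrow> (nat \<Rightarrow> real) \<Rightarrow> (nat \<Rightarrow> real) \<Rightarrow> (nat \<Rightarrow> real) \<Rightarrow>
    (nat \<Rightarrow> real) \<Rightarrow> complex \<Rightarrow> complex Matrix.mat" where
  "Theta n l x w \<gamma> \<xi> z =
     (let CE = of_real_mat (C_row n l w \<xi> @\<^sub>r E_row n l);
          X = of_real_mat (node_matrix n x);
          P = of_real_mat (pick_matrix n l x w \<gamma> \<xi>)
      in 1\<^sub>m 2 - \<i> \<cdot>\<^sub>m (CE * mat_inv (z \<cdot>\<^sub>m 1\<^sub>m n - X) * mat_inv P * mat_adjoint CE * J_mat))"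

text \<open>
  Equality of meromorphic functions is equality off isolated singularities; \<^const>\<open>remove_sings\<close>
  selects the normalized representative of the quotient. Accordingly, the denominator vanishes
  identically if it does so wherever \<open>f\<close> is analytic.
\<close>

fun lin_frac :: "(complex \<Rightarrow> complex Matrix.mat) \<Rightarrow> ext_fun \<Rightarrow> ext_fun" where
  "lin_frac \<Theta> (Fin f) =
     (if \<forall>z \<in> analyticity_domain f. \<Theta> z $$ (1, 0) * f z + \<Theta> z $$ (1, 1) = 0 then Infty
      else Fin (remove_sings (\<lambda>z.
        (\<Theta> z $$ (0, 0) * f z + \<Theta> z $$ (0, 1)) / (\<Theta> z $$ (1, 0) * f z + \<Theta> z $$ (1, 1)))))"
| "lin_frac \<Theta> Infty =
     (if \<forall>z \<in> upper_half_plane. \<Theta> z $$ (1, 0) = 0 then Infty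
      else Fin (remove_sings (\<lambda>z. \<Theta> z $$ (0, 0) / \<Theta> z $$ (1, 0))))"


section \<open>The boundary conditions at a node\<close>

text \<open>
  In the following, \<open>x\<close>, \<open>c\<close>, \<open>e\<close>, \<open>p\<close> stand for the node \<open>x\<^sub>i\<close>, the \<open>i\<close>-th entries of \<open>C P\<inverse>\<close> and
  \<open>E P\<inverse>\<close>, and the \<open>i\<close>-th diagonal entry of \<open>P\<inverse>\<close>.
\<close>

definition cond_C4 :: "ext_fun \<Rightarrow> real \<Rightarrow> real \<Rightarrow> real \<Rightarrow> real \<Rightarrow> bool" where
  "cond_C4 \<phi> x c e p \<longleftrightarrow> bd_value \<phi> x (complex_of_real (c / e)) \<and>
     (\<exists>d. bd_deriv \<phi> x (complex_of_real d) \<and> 0 \<le> d \<and> d < - p / e\<^sup>2)"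

definition cond_C5 :: "ext_fun \<Rightarrow> real \<Rightarrow> real \<Rightarrow> real \<Rightarrow> real \<Rightarrow> bool" where
  "cond_C5 \<phi> x c e p \<longleftrightarrow> bd_value \<phi> x (complex_of_real (c / e)) \<and>
     (\<exists>d. bd_deriv \<phi> x (complex_of_real d) \<and> d = - p / e\<^sup>2 \<and> - p / e\<^sup>2 > 0)"

definition cond_C6 :: "ext_fun \<Rightarrow> real \<Rightarrow> real \<Rightarrow> real \<Rightarrow> real \<Rightarrow> bool" where
  "cond_C6 \<phi> x c e p \<longleftrightarrow> bd_value \<phi> x (complex_of_real (c / e)) \<and>
     (\<exists>d. bd_deriv \<phi> x (complex_of_real d) \<and> d = p \<and> p = 0)"

definition cond_C4' :: "ext_fun \<Rightarrow> real \<Rightarrow> real \<Rightarrow> real \<Rightarrow> bool" where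
  "cond_C4' \<phi> x c p \<longleftrightarrow> bd_value_infinite \<phi> x \<and>
     (\<exists>r. bd_inv_residue \<phi> x r \<and> 0 \<le> - r \<and> - r < - p / c\<^sup>2)"

definition cond_C5' :: "ext_fun \<Rightarrow> real \<Rightarrow> real \<Rightarrow> real \<Rightarrow> bool" where
  "cond_C5' \<phi> x c p \<longleftrightarrow> bd_value_infinite \<phi> x \<and>
     (\<exists>r. bd_inv_residue \<phi> x r \<and> r = p / c\<^sup>2 \<and> p / c\<^sup>2 < 0)"

definition cond_C6' :: "ext_fun \<Rightarrow> real \<Rightarrow> real \<Rightarrow> real \<Rightarrow> bool" where
  "cond_C6' \<phi> x c p \<longleftrightarrow> bd_value_infinite \<phi> x \<and>
     (\<exists>r. bd_inv_residue \<phi> x r \<and> r = p \<and> p = 0)"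

definition cond_C46 :: "nat \<Rightarrow> nat \<Rightarrow> (nat \<Rightarrow> real) \<Rightarrow> (nat \<Rightarrow> real) \<Rightarrow> (nat \<Rightarrow> real) \<Rightarrow>
    (nat \<Rightarrow> real) \<Rightarrow> ext_fun \<Rightarrow> nat \<Rightarrow> bool" where
  "cond_C46 n l x w \<gamma> \<xi> \<phi> i \<longleftrightarrow>
     (let Q = mat_inv (pick_matrix n l x w \<gamma> \<xi>);
          c = (C_row n l w \<xi> * Q) $$ (0, i);
          e = (E_row n l * Q) $$ (0, i);
          p = Q $$ (i, i)
      in if e \<noteq> 0
         then cond_C4 \<phi> (x i) c e p \<or> cond_C5 \<phi> (x i) c e p \<or> cond_C6 \<phi> (x i) c e p
         else cond_C4' \<phi> (x i) c p \<or> cond_C5' \<phi> (x i) c p \<or> cond_C6' \<phi> (x i) c p)"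

end

theory Submission imports Defs
begin

text \<open>
  Write \<open>v\<^sub>i(z) = (e\<^sub>i \<phi>(z) - c\<^sub>i) / (z - x\<^sub>i)\<close>, where \<open>c\<^sub>i\<close>, \<open>e\<^sub>i\<close> are the entries of \<open>C P\<inverse>\<close>,
  \<open>E P\<inverse>\<close>. The Lyapunov identity for \<open>P\<close> shows that the kernel of \<open>w = T\<^sub>\<Theta>[\<phi>]\<close> is, up to a
  congruence by the denominator of \<open>w\<close>, equal to \<open>K\<^sub>\<phi>(z, \<zeta>) + v(\<zeta>)\<^sup>* P v(z)\<close>. Let \<open>H\<close> be the
  reproducing kernel Hilbert space of \<open>K\<^sub>\<phi>\<close>. The negative index of this kernel is \<open>\<kappa>\<close> minus the
  dimension of a maximal nonpositive subspace of the orthogonal complement of all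
  \<open>(k\<^sub>z, v(z))\<close> in \<open>H \<oplus> \<complex>\<^sup>n\<close>; this complement consists of the \<open>y\<close> with \<open>\<Sum> y\<^sub>i v\<^sub>i \<in> H\<close>, and carries
  the form \<open>norm (\<Sum> y\<^sub>i v\<^sub>i)\<^sup>2 + y\<^sup>* P\<inverse> y\<close>. By the Julia-Caratheodory theorem \<open>\<Sum> y\<^sub>i v\<^sub>i\<close> lies in
  \<open>H\<close> only if every \<open>v\<^sub>i\<close> with \<open>y\<^sub>i \<noteq> 0\<close> does, that is, only if \<open>\<phi>\<close> has the boundary value
  \<open>c\<^sub>i / e\<^sub>i\<close> and a finite angular derivative at \<open>x\<^sub>i\<close>. The Lyapunov identity for \<open>P\<inverse>\<close> makes the form
  diagonal, with entries \<open>e\<^sub>i\<^sup>2 \<phi>'(x\<^sub>i) + (P\<inverse>)\<^sub>i\<^sub>i\<close>, and the conditions say that the \<open>i\<close>-th entry is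
  nonpositive. All this is carried out with finite Gram matrices, so that \<open>H\<close> itself is not needed.
  The substitution of \<open>-1 / (\<phi> - t)\<close> for \<open>\<phi>\<close> with a suitable real \<open>t\<close> makes all \<open>e\<^sub>i\<close> nonzero and \<open>\<phi>\<close> finite.
\<close>


section \<open>Hermitian forms\<close>

text \<open>That a function \<open>u\<close> lies in \<open>H\<close> with squared norm at most
  \<open>c\<close> is expressed by \<open>2 Re <u, h> <= norm(h)^2 + c\<close> for all finite
  combinations \<open>h\<close> of kernel functions, an inequality that passes to boundary limits.
  Comparisons of negative indices become counts of unknowns against equations: a nontrivial solution
  of a homogeneous system would contradict the signs of the forms. The upper bound holds at every
  finite set of points, but the lower bound must exhibit one set that handles all bad directions
  \<open>y\<close> at once. It comes from compactness of the unit sphere of such \<open>y\<close>,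
  and its points have to avoid the zeros of the denominator, where the kernel of \<open>w\<close> is
  not defined. Good nodes are used along vertical rays alone. Bad nodes need more: domination of a
  sum has to produce nontangential limits at every node of its support, without prior control of
  \<phi> there, because the conditions speak of these limits.\<close>

abbreviation "cx \<equiv> complex_of_real"

abbreviation "UHP \<equiv> upper_half_plane"

abbreviation nt_at :: "real \<Rightarrow> real \<Rightarrow> complex filter" where
  "nt_at M x \<equiv> at (cx x) within stolz_angle M x"

text \<open>All dimension counts go through this. The index sets may have any type, so disjoint sums
  can list unknowns and equations of different origin, which replaces intersecting
  subspaces.\<close>

lemma homogeneous_system_nontrivial:
  fixes c :: "'i \<Rightarrow> 'j \<Rightarrow> 'a::field"
  assumes "finite I" "finite J" "card I < card J"
  obtains t where "\<exists>j\<in>J. t j \<noteq> 0" "\<And>i. i \<in> I \<Longrightarrow> (\<Sum>j\<in>J. c i j * t j) = 0"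
proof -
  have "\<exists>t. (\<exists>j\<in>J. t j \<noteq> 0) \<and> (\<forall>i\<in>I. (\<Sum>j\<in>J. c i j * t j) = 0)"
    using assms
  proof (induction I arbitrary: J c rule: finite_induct)
    case empty
    then have "J \<noteq> {}" by auto
    then show ?case by (intro exI[of _ "\<lambda>_. 1"]) auto
  next
    case (insert i I)
    show ?case
    proof (cases "\<forall>j\<in>J. c i j = 0")
      case True
      obtain t where t: "\<exists>j\<in>J. t j \<noteq> 0" "\<forall>i\<in>I. (\<Sum>j\<in>J. c i j * t j) = 0"
        using insert.IH[of J c] insert.prems insert.hyps by auto
      have "(\<Sum>j\<in>J. c i j * t j) = 0" using True by simp
      then show ?thesis using t by auto
    next
      case False
      then obtain p where p: "p \<in> J" "c i p \<noteq> 0" by auto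
      \<comment> \<open>Pivot elimination: the unknown \<open>p\<close> is removed from the other
        equations by means of equation \<open>i\<close>, and recovered at the end from that
        equation.\<close>
      define c' where "c' = (\<lambda>k j. c k j - c k p * c i j / c i p)"
      have "card I < card (J - {p})"
        using insert.prems insert.hyps p by auto
      then obtain t where t: "\<exists>j\<in>J-{p}. t j \<noteq> 0"
          "\<forall>k\<in>I. (\<Sum>j\<in>J-{p}. c' k j * t j) = 0"
        using insert.IH[of "J - {p}" c'] insert.prems by auto
      define s where "s = (\<Sum>j\<in>J-{p}. c i j * t j)"
      define t' where "t' = t(p := - s / c i p)"
      have sum: "(\<Sum>j\<in>J. c k j * t' j) = - c k p * s / c i p + (\<Sum>j\<in>J-{p}. c k j * t j)" for k
      proof -
        have "(\<Sum>j\<in>J. c k j * t' j) = c k p * t' p + (\<Sum>j\<in>J-{p}. c k j * t' j)"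
          using p insert.prems by (simp add: sum.remove)
        also have "(\<Sum>j\<in>J-{p}. c k j * t' j) = (\<Sum>j\<in>J-{p}. c k j * t j)"
          by (intro sum.cong) (auto simp: t'_def)
        finally show ?thesis by (simp add: t'_def)
      qed
      have "(\<Sum>j\<in>J. c k j * t' j) = 0" if "k \<in> I" for k
      proof -
        have "0 = (\<Sum>j\<in>J-{p}. c' k j * t j)"
          using t(2) that by simp
        also have "\<dots> = (\<Sum>j\<in>J-{p}. c k j * t j - c k p / c i p * (c i j * t j))"
          by (intro sum.cong refl) (simp add: c'_def algebra_simps)
        also have "\<dots> = (\<Sum>j\<in>J-{p}. c k j * t j) - c k p / c i p * s"
          by (simp add: sum_subtractf s_def sum_distrib_left)
        finally show ?thesis by (simp add: sum)
      qed
      moreover have "(\<Sum>j\<in>J. c i j * t' j) = 0"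
        using p by (simp add: sum s_def)
      moreover have "\<exists>j\<in>J. t' j \<noteq> 0"
        using t(1) by (auto simp: t'_def)
      ultimately show ?thesis by auto
    qed
  qed
  with that show ?thesis by blast
qed

lemma cnj_mult_self: "cnj z * z = cx ((cmod z)\<^sup>2)"
  by (simp add: complex_norm_square mult.commute del: of_real_power)

text \<open>This says \<open>A = L* D L\<close> with \<open>D\<close> diagonal and \<open>L\<close>
  injective. Unitarity of \<open>L\<close> is not demanded, so congruences act on \<open>L\<close>
  and leave \<open>lam\<close> alone; by Sylvester's law of inertia the negative
  \<open>lam k\<close> still count the negative index.\<close>

definition diagonalizes ::
    "nat \<Rightarrow> (nat \<Rightarrow> nat \<Rightarrow> complex) \<Rightarrow> (nat \<Rightarrow> real) \<Rightarrow> (nat \<Rightarrow> nat \<Rightarrow> complex) \<Rightarrow> bool" where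
  "diagonalizes m A lam L \<longleftrightarrow>
     (\<forall>i<m. \<forall>j<m. A i j = (\<Sum>k<m. cnj (L k i) * cx (lam k) * L k j)) \<and>
     (\<forall>a. (\<forall>k<m. (\<Sum>j<m. L k j * a j) = 0) \<longrightarrow> (\<forall>j<m. a j = 0))"

lemma diagonalizes_entry:
  assumes "diagonalizes m A lam L" "i < m" "j < m"
  shows "A i j = (\<Sum>k<m. cnj (L k i) * cx (lam k) * L k j)"
  using assms unfolding diagonalizes_def by blast

lemma diagonalizes_inj:
  assumes "diagonalizes m A lam L" "\<And>k. k < m \<Longrightarrow> (\<Sum>j<m. L k j * a j) = 0" "j < m"
  shows "a j = 0"
  using assms unfolding diagonalizes_def by blast

lemma diagonalizes_cong:
  assumes "diagonalizes m A lam L" "\<And>i j. i < m \<Longrightarrow> j < m \<Longrightarrow> B i j = A i j"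
  shows "diagonalizes m B lam L"
  unfolding diagonalizes_def
proof (intro conjI allI impI)
  fix i j assume "i < m" "j < m"
  then show "B i j = (\<Sum>k<m. cnj (L k i) * cx (lam k) * L k j)"
    by (simp only: assms(2) diagonalizes_entry[OF assms(1)])
qed (use diagonalizes_inj[OF assms(1)] in blast)

lemma diagonalizes_form:
  assumes "diagonalizes m A lam L"
  shows "(\<Sum>i<m. \<Sum>j<m. cnj (a i) * A i j * a j) =
         cx (\<Sum>k<m. lam k * (cmod (\<Sum>j<m. L k j * a j))\<^sup>2)"
proof -
  have "(\<Sum>i<m. \<Sum>j<m. cnj (a i) * A i j * a j) =
        (\<Sum>i<m. \<Sum>j<m. \<Sum>k<m. cx (lam k) * (cnj (L k i * a i) * (L k j * a j)))"
    by (intro sum.cong refl)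
       (simp add: diagonalizes_entry[OF assms] sum_distrib_left sum_distrib_right mult_ac)
  also have "\<dots> = (\<Sum>k<m. \<Sum>i<m. \<Sum>j<m. cx (lam k) * (cnj (L k i * a i) * (L k j * a j)))"
    by (subst (2) sum.swap, subst sum.swap, rule refl)
  also have "\<dots> = (\<Sum>k<m. cx (lam k) *
                    (\<Sum>i<m. \<Sum>j<m. cnj (L k i * a i) * (L k j * a j)))"
    by (simp only: sum_distrib_left)
  also have "\<dots> = (\<Sum>k<m. cx (lam k) *
                    (cnj (\<Sum>i<m. L k i * a i) * (\<Sum>j<m. L k j * a j)))"
    by (simp only: cnj_sum sum_product)
  also have "\<dots> = cx (\<Sum>k<m. lam k * (cmod (\<Sum>j<m. L k j * a j))\<^sup>2)"
    by (simp only: cnj_mult_self of_real_sum of_real_mult)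
  finally show ?thesis .
qed

lemma diagonalizes_congruence:
  assumes "diagonalizes m A lam L"
    and inj: "\<And>a. (\<forall>p<m. (\<Sum>i<m. T p i * a i) = 0) \<Longrightarrow> \<forall>i<m. a i = 0"
  shows "diagonalizes m (\<lambda>i j. \<Sum>p<m. \<Sum>q<m. cnj (T p i) * A p q * T q j) lam
           (\<lambda>k j. \<Sum>q<m. L k q * T q j)"
  unfolding diagonalizes_def
proof (intro conjI allI impI)
  fix i j
  have "(\<Sum>p<m. \<Sum>q<m. cnj (T p i) * A p q * T q j) =
     (\<Sum>p<m. \<Sum>q<m. \<Sum>k<m. cnj (L k p * T p i) * cx (lam k) * (L k q * T q j))"
    by (intro sum.cong refl)
       (simp add: diagonalizes_entry[OF assms(1)] sum_distrib_left sum_distrib_right mult_ac)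
  also have "\<dots> = (\<Sum>k<m. \<Sum>p<m. \<Sum>q<m. cnj (L k p * T p i) * cx (lam k) * (L k q * T q j))"
    by (subst (2) sum.swap, subst sum.swap, rule refl)
  also have "\<dots> = (\<Sum>k<m. cnj (\<Sum>q<m. L k q * T q i) * cx (lam k) * (\<Sum>q<m. L k q * T q j))"
    by (intro sum.cong refl)
       (simp only: cnj_sum sum_product sum_distrib_left sum_distrib_right mult_ac)
  finally show "(\<Sum>p<m. \<Sum>q<m. cnj (T p i) * A p q * T q j) = \<dots>" .
next
  fix a j assume a: "\<forall>k<m. (\<Sum>j<m. (\<Sum>q<m. L k q * T q j) * a j) = 0" and "j < m"
  have "(\<Sum>q<m. L k q * (\<Sum>j<m. T q j * a j)) = 0" if "k < m" for k
  proof -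
    have "(\<Sum>q<m. L k q * (\<Sum>j<m. T q j * a j)) = (\<Sum>q<m. \<Sum>j<m. L k q * T q j * a j)"
      by (simp add: sum_distrib_left mult_ac)
    also have "\<dots> = (\<Sum>j<m. (\<Sum>q<m. L k q * T q j) * a j)"
      by (subst sum.swap) (simp add: sum_distrib_right)
    finally show ?thesis using a that by simp
  qed
  then have "\<forall>q<m. (\<Sum>j<m. T q j * a j) = 0"
    using diagonalizes_inj[OF assms(1), of "\<lambda>q. \<Sum>j<m. T q j * a j"] by blast
  then show "a j = 0" using inj \<open>j < m\<close> by blast
qed

lemma diagonalizes_scale:
  assumes "diagonalizes m A lam L" and "\<And>j. j < m \<Longrightarrow> b j \<noteq> 0"
  shows "diagonalizes m (\<lambda>i j. cnj (b i) * A i j * b j) lam (\<lambda>k j. L k j * b j)"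
proof -
  show ?thesis
    unfolding diagonalizes_def
  proof (intro conjI allI impI)
    fix i j assume "i < m" "j < m"
    then show "cnj (b i) * A i j * b j =
        (\<Sum>k<m. cnj (L k i * b i) * cx (lam k) * (L k j * b j))"
      by (simp add: diagonalizes_entry[OF assms(1)] sum_distrib_left sum_distrib_right mult_ac)
  next
    fix a j assume a: "\<forall>k<m. (\<Sum>j<m. L k j * b j * a j) = 0" and "j < m"
    have "b j * a j = 0"
      by (rule diagonalizes_inj[OF assms(1) _ \<open>j < m\<close>]) (use a in \<open>simp add: mult.assoc\<close>)
    then show "a j = 0" using assms(2) \<open>j < m\<close> by simp
  qed
qed

text \<open>If \<open>lam k\<close> vanished, the other \<open>m - 1\<close> rows of
  \<open>L\<close> would have a common nonzero null vector, and \<open>A\<close> would annihilate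
  it.\<close>

lemma diagonalizes_nonzero:
  assumes d: "diagonalizes m A lam L" and "k < m"
    and inj: "\<And>a. (\<forall>i<m. (\<Sum>j<m. A i j * a j) = 0) \<Longrightarrow> \<forall>j<m. a j = 0"
  shows "lam k \<noteq> 0"
proof
  assume z: "lam k = 0"
  obtain t where t: "\<exists>j\<in>{..<m}. t j \<noteq> 0" "\<And>i. i \<in> {..<m}-{k} \<Longrightarrow> (\<Sum>j\<in>{..<m}. L i j * t j) = 0"
    using homogeneous_system_nontrivial[of "{..<m}-{k}" "{..<m}" L] \<open>k < m\<close> by auto
  have "(\<Sum>j<m. A i j * t j) = 0" if "i < m" for i
  proof -
    have "(\<Sum>j<m. A i j * t j) = (\<Sum>j<m. \<Sum>k<m. cnj (L k i) * cx (lam k) * (L k j * t j))"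
      by (intro sum.cong refl)
         (simp add: diagonalizes_entry[OF d that] sum_distrib_left sum_distrib_right mult_ac)
    also have "\<dots> = (\<Sum>k<m. cnj (L k i) * cx (lam k) * (\<Sum>j<m. L k j * t j))"
      by (subst sum.swap) (simp add: sum_distrib_left)
    also have "\<dots> = 0"
    proof (intro sum.neutral ballI)
      fix l assume "l \<in> {..<m}"
      then show "cnj (L l i) * cx (lam l) * (\<Sum>j<m. L l j * t j) = 0"
        using t(2)[of l] z by (cases "l = k") auto
    qed
    finally show ?thesis .
  qed
  then show False using inj t(1) by blast
qed

section \<open>Diagonalization of Hermitian matrices by reflections\<close>

lemma householder_exists:
  fixes v :: "nat \<Rightarrow> complex"
  assumes "\<exists>i<m. v i \<noteq> 0" and "0 < m"
  obtains H s where
    "\<And>i j. H j i = cnj (H i j)"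
    "\<And>i j. i < m \<Longrightarrow> j < m \<Longrightarrow> (\<Sum>k<m. H i k * H k j) = (if i = j then 1 else 0)"
    "\<And>i. i < m \<Longrightarrow> H i 0 = s * v i"
proof -
  define N where "N = sqrt (\<Sum>i<m. (cmod (v i))\<^sup>2)"
  have N0: "N > 0"
  proof -
    from assms obtain i where i: "i < m" "v i \<noteq> 0" by auto
    have "0 < (cmod (v i))\<^sup>2" using i by simp
    also have "\<dots> \<le> (\<Sum>i<m. (cmod (v i))\<^sup>2)"
      by (rule member_le_sum) (use i in auto)
    finally show ?thesis unfolding N_def by simp
  qed
  \<comment> \<open>The phase makes the first coordinate of the unit vector \<open>u\<close> equal
    to \<open>- r\<close> with \<open>r >= 0\<close>. The reflection vector
    \<open>q = u - e_0\<close> then has squared norm \<open>2 * (1 + r)\<close>, which is never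
    zero, so \<open>u\<close> parallel to \<open>e_0\<close> is no special case.\<close>
  define ph where "ph = (if v 0 = 0 then 1 else - cnj (v 0) / cmod (v 0))"
  have ph: "cmod ph = 1" by (auto simp: ph_def norm_divide)
  define s where "s = ph / cx N"
  define u where "u = (\<lambda>i. s * v i)"
  define r where "r = cmod (v 0) / N"
  have u0: "u 0 = - cx r"
  proof -
    have "cnj (v 0) * v 0 = cx (cmod (v 0)) * cx (cmod (v 0))"
      by (simp add: complex_norm_square[symmetric] power2_eq_square[symmetric] mult.commute)
    then have "ph * v 0 = - cx (cmod (v 0))"
      by (auto simp: ph_def)
    then show ?thesis by (simp add: u_def s_def r_def)
  qed
  have r0: "r \<ge> 0" using N0 by (simp add: r_def)
  have unorm: "(\<Sum>i<m. cnj (u i) * u i) = 1"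
  proof -
    have "(\<Sum>i<m. cnj (u i) * u i) = cx (\<Sum>i<m. (cmod (u i))\<^sup>2)"
      by (simp only: cnj_mult_self of_real_sum)
    also have "(\<Sum>i<m. (cmod (u i))\<^sup>2) = (\<Sum>i<m. (cmod (v i))\<^sup>2 / N\<^sup>2)"
      using ph N0 by (simp add: u_def s_def norm_mult norm_divide power_mult_distrib power_divide)
    also have "\<dots> = 1"
      unfolding sum_divide_distrib[symmetric] using N0
      by (simp add: N_def sum_nonneg)
    finally show ?thesis by simp
  qed
  define q where "q = (\<lambda>i. u i - (if i = 0 then 1 else 0))"
  have split0: "(\<Sum>i<m. f i * (if i = 0 then 1 else 0)) = f 0" for f :: "nat \<Rightarrow> complex"
    using assms(2) by (simp add: if_distrib cong: if_cong)
  have qq: "(\<Sum>i<m. cnj (q i) * q i) = 2 * (1 + cx r)"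
  proof -
    have "(\<Sum>i<m. cnj (q i) * q i) = (\<Sum>i<m. cnj (u i) * u i) - (\<Sum>i<m. cnj (u i) * (if i = 0 then 1 else 0))
      - (\<Sum>i<m. u i * (if i = 0 then 1 else 0)) + (\<Sum>i<m. 1 * (if i = 0 then 1 else 0))"
      unfolding sum_subtractf[symmetric] sum.distrib[symmetric]
      by (intro sum.cong refl) (auto simp: q_def algebra_simps)
    also have "\<dots> = 2 * (1 + cx r)"
      unfolding split0 unorm by (simp add: u0)
    finally show ?thesis .
  qed
  \<comment> \<open>The reflection that exchanges \<open>e_0\<close> and \<open>u\<close>; it is
    Hermitian and its own inverse.\<close>
  define H where "H = (\<lambda>i j. (if i = j then 1 else 0) - q i * cnj (q j) / (1 + cx r))"
  have nz: "1 + cx r \<noteq> 0"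
    using r0 by (metis add.commute add_nonneg_eq_0_iff of_real_1 of_real_add of_real_eq_0_iff zero_le_one zero_neq_one)
  have "H j i = cnj (H i j)" for i j by (simp add: H_def)
  moreover have "(\<Sum>k<m. H i k * H k j) = (if i = j then 1 else 0)" if "i < m" "j < m" for i j
  proof -
    have sd: "(\<Sum>k<m. (if i = k then 1 else 0) * f k) = f i" "(\<Sum>k<m. f k * (if k = j then 1 else 0)) = f j"
      for f :: "nat \<Rightarrow> complex" using that by (simp_all add: if_distrib if_distribR cong: if_cong)
    have "(\<Sum>k<m. H i k * H k j) = (\<Sum>k<m. (if i = k then 1 else 0) * (if k = j then 1 else 0))
       - (\<Sum>k<m. (if i = k then 1 else 0) * (q k * cnj (q j) / (1 + cx r)))
       - (\<Sum>k<m. (q i * cnj (q k) / (1 + cx r)) * (if k = j then 1 else 0))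
       + q i * cnj (q j) / (1 + cx r)^2 * (\<Sum>k<m. cnj (q k) * q k)"
      unfolding sum_subtractf[symmetric] sum.distrib[symmetric] sum_distrib_left
      by (intro sum.cong refl) (simp add: H_def algebra_simps power2_eq_square)
    also have "\<dots> = (if i = j then 1 else 0)"
    proof -
      have "y / w\<^sup>2 * (2 * w) = y / w + y / w" if "w \<noteq> 0" for y w :: complex
        using that by (simp add: power2_eq_square)
      from this[OF nz] show ?thesis unfolding sd qq by simp
    qed
    finally show ?thesis .
  qed
  moreover have "H i 0 = s * v i" if "i < m" for i
  proof -
    have "cnj (q 0) = - (1 + cx r)" by (simp add: q_def u0)
    then have "H i 0 = (if i = 0 then 1 else 0) + q i" using nz by (simp add: H_def divide_simps) (simp add: algebra_simps)
    then show ?thesis by (simp add: q_def u_def)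
  qed
  ultimately show ?thesis using that by blast
qed

text \<open>Deflation by induction on the size: the reflection whose first column is an eigenvector
  splits off one eigenvalue. Since the reflection is Hermitian and its own inverse, the product
  \<open>U * A * U\<close> is at once a similarity, which keeps \<open>char_poly\<close>, and a
  congruence, which keeps the form.\<close>

lemma hermitian_diagonalization:
  assumes "A \<in> carrier_mat m m"
    and "\<And>i j. i < m \<Longrightarrow> j < m \<Longrightarrow> A $$ (j, i) = cnj (A $$ (i, j))"
  shows "\<exists>lam L. diagonalizes m (\<lambda>i j. A $$ (i, j)) lam L \<and>
           char_poly A = (\<Prod>k<m. [:- cx (lam k), 1:])"
  using assms
proof (induction m arbitrary: A)
  case 0
  then have "char_poly A = 1"
    by (simp add: char_poly_def char_poly_matrix_def Determinant.det_def)
  then show ?case by (simp add: diagonalizes_def)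
next
  case (Suc m)
  define n where "n = Suc m"
  have A: "A \<in> carrier_mat n n" and herm: "\<And>i j. i < n \<Longrightarrow> j < n \<Longrightarrow> A $$ (j, i) = cnj (A $$ (i, j))"
    using Suc.prems unfolding n_def by blast+
  obtain as where "char_poly A = (\<Prod>a\<leftarrow>as. [:- a, 1:])" "length as = n"
    using char_poly_factorized[OF A] by auto
  then have "poly (char_poly A) (hd as) = 0"
    by (cases as) (auto simp: n_def)
  then have ev: "eigenvalue A (hd as)"
    using eigenvalue_root_char_poly[OF A] by blast
  define r where "r = hd as"
  obtain v where v: "v \<in> carrier_vec n" "v \<noteq> 0\<^sub>v n" "A *\<^sub>v v = r \<cdot>\<^sub>v v"
    using ev A unfolding eigenvalue_def eigenvector_def r_def by auto
  have Av: "(\<Sum>j<n. A $$ (i, j) * vec_index v j) = r * vec_index v i" if "i < n" for i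
  proof -
    have "vec_index (A *\<^sub>v v) i = r * vec_index v i" using v that by simp
    moreover have "vec_index (A *\<^sub>v v) i = (\<Sum>j<n. A $$ (i, j) * vec_index v j)"
      using A v(1) that by (simp add: scalar_prod_def atLeast0LessThan)
    ultimately show ?thesis by simp
  qed
  have n0: "0 < n" by (simp add: n_def)
  have vnz: "\<exists>i<n. vec_index v i \<noteq> 0"
    using v by (metis carrier_vecD eq_vecI index_zero_vec(1) index_zero_vec(2))
  obtain H s where H: "\<And>i j. H j i = cnj (H i j)"
    "\<And>i j. i < n \<Longrightarrow> j < n \<Longrightarrow> (\<Sum>k<n. H i k * H k j) = (if i = j then 1 else 0)"
    "\<And>i. i < n \<Longrightarrow> H i 0 = s * vec_index v i"
    by (rule householder_exists[OF vnz n0]) (rule that, assumption+)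
  define U where "U = Matrix.mat n n (\<lambda>(i,j). H i j)"
  have U: "U \<in> carrier_mat n n" by (simp add: U_def)
  have UU: "U * U = 1\<^sub>m n"
    by (intro eq_matI) (auto simp: U_def scalar_prod_def atLeast0LessThan H(2))
  define B where "B = U * A * U"
  have B: "B \<in> carrier_mat n n" using U A by (auto simp: B_def)
  have sim: "similar_mat A B"
    unfolding similar_mat_def similar_mat_wit_def Let_def
  proof (intro exI[of _ U] conjI)
    have "U * B * U = (U * U) * A * (U * U)"
      using U A by (simp add: B_def assoc_mult_mat[of _ n n _ n _ n])
    then show "A = U * B * U" using UU A by simp
  qed (use A B U UU in auto)
  have Bij: "B $$ (i, j) = (\<Sum>p<n. \<Sum>q<n. cnj (H p i) * A $$ (p, q) * H q j)" if "i < n" "j < n" for i j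
  proof -
    have "B $$ (i, j) = (\<Sum>q<n. (\<Sum>p<n. H i p * A $$ (p, q)) * H q j)"
      using that A by (simp add: B_def U_def scalar_prod_def atLeast0LessThan)
    also have "\<dots> = (\<Sum>p<n. \<Sum>q<n. cnj (H p i) * A $$ (p, q) * H q j)"
      by (subst sum.swap) (simp add: sum_distrib_right H(1)[of i, symmetric])
    finally show ?thesis .
  qed
  have "A = U * B * U"
  proof -
    have "U * B * U = (U * U) * A * (U * U)"
      using U A by (simp add: B_def assoc_mult_mat[of _ n n _ n _ n])
    then show ?thesis using UU A by simp
  qed
  then have Aij: "A $$ (i, j) = (\<Sum>p<n. \<Sum>q<n. cnj (H p i) * B $$ (p, q) * H q j)" if "i < n" "j < n" for i j
  proof -
    have "(U * B * U) $$ (i, j) = (\<Sum>q<n. (\<Sum>p<n. H i p * B $$ (p, q)) * H q j)"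
      using that B by (simp add: U_def scalar_prod_def atLeast0LessThan)
    also have "\<dots> = (\<Sum>p<n. \<Sum>q<n. cnj (H p i) * B $$ (p, q) * H q j)"
      by (subst sum.swap) (simp add: sum_distrib_right H(1)[of i, symmetric])
    finally show ?thesis using \<open>A = U * B * U\<close> by simp
  qed
  have Bherm: "B $$ (j, i) = cnj (B $$ (i, j))" if "i < n" "j < n" for i j
  proof -
    have "cnj (B $$ (i, j)) = (\<Sum>p<n. \<Sum>q<n. H p i * cnj (A $$ (p, q)) * cnj (H q j))"
      by (simp add: Bij that cnj_sum)
    also have "\<dots> = (\<Sum>p<n. \<Sum>q<n. cnj (H q j) * A $$ (q, p) * H p i)"
      by (intro sum.cong refl) (simp add: herm[symmetric])
    also have "\<dots> = B $$ (j, i)"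
      by (subst sum.swap) (simp add: Bij that)
    finally show ?thesis by simp
  qed
  have B0: "B $$ (i, 0) = (if i = 0 then r else 0)" if "i < n" for i
  proof -
    have "B $$ (i, 0) = (\<Sum>p<n. H i p * (\<Sum>q<n. A $$ (p, q) * H q 0))"
      using that n0 by (simp add: Bij sum_distrib_left mult_ac H(1)[of i, symmetric])
    also have "\<dots> = (\<Sum>p<n. H i p * (s * (\<Sum>q<n. A $$ (p, q) * vec_index v q)))"
      by (intro sum.cong refl) (simp add: H(3) sum_distrib_left mult_ac)
    also have "\<dots> = (\<Sum>p<n. H i p * (s * (r * vec_index v p)))"
      by (simp add: Av)
    also have "\<dots> = r * (\<Sum>p<n. H i p * H p 0)"
      by (simp add: H(3) sum_distrib_left mult_ac)
    also have "\<dots> = (if i = 0 then r else 0)"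
      using that by (subst H(2)) (auto simp: n_def)
    finally show ?thesis .
  qed
  have rreal: "r = cx (Re r)"
    using Bherm[of 0 0] B0[of 0] by (simp add: n_def complex_eq_iff)
  have B0': "B $$ (0, j) = (if j = 0 then r else 0)" if "j < n" for j
    using Bherm[of j 0] B0[of j] that rreal by (auto simp: n_def complex_eq_iff)
  define D where "D = Matrix.mat m m (\<lambda>(i, j). B $$ (Suc i, Suc j))"
  have D: "D \<in> carrier_mat m m" by (simp add: D_def)
  have "D $$ (j, i) = cnj (D $$ (i, j))" if "i < m" "j < m" for i j
    using that Bherm[of "Suc i" "Suc j"] by (simp add: D_def n_def)
  then obtain lam L where IH: "diagonalizes m (\<lambda>i j. D $$ (i, j)) lam L"
     "char_poly D = (\<Prod>k<m. [:- cx (lam k), 1:])"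
    using Suc.IH[OF D] by blast
  define R where "R = Matrix.mat 1 1 (\<lambda>_. r)"
  have R: "R \<in> carrier_mat 1 1" by (simp add: R_def)
  have cpR: "char_poly R = [:- r, 1:]"
    by (subst char_poly_upper_triangular[OF R]) (auto simp: R_def diag_mat_def upper_triangular_def)
  have block: "B = four_block_mat R (0\<^sub>m 1 m) (0\<^sub>m m 1) D"
  proof (intro eq_matI)
    fix i j assume "i < dim_row (four_block_mat R (0\<^sub>m 1 m) (0\<^sub>m m 1) D)"
       "j < dim_col (four_block_mat R (0\<^sub>m 1 m) (0\<^sub>m m 1) D)"
    then have "i < n" "j < n" using R D by (auto simp: n_def)
    then show "B $$ (i, j) = four_block_mat R (0\<^sub>m 1 m) (0\<^sub>m m 1) D $$ (i, j)"
      using B0[of i] B0'[of j] R D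
      by (cases i; cases j) (auto simp: n_def R_def D_def)
  qed (use B R D in \<open>auto simp: n_def\<close>)
  have "char_poly B = char_poly R * char_poly D"
  proof (rule char_poly_0_block[OF block _ _ R _ D])
    show "\<exists>es. char_poly R = (\<Prod>a\<leftarrow>es. [:- a, 1:])"
      by (rule exI[of _ "[r]"]) (simp add: cpR)
    show "\<exists>es. char_poly D = (\<Prod>a\<leftarrow>es. [:- a, 1:])"
      using char_poly_factorized[OF D] by auto
  qed auto
  define lam' where "lam' = case_nat (Re r) lam"
  define L' where "L' = (\<lambda>k j. case k of 0 \<Rightarrow> (if j = 0 then 1 else 0)
       | Suc k' \<Rightarrow> (case j of 0 \<Rightarrow> 0 | Suc j' \<Rightarrow> L k' j'))"
  have lessThan_n: "(\<Sum>k<n. f k) = f 0 + (\<Sum>k<m. f (Suc k))" for f :: "nat \<Rightarrow> complex"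
    unfolding n_def by (rule sum.lessThan_Suc_shift)
  have dB: "diagonalizes n (\<lambda>i j. B $$ (i, j)) lam' L'"
    unfolding diagonalizes_def
  proof (intro conjI allI impI)
    fix i j assume ij: "i < n" "j < n"
    show "B $$ (i, j) = (\<Sum>k<n. cnj (L' k i) * cx (lam' k) * L' k j)"
    proof (cases "i = 0 \<or> j = 0")
      case True
      then show ?thesis
        using B0[of i] B0'[of j] ij rreal unfolding lessThan_n
        by (cases i; cases j) (auto simp: L'_def lam'_def)
    next
      case False
      then obtain i' j' where "i = Suc i'" "j = Suc j'" by (metis not0_implies_Suc)
      then show ?thesis
        using diagonalizes_entry[OF IH(1), of i' j'] ij unfolding lessThan_n
        by (simp add: L'_def lam'_def D_def n_def)
    qed
  next
    fix a j assume a: "\<forall>k<n. (\<Sum>j<n. L' k j * a j) = 0" and j: "j < n"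
    have "a 0 = 0" using a[rule_format, of 0] unfolding lessThan_n by (simp add: n_def L'_def)
    moreover have "a (Suc j') = 0" if "j' < m" for j'
    proof (rule diagonalizes_inj[OF IH(1) _ that])
      fix k assume "k < m"
      then show "(\<Sum>j<m. L k j * a (Suc j)) = 0"
        using a[rule_format, of "Suc k"] unfolding lessThan_n by (simp add: n_def L'_def)
    qed
    ultimately show "a j = 0" using j by (cases j) (auto simp: n_def)
  qed
  have injH: "\<forall>i<n. a i = 0" if "\<forall>p<n. (\<Sum>i<n. H p i * a i) = 0" for a
  proof (intro allI impI)
    fix i assume i: "i < n"
    have "0 = (\<Sum>p<n. H i p * (\<Sum>j<n. H p j * a j))" using that by simp
    also have "\<dots> = (\<Sum>j<n. (\<Sum>p<n. H i p * H p j) * a j)"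
      unfolding sum_distrib_left sum_distrib_right by (subst sum.swap) (simp add: mult_ac)
    also have "\<dots> = (\<Sum>j<n. (if i = j then 1 else 0) * a j)"
      by (intro sum.cong refl) (simp add: H(2) i)
    also have "\<dots> = a i" using i by (simp add: if_distrib if_distribR cong: if_cong)
    finally show "a i = 0" by simp
  qed
  define L'' where "L'' = (\<lambda>k j. \<Sum>q<n. L' k q * H q j)"
  have dA: "diagonalizes n (\<lambda>i j. \<Sum>p<n. \<Sum>q<n. cnj (H p i) * B $$ (p, q) * H q j) lam' L''"
    unfolding L''_def by (rule diagonalizes_congruence[OF dB injH])
  have "diagonalizes n (\<lambda>i j. A $$ (i, j)) lam' L''"
    by (rule diagonalizes_cong[OF dA Aij])
  moreover have "char_poly A = (\<Prod>k<n. [:- cx (lam' k), 1:])"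
    using char_poly_similar[OF sim] \<open>char_poly B = _\<close> cpR IH(2) rreal
    by (simp add: n_def prod.lessThan_Suc_shift lam'_def del: prod.lessThan_Suc)
  ultimately show ?case unfolding n_def by blast
qed

text \<open>The order of a root of the product is the number of \<open>k\<close> with that
  \<open>lam k\<close>; summing over the distinct negative roots counts each index once.\<close>

lemma num_neg_eigenvalues_eq_card:
  assumes A: "A \<in> carrier_mat m m"
    and cp: "char_poly A = (\<Prod>k<m. [:- cx (lam k), 1:])"
  shows "num_neg_eigenvalues A = card {k. k < m \<and> lam k < 0}"
proof -
  have ord: "Polynomial.order (cx r) (\<Prod>k\<in>K. [:- cx (lam k), 1:]) =
      card {k \<in> K. lam k = r}" if "finite K" for r K
    using that
  proof (induction K rule: finite_induct)
    case (insert k K)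
    have nz: "[:- cx (lam k), 1:] * (\<Prod>k\<in>K. [:- cx (lam k), 1:]) \<noteq> 0"
      using insert.hyps(1) by (simp del: mult_pCons_left)
    have "Polynomial.order (cx r) [:- cx (lam k), 1:] = (if lam k = r then 1 else 0)"
      by (auto simp: order_linear' )
    moreover have "{j \<in> insert k K. lam j = r} = (if lam k = r then insert k {j \<in> K. lam j = r} else {j \<in> K. lam j = r})"
      by auto
    ultimately show ?case
      using insert nz by (simp add: Polynomial.order_mult del: mult_pCons_left)
  qed auto
  have ev: "eigenvalue A (cx r) \<longleftrightarrow> r \<in> lam ` {..<m}" for r
    unfolding eigenvalue_root_char_poly[OF A] cp poly_prod by auto
  have "num_neg_eigenvalues A = (\<Sum>r\<in>{r \<in> lam ` {..<m}. r < 0}. card {k \<in> {..<m}. lam k = r})"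
    unfolding num_neg_eigenvalues_def ev cp ord[OF finite_lessThan] by (rule sum.cong) auto
  also have "\<dots> = card (\<Union>r\<in>{r \<in> lam ` {..<m}. r < 0}. {k \<in> {..<m}. lam k = r})"
    by (rule card_UN_disjoint[symmetric]) auto
  also have "(\<Union>r\<in>{r \<in> lam ` {..<m}. r < 0}. {k \<in> {..<m}. lam k = r}) = {k. k < m \<and> lam k < 0}"
    by auto
  finally show ?thesis .
qed

lemma hermitian_inertia:
  assumes "A \<in> carrier_mat m m"
    and "\<And>i j. i < m \<Longrightarrow> j < m \<Longrightarrow> A $$ (j, i) = cnj (A $$ (i, j))"
  obtains lam L where "diagonalizes m (\<lambda>i j. A $$ (i, j)) lam L"
    "num_neg_eigenvalues A = card {k. k < m \<and> lam k < 0}"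
proof -
  obtain lam L where "diagonalizes m (\<lambda>i j. A $$ (i, j)) lam L"
     "char_poly A = (\<Prod>k<m. [:- cx (lam k), 1:])"
    using hermitian_diagonalization[OF assms] by blast
  with that num_neg_eigenvalues_eq_card[OF assms(1)] show ?thesis by blast
qed


section \<open>Nevanlinna kernels and the Julia-Caratheodory theorem\<close>

definition nev_psd :: "(complex \<Rightarrow> complex) \<Rightarrow> bool" where
  "nev_psd f \<longleftrightarrow> (\<forall>(m::nat) z a. (\<forall>j<m. z j \<in> UHP) \<longrightarrow>
     0 \<le> Re (\<Sum>i<m. \<Sum>j<m. cnj (a i) * nev_kernel f (z j) (z i) * a j))"

text \<open>In \<open>H\<close> this is the squared norm of the combination of the kernel functions
  at the points \<open>z i\<close> with coefficients \<open>cnj (a i)\<close>. The index type is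
  arbitrary because boundary points will be adjoined to given points.\<close>

definition gram :: "(complex \<Rightarrow> complex) \<Rightarrow> 'i set \<Rightarrow> ('i \<Rightarrow> complex) \<Rightarrow> ('i \<Rightarrow> complex) \<Rightarrow> real" where
  "gram f I z a = Re (\<Sum>i\<in>I. \<Sum>j\<in>I. cnj (a i) * nev_kernel f (z j) (z i) * a j)"

text \<open>With \<open>h\<close> the combination of the kernel functions at \<open>z j\<close> with
  coefficients \<open>cnj (a j)\<close>, the sum on the left is the inner product of
  \<open>u\<close> with \<open>h\<close>. For positive \<open>f\<close> the condition thus says that
  \<open>u\<close> lies in \<open>H\<close> with squared norm at most \<open>c\<close>.\<close>

definition dominated :: "(complex \<Rightarrow> complex) \<Rightarrow> (complex \<Rightarrow> complex) \<Rightarrow> real \<Rightarrow> bool" where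
  "dominated f u c \<longleftrightarrow> (\<forall>(m::nat) z a. (\<forall>j<m. z j \<in> UHP) \<longrightarrow>
     2 * Re (\<Sum>j<m. a j * u (z j)) \<le> gram f {..<m} z a + c)"

lemma gram_reindex:
  assumes "bij_betw h J I"
  shows "gram f I z a = gram f J (z \<circ> h) (a \<circ> h)"
  unfolding gram_def by (simp flip: sum.reindex_bij_betw[OF assms])

lemma gram_nonneg:
  assumes "nev_psd f" "finite I" "\<And>j. j \<in> I \<Longrightarrow> z j \<in> UHP"
  shows "0 \<le> gram f I z a"
proof -
  obtain h where h: "bij_betw h {..<card I} I"
    using ex_bij_betw_nat_finite[OF assms(2)] by (auto simp: atLeast0LessThan)
  then have "\<forall>j<card I. (z \<circ> h) j \<in> UHP"
    using assms(3) by (auto simp: bij_betw_def)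
  with assms(1) show ?thesis
    unfolding gram_reindex[OF h] unfolding gram_def nev_psd_def by blast
qed

lemma diff_divide_swap: "(a - b) / (c - d) = (b - a) / (d - c)" for a :: "'a::field"
  by (metis minus_diff_eq minus_divide_divide)

lemma Complex_of_real: "Complex r 0 = cx r"
  by (simp add: complex_eq_iff)

lemma cnj_nev_kernel: "cnj (nev_kernel f z w) = nev_kernel f w z"
  by (simp add: nev_kernel_def diff_divide_swap[of "f w"])

lemma nev_kernel_diag:
  assumes "z \<in> UHP"
  shows "nev_kernel f z z = cx (Im (f z) / Im z)"
proof -
  have "f z - cnj (f z) = 2 * \<i> * cx (Im (f z))"
       "z - cnj z = 2 * \<i> * cx (Im z)"
    by (simp_all add: complex_diff_cnj mult_ac)
  then show ?thesis using assms by (simp add: nev_kernel_def upper_half_plane_def)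
qed

lemma nev_psd_Im_nonneg:
  assumes "nev_psd f" "z \<in> UHP"
  shows "0 \<le> Im (f z)"
proof -
  have "0 \<le> gram f {..<Suc 0} (\<lambda>_. z) (\<lambda>_. 1)"
    using assms by (intro gram_nonneg) auto
  then have "0 \<le> Im (f z) / Im z"
    using nev_kernel_diag[OF assms(2)] by (simp add: gram_def)
  moreover have "Im z > 0" using assms(2) by (simp add: upper_half_plane_def)
  ultimately show ?thesis by (simp add: zero_le_divide_iff)
qed

text \<open>A point adjoined with free weight \<open>t\<close> makes the Gram form a quadratic
  polynomial in \<open>t\<close>, ready for \<open>quadratic_bound\<close> or for a limit of
  \<open>w\<close> to the boundary.\<close>

lemma gram_Suc:
  assumes "w \<in> UHP"
  shows "gram f {..<Suc m} (z(m := w)) (a(m := t)) =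
    gram f {..<m} z a + 2 * Re (t * (\<Sum>i<m. cnj (a i) * nev_kernel f w (z i))) +
      (cmod t)\<^sup>2 * (Im (f w) / Im w)"
proof -
  define X where "X = (\<Sum>i<m. cnj (a i) * nev_kernel f w (z i))"
  have "(\<Sum>i<Suc m. \<Sum>j<Suc m. cnj ((a(m := t)) i) * nev_kernel f ((z(m := w)) j) ((z(m := w)) i) * (a(m := t)) j)
    = (\<Sum>i<m. (\<Sum>j<m. cnj (a i) * nev_kernel f (z j) (z i) * a j) + cnj (a i) * nev_kernel f w (z i) * t)
      + ((\<Sum>j<m. cnj t * nev_kernel f (z j) w * a j) + cnj t * nev_kernel f w w * t)"
    unfolding sum.lessThan_Suc by (intro arg_cong2[of _ _ _ _ "(+)"] sum.cong refl) auto
  also have "\<dots> = (\<Sum>i<m. \<Sum>j<m. cnj (a i) * nev_kernel f (z j) (z i) * a j) + t * X + cnj (t * X)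
      + cnj t * t * nev_kernel f w w"
    by (simp add: sum.distrib X_def sum_distrib_left cnj_sum cnj_nev_kernel mult_ac)
  also have "Re \<dots> = gram f {..<m} z a + 2 * Re (t * X) + (cmod t)\<^sup>2 * (Im (f w) / Im w)"
    unfolding cnj_mult_self nev_kernel_diag[OF assms] of_real_mult[symmetric]
    by (simp add: gram_def)
  finally show ?thesis by (simp only: gram_def X_def)
qed

lemma quadratic_bound_real:
  fixes q \<alpha> B :: real
  assumes "\<And>s. 2 * s * q \<le> \<alpha> + s\<^sup>2 * B" "0 \<le> B"
  shows "q\<^sup>2 \<le> \<alpha> * B"
proof (cases "B = 0")
  case True
  have "q = 0"
  proof (rule ccontr)
    assume "q \<noteq> 0"
    \<comment> \<open>For \<open>B = 0\<close> this \<open>s\<close> turns the assumption into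
      \<open>\<alpha> + 1 <= \<alpha>\<close>.\<close>
    then show False using assms(1)[of "(\<alpha> + 1) / (2 * q)"] True by simp
  qed
  then show ?thesis using True by simp
next
  case False
  then have "B > 0" using assms(2) by simp
  have "2 * (q / B) * q \<le> \<alpha> + (q / B)\<^sup>2 * B" by (rule assms(1))
  then have "q\<^sup>2 / B \<le> \<alpha>" using False by (simp add: power2_eq_square)
  with \<open>B > 0\<close> show ?thesis by (simp add: divide_le_eq)
qed

text \<open>A discriminant estimate, from which the Cauchy-Schwarz inequalities in \<open>H\<close>
  are obtained.\<close>

lemma quadratic_bound:
  fixes q :: complex
  assumes "\<And>t. 2 * Re (t * q) \<le> \<alpha> + (cmod t)\<^sup>2 * B" "0 \<le> B"
  shows "(cmod q)\<^sup>2 \<le> \<alpha> * B"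
proof (cases "q = 0")
  case True
  have "0 \<le> \<alpha>" using assms(1)[of 0] by simp
  then show ?thesis using True assms(2) by simp
next
  case False
  \<comment> \<open>The choice \<open>t = s * cnj q\<close> with real \<open>s\<close> reduces to
    the real case.\<close>
  have "((cmod q)\<^sup>2)\<^sup>2 \<le> \<alpha> * ((cmod q)\<^sup>2 * B)"
  proof (rule quadratic_bound_real)
    fix s :: real
    have "2 * Re ((cx s * cnj q) * q) \<le> \<alpha> + (cmod (cx s * cnj q))\<^sup>2 * B"
      by (rule assms(1))
    then show "2 * s * (cmod q)\<^sup>2 \<le> \<alpha> + s\<^sup>2 * ((cmod q)\<^sup>2 * B)"
      unfolding mult.assoc cnj_mult_self of_real_mult[symmetric] Re_complex_of_real
      by (simp add: norm_mult power_mult_distrib mult_ac)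
  qed (use assms(2) in simp)
  then have "(cmod q)\<^sup>2 * (cmod q)\<^sup>2 \<le> (cmod q)\<^sup>2 * (\<alpha> * B)"
    by (simp add: power2_eq_square mult_ac)
  moreover have "0 < (cmod q)\<^sup>2" using False by simp
  ultimately show ?thesis by (rule mult_left_le_imp_le)
qed

lemma dominated_reindex:
  assumes "dominated f u c" "finite I" "\<And>j. j \<in> I \<Longrightarrow> z j \<in> UHP"
  shows "2 * Re (\<Sum>j\<in>I. a j * u (z j)) \<le> gram f I z a + c"
proof -
  obtain h where h: "bij_betw h {..<card I} I"
    using ex_bij_betw_nat_finite[OF assms(2)] by (auto simp: atLeast0LessThan)
  then have "\<forall>j<card I. (z \<circ> h) j \<in> UHP"
    using assms(3) by (auto simp: bij_betw_def)
  with assms(1) have "2 * Re (\<Sum>j<card I. (a \<circ> h) j * u ((z \<circ> h) j)) \<le> gram f {..<card I} (z \<circ> h) (a \<circ> h) + c"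
    unfolding dominated_def by blast
  then show ?thesis
    unfolding gram_reindex[OF h] by (simp add: sum.reindex_bij_betw[OF h, of "\<lambda>j. a j * u (z j)"])
qed

text \<open>Cauchy-Schwarz in \<open>H\<close> against a single kernel function, whose squared norm
  is \<open>Im (f z) / Im z\<close>.\<close>

lemma dominated_pointwise:
  assumes "dominated f u c" "nev_psd f" "z \<in> UHP"
  shows "(cmod (u z))\<^sup>2 \<le> c * (Im (f z) / Im z)"
proof (rule quadratic_bound)
  fix t
  have "2 * Re (\<Sum>j<Suc 0. t * u z) \<le> gram f {..<Suc 0} (\<lambda>_. z) (\<lambda>_. t) + c"
    using assms(1)[unfolded dominated_def, rule_format, of "Suc 0" "\<lambda>_. z" "\<lambda>_. t"] assms(3)
    by simp
  moreover have "gram f {..<Suc 0} (\<lambda>_. z) (\<lambda>_. t) = (cmod t)\<^sup>2 * (Im (f z) / Im z)"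
  proof -
    have "gram f {..<Suc 0} (\<lambda>_. z) (\<lambda>_. t) = Re ((cnj t * t) * nev_kernel f z z)"
      by (simp add: gram_def mult_ac)
    then show ?thesis
      unfolding cnj_mult_self nev_kernel_diag[OF assms(3)] of_real_mult[symmetric] by simp
  qed
  ultimately show "2 * Re (t * u z) \<le> c + (cmod t)\<^sup>2 * (Im (f z) / Im z)" by simp
qed (use nev_psd_Im_nonneg[OF assms(2,3)] assms(3) in \<open>simp add: upper_half_plane_def\<close>)

section \<open>Nontangential approach and boundary difference quotients\<close>

lemma Complex_mem_upper_half_plane [simp]: "Complex a b \<in> UHP \<longleftrightarrow> 0 < b"
  by (simp add: upper_half_plane_def)

lemma stolz_angle_subset: "stolz_angle M x \<subseteq> UHP"
  by (auto simp: stolz_angle_def upper_half_plane_def)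

lemma stolz_angle_norm_le:
  assumes "z \<in> stolz_angle M x"
  shows "cmod (z - cx x) \<le> (M + 1) * Im z"
  using cmod_le[of "z - cx x"] assms by (simp add: stolz_angle_def algebra_simps)

lemma at_stolz_angle_neq_bot: "nt_at 1 x \<noteq> bot"
proof -
  have "cx x islimpt stolz_angle 1 x"
    unfolding islimpt_approachable
  proof (intro allI impI)
    fix r :: real assume "r > 0"
    then show "\<exists>z\<in>stolz_angle 1 x. z \<noteq> cx x \<and> dist z (cx x) < r"
      by (intro bexI[of _ "Complex x (r/2)"])
         (auto simp: stolz_angle_def complex_eq_iff dist_norm norm_complex_def)
  qed
  then show ?thesis by (simp add: trivial_limit_within)
qed

lemma filterlim_vertical:
  assumes "M > 0"
  shows "filterlim (\<lambda>\<epsilon>. Complex x \<epsilon>) (nt_at M x) (at_right 0)"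
proof -
  have "((\<lambda>\<epsilon>. Complex x \<epsilon>) \<longlongrightarrow> Complex x 0) (at_right 0)"
    by (intro tendsto_Complex tendsto_const tendsto_ident_at)
  moreover have "\<forall>\<^sub>F \<epsilon> in at_right 0. Complex x \<epsilon> \<in> stolz_angle M x \<and> Complex x \<epsilon> \<noteq> cx x"
    using eventually_at_right_less[of "0::real"]
    by eventually_elim (use assms in \<open>auto simp: stolz_angle_def complex_eq_iff\<close>)
  ultimately show ?thesis
    unfolding filterlim_at by (simp add: Complex_of_real)
qed

text \<open>The positive Gram form is enlarged by the point \<open>x + \<i> \<epsilon>\<close> with
  weight \<open>-1\<close>. As \<epsilon> tends to 0, the cross terms converge to values of the
  difference quotient, while the diagonal entry stays at most \<open>k\<close>.\<close>

lemma dominated_difference_quotient: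
  fixes f :: "complex \<Rightarrow> complex" and x \<eta> :: real
  assumes psd: "nev_psd f"
    and lim: "((\<lambda>\<epsilon>. f (Complex x \<epsilon>)) \<longlongrightarrow> cx \<eta>) (at_right 0)"
    and bd: "\<forall>\<^sub>F \<epsilon> in at_right 0. Im (f (Complex x \<epsilon>)) / \<epsilon> \<le> k"
  shows "dominated f (\<lambda>z. (f z - \<eta>) / (z - x)) k"
  unfolding dominated_def
proof (intro allI impI)
  fix m z a assume z: "\<forall>j<(m::nat). z j \<in> UHP"
  define u where "u = (\<lambda>z. (f z - \<eta>) / (z - x))"
  define X where "X = (\<lambda>\<epsilon>. \<Sum>i<m. cnj (a i) * nev_kernel f (Complex x \<epsilon>) (z i))"
  have "(X \<longlongrightarrow> (\<Sum>i<m. cnj (a i) * ((\<eta> - cnj (f (z i))) / (Complex x 0 - cnj (z i))))) (at_right 0)"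
    unfolding X_def nev_kernel_def
  proof (intro tendsto_sum tendsto_mult tendsto_divide tendsto_diff tendsto_const lim tendsto_Complex tendsto_ident_at)
    fix i assume "i \<in> {..<m}"
    then show "Complex x 0 - cnj (z i) \<noteq> 0"
      using z by (auto simp: upper_half_plane_def complex_eq_iff)
  qed
  also have "(\<Sum>i<m. cnj (a i) * ((\<eta> - cnj (f (z i))) / (Complex x 0 - cnj (z i)))) = cnj (\<Sum>i<m. a i * u (z i))"
    unfolding cnj_sum u_def
    by (intro sum.cong refl)
       (simp add: Complex_of_real diff_divide_swap[of "cx \<eta>" _ "cx x"])
  finally have X: "(X \<longlongrightarrow> cnj (\<Sum>i<m. a i * u (z i))) (at_right 0)" .
  have "\<forall>\<^sub>F \<epsilon> in at_right 0. 0 \<le> gram f {..<m} z a - 2 * Re (X \<epsilon>) + k"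
    using bd eventually_at_right_less[of "0::real"]
  proof eventually_elim
    case (elim \<epsilon>)
    have "0 \<le> gram f {..<Suc m} (z(m := Complex x \<epsilon>)) (a(m := -1))"
      using z elim by (intro gram_nonneg[OF psd]) (auto simp: less_Suc_eq)
    also have "\<dots> = gram f {..<m} z a - 2 * Re (X \<epsilon>) + Im (f (Complex x \<epsilon>)) / \<epsilon>"
      using elim by (subst gram_Suc) (auto simp: X_def)
    finally show ?case using elim by simp
  qed
  then have "0 \<le> gram f {..<m} z a - 2 * Re (cnj (\<Sum>i<m. a i * u (z i))) + k"
    by (intro tendsto_lowerbound[OF tendsto_add[OF tendsto_diff[OF tendsto_const
          tendsto_mult[OF tendsto_const tendsto_Re[OF X]]] tendsto_const]]) auto
  then show "2 * Re (\<Sum>j<m. a j * ((f (z j) - \<eta>) / (z j - x))) \<le> gram f {..<m} z a + k"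
    by (simp only: cnj.simps u_def)
qed

text \<open>
  In the reproducing kernel Hilbert space of the kernel of \<open>f\<close>, the least \<open>d\<close> for which the
  difference quotient \<open>u\<close> is dominated is the squared norm of \<open>u\<close>, and \<open>u\<close> is the weak limit of
  the kernel functions at points tending to \<open>x\<close>. Approximating \<open>u\<close> in norm by finite combinations of
  kernel functions yields \<open>u \<longlongrightarrow> d\<close>.
\<close>

lemma julia_caratheodory:
  fixes f :: "complex \<Rightarrow> complex" and x \<eta> :: real
  assumes psd: "nev_psd f"
    and bd: "\<And>M. M > 0 \<Longrightarrow> \<exists>C r. r > 0 \<and> (\<forall>z\<in>stolz_angle M x. cmod (z - x) < r \<longrightarrow> cmod (f z - \<eta>) \<le> C * cmod (z - x))"
  shows "\<exists>d\<ge>0. \<forall>M>0. ((\<lambda>z. (f z - \<eta>) / (z - x)) \<longlongrightarrow> cx d) (nt_at M x)"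
proof -
  define u where "u = (\<lambda>z. (f z - \<eta>) / (z - x))"
  have near: "\<forall>\<^sub>F z in nt_at M x. z \<in> stolz_angle M x \<and> cmod (z - x) < r \<and> z \<noteq> x"
    if "r > 0" for M r
    unfolding eventually_at using that by (intro exI[of _ r]) (auto simp: dist_norm)
  have lim: "(f \<longlongrightarrow> \<eta>) (nt_at M x)" if M: "M > 0" for M
  proof -
    obtain C r where C: "r > 0" "\<forall>z\<in>stolz_angle M x. cmod (z - x) < r \<longrightarrow> cmod (f z - \<eta>) \<le> C * cmod (z - x)"
      using bd[OF M] by auto
    have "((\<lambda>z. C * cmod (z - x)) \<longlongrightarrow> C * cmod (cx x - x)) (nt_at M x)"
      by (intro tendsto_intros)
    then have "((\<lambda>z. C * cmod (z - x)) \<longlongrightarrow> 0) (nt_at M x)" by simp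
    moreover have "\<forall>\<^sub>F z in nt_at M x. norm (f z - \<eta>) \<le> C * cmod (z - x)"
      using near[OF C(1), of M] by eventually_elim (use C(2) in auto)
    ultimately have "((\<lambda>z. f z - \<eta>) \<longlongrightarrow> 0) (nt_at M x)"
      by (rule Lim_null_comparison[rotated])
    then show ?thesis by (simp add: LIM_zero_iff)
  qed
  have kbd: "\<exists>k\<ge>0. \<forall>\<^sub>F z in nt_at M x. Im (f z) / Im z \<le> k" if M: "M > 0" for M
  proof -
    obtain C r where C: "r > 0" "\<forall>z\<in>stolz_angle M x. cmod (z - x) < r \<longrightarrow> cmod (f z - \<eta>) \<le> C * cmod (z - x)"
      using bd[OF M] by auto
    have "\<forall>\<^sub>F z in nt_at M x. Im (f z) / Im z \<le> \<bar>C\<bar> * (M + 1)"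
      using near[OF C(1), of M]
    proof eventually_elim
      case (elim z)
      have "Im (f z) = Im (f z - \<eta>)" by simp
      also have "\<dots> \<le> cmod (f z - \<eta>)" using abs_Im_le_cmod abs_le_D1 by blast
      also have "\<dots> \<le> C * cmod (z - x)" using C(2) elim by auto
      also have "\<dots> \<le> \<bar>C\<bar> * cmod (z - x)" by (intro mult_right_mono) auto
      also have "\<dots> \<le> \<bar>C\<bar> * ((M + 1) * Im z)"
        using elim by (intro mult_left_mono stolz_angle_norm_le) auto
      finally show ?case using elim by (simp add: stolz_angle_def divide_le_eq mult_ac)
    qed
    then show ?thesis using M by (intro exI[of _ "\<bar>C\<bar> * (M + 1)"]) auto
  qed
  obtain k where "k \<ge> 0" "\<forall>\<^sub>F z in nt_at 1 x. Im (f z) / Im z \<le> k"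
    using kbd[of 1] by auto
  then have "\<forall>\<^sub>F \<epsilon> in at_right 0. Im (f (Complex x \<epsilon>)) / Im (Complex x \<epsilon>) \<le> k"
    using filterlim_vertical[of 1 x] by (auto simp: filterlim_iff)
  then have domk: "dominated f u k"
    unfolding u_def
  proof (intro dominated_difference_quotient psd)
    show "((\<lambda>\<epsilon>. f (Complex x \<epsilon>)) \<longlongrightarrow> \<eta>) (at_right 0)"
      by (rule filterlim_compose[OF lim[of 1] filterlim_vertical[of 1]]) simp_all
  qed simp
  define T where "T = (\<lambda>(m::nat) z a. \<Sum>j<m. a j * u (z j))"
  \<comment> \<open>By duality the supremum of \<open>S\<close> is the squared norm of
    \<open>u\<close> in \<open>H\<close>; domination by \<open>k\<close> bounds
    \<open>S\<close>.\<close>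
  define S where "S = {2 * Re (T m z a) - gram f {..<m} z a | m z a. \<forall>j<m. z j \<in> UHP}"
  have Sbd: "s \<le> k" if s: "s \<in> S" for s
  proof -
    obtain m z a where "s = 2 * Re (T m z a) - gram f {..<m} z a" "\<forall>j<m. z j \<in> UHP"
      using s unfolding S_def by blast
    then show ?thesis
      using domk[unfolded dominated_def, rule_format, of m z a] by (simp add: T_def)
  qed
  have "0 \<in> S"
    unfolding S_def by (intro CollectI exI[of _ 0] exI[of _ "\<lambda>_. 0"]) (auto simp: T_def gram_def)
  have bdd: "bdd_above S" using Sbd by (auto simp: bdd_above_def)
  define d where "d = Sup S"
  have d0: "d \<ge> 0" unfolding d_def by (rule cSup_upper[OF \<open>0 \<in> S\<close> bdd])
  have domd: "2 * Re (T m z a) \<le> gram f {..<m} z a + d" if "\<forall>j<m. z j \<in> UHP" for m z a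
  proof -
    have "2 * Re (T m z a) - gram f {..<m} z a \<in> S" unfolding S_def using that by blast
    then show ?thesis using cSup_upper[OF _ bdd] unfolding d_def by force
  qed
  have "(u \<longlongrightarrow> cx d) (nt_at M x)" if M: "M > 0" for M
  proof (rule tendstoI)
    fix e :: real assume e: "e > 0"
    obtain k where k: "k \<ge> 0" "\<forall>\<^sub>F z in nt_at M x. Im (f z) / Im z \<le> k"
      using kbd[OF M] by auto
    \<comment> \<open>The errors \<open>\<epsilon> * sqrt k\<close> and
      \<open>\<epsilon> * sqrt d\<close> together stay below \<open>e / 2\<close>; the other half is
      left for the convergence of \<open>X\<close>. The summand 1 keeps the denominator
      positive.\<close>
    define \<epsilon> where "\<epsilon> = e / 2 / (sqrt k + sqrt d + 1)"
    have pos: "sqrt k + sqrt d + 1 > 0" using k(1) d0 by (smt (verit) real_sqrt_ge_zero)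
    have \<epsilon>0: "\<epsilon> > 0" using e pos by (simp add: \<epsilon>_def)
    have "d - \<epsilon>\<^sup>2 < Sup S" using \<epsilon>0 by (simp add: d_def)
    then obtain s where "s \<in> S" "d - \<epsilon>\<^sup>2 < s"
      using less_cSup_iff[OF _ bdd] \<open>0 \<in> S\<close> by blast
    then obtain m z a where z: "\<forall>j<(m::nat). z j \<in> UHP"
        and near_d: "d - \<epsilon>\<^sup>2 < 2 * Re (T m z a) - gram f {..<m} z a"
      unfolding S_def by blast
    define G where "G = gram f {..<m} z a"
    have G0: "G \<ge> 0" unfolding G_def by (rule gram_nonneg[OF psd]) (use z in auto)
    \<comment> \<open>The near-maximizer competes with its multiples: dividing \<open>a\<close> by
      \<open>s = cnj (1 + t)\<close> cannot improve the functional by more than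
      \<open>\<epsilon>^2\<close>, which forces its value \<open>T\<close> to be close to
      \<open>d\<close>.\<close>
    have Td: "(cmod (T m z a - d))\<^sup>2 \<le> \<epsilon>\<^sup>2 * d"
    proof (rule quadratic_bound[OF _ d0])
      fix t
      have "2 * Re ((1 + t) * T m z a) \<le> G + (cmod (1 + t))\<^sup>2 * d"
      proof (cases "1 + t = 0")
        case True then show ?thesis using G0 by simp
      next
        case False
        define s where "s = cnj (1 + t)"
        have s: "s \<noteq> 0" using False unfolding s_def by (simp only: complex_cnj_zero_iff not_False_eq_True)
        have "2 * Re (T m z (\<lambda>j. a j / s)) \<le> gram f {..<m} z (\<lambda>j. a j / s) + d"
          by (rule domd[OF z])
        also have "T m z (\<lambda>j. a j / s) = T m z a / s"
          by (simp add: T_def sum_divide_distrib)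
        also have "gram f {..<m} z (\<lambda>j. a j / s) = G / (cmod s)\<^sup>2"
        proof -
          have "(\<Sum>i<m. \<Sum>j<m. cnj (a i / s) * nev_kernel f (z j) (z i) * (a j / s)) =
             (\<Sum>i<m. \<Sum>j<m. cnj (a i) * nev_kernel f (z j) (z i) * a j) / cx ((cmod s)\<^sup>2)"
            unfolding cnj_mult_self[symmetric] by (simp add: sum_divide_distrib)
          then show ?thesis by (simp add: gram_def G_def Re_divide_of_real del: of_real_power)
        qed
        finally have "(cmod s)\<^sup>2 * (2 * Re (T m z a / s)) \<le> (cmod s)\<^sup>2 * (G / (cmod s)\<^sup>2 + d)"
          by (rule mult_left_mono) simp
        moreover have "(cmod s)\<^sup>2 * Re (T m z a / s) = Re ((1 + t) * T m z a)"
        proof -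
          have "(cmod s)\<^sup>2 * Re (T m z a / s) = Re (cx ((cmod s)\<^sup>2) * (T m z a / s))"
            by (simp only: scaleR_conv_of_real[symmetric] scaleR_complex.simps)
          also have "cx ((cmod s)\<^sup>2) * (T m z a / s) = cnj s * T m z a"
            unfolding cnj_mult_self[symmetric] using s by simp
          finally show ?thesis by (simp add: s_def)
        qed
        moreover have "cmod s = cmod (1 + t)" unfolding s_def by (rule complex_mod_cnj)
        moreover have "(cmod s)\<^sup>2 * (G / (cmod s)\<^sup>2 + d) = G + (cmod s)\<^sup>2 * d"
          using s by (simp add: distrib_left)
        ultimately have "2 * Re ((1 + t) * T m z a) \<le> G + (cmod s)\<^sup>2 * d"
          by linarith
        then show ?thesis by (simp only: \<open>cmod s = cmod (1 + t)\<close>)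
      qed
      moreover have "(cmod (1 + t))\<^sup>2 = 1 + 2 * Re t + (cmod t)\<^sup>2"
        unfolding cmod_power2 by (simp add: power2_eq_square algebra_simps)
      ultimately show "2 * Re (t * (T m z a - d)) \<le> \<epsilon>\<^sup>2 + (cmod t)\<^sup>2 * d"
        using near_d unfolding G_def[symmetric] by (simp add: algebra_simps)
    qed
    define X where "X = (\<lambda>w. \<Sum>i<m. cnj (a i) * nev_kernel f w (z i))"
    have "(X \<longlongrightarrow> (\<Sum>i<m. cnj (a i) * ((\<eta> - cnj (f (z i))) / (x - cnj (z i))))) (nt_at M x)"
      unfolding X_def nev_kernel_def
    proof (intro tendsto_sum tendsto_mult tendsto_divide tendsto_diff tendsto_const lim[OF M] tendsto_ident_at)
      fix i assume "i \<in> {..<m}"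
      then show "x - cnj (z i) \<noteq> 0"
        using z by (auto simp: upper_half_plane_def complex_eq_iff)
    qed
    also have "(\<Sum>i<m. cnj (a i) * ((\<eta> - cnj (f (z i))) / (x - cnj (z i)))) = cnj (T m z a)"
      unfolding cnj_sum u_def T_def
      by (intro sum.cong refl) (simp add: diff_divide_swap[of "cx \<eta>" _ "cx x"])
    finally have X: "\<forall>\<^sub>F w in nt_at M x. dist (X w) (cnj (T m z a)) < e / 2"
      by (rule tendstoD) (use e in simp)
    show "\<forall>\<^sub>F w in nt_at M x. dist (u w) d < e"
      using X k(2) near[OF e, of M]
    proof eventually_elim
      case (elim w)
      then have w: "w \<in> UHP" using stolz_angle_subset by blast
      \<comment> \<open>Adjoining \<open>w\<close> with weight \<open>t\<close> to the
        near-maximizer gains at most \<open>\<epsilon>^2\<close> as well. So \<open>u\<close>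
        differs little from the finite combination \<open>X\<close> at \<open>w\<close>, uniformly
        because the diagonal kernel is bounded by \<open>k\<close> in the Stolz angle.\<close>
      have "(cmod (u w - X w))\<^sup>2 \<le> \<epsilon>\<^sup>2 * k"
      proof (rule quadratic_bound[OF _ k(1)])
        fix t
        have "2 * Re (T (Suc m) (z(m := w)) (a(m := t))) \<le> gram f {..<Suc m} (z(m := w)) (a(m := t)) + d"
          by (rule domd) (use z w in \<open>auto simp: less_Suc_eq\<close>)
        also have "T (Suc m) (z(m := w)) (a(m := t)) = T m z a + t * u w"
          by (simp add: T_def)
        also have "gram f {..<Suc m} (z(m := w)) (a(m := t)) = G + 2 * Re (t * X w) + (cmod t)\<^sup>2 * (Im (f w) / Im w)"
          unfolding gram_Suc[OF w] X_def G_def by simp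
        finally have "2 * Re (t * (u w - X w)) \<le> \<epsilon>\<^sup>2 + (cmod t)\<^sup>2 * (Im (f w) / Im w)"
          using near_d unfolding G_def[symmetric] by (simp add: algebra_simps)
        also have "(cmod t)\<^sup>2 * (Im (f w) / Im w) \<le> (cmod t)\<^sup>2 * k"
          using elim by (intro mult_left_mono) auto
        finally show "2 * Re (t * (u w - X w)) \<le> \<epsilon>\<^sup>2 + (cmod t)\<^sup>2 * k" by simp
      qed
      then have 1: "cmod (u w - X w) \<le> \<epsilon> * sqrt k"
        using real_le_rsqrt[of "cmod (u w - X w)" "\<epsilon>\<^sup>2 * k"] \<epsilon>0 by (simp add: real_sqrt_mult)
      have 2: "cmod (T m z a - d) \<le> \<epsilon> * sqrt d"
        using real_le_rsqrt[OF Td] \<epsilon>0 by (simp add: real_sqrt_mult)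
      have "cmod (cnj (T m z a) - d) = cmod (T m z a - d)"
        by (metis complex_cnj_complex_of_real complex_cnj_diff complex_mod_cnj)
      then have "cmod (u w - d) \<le> cmod (u w - X w) + cmod (X w - cnj (T m z a)) + cmod (T m z a - d)"
        using norm_triangle_ineq[of "u w - X w" "X w - cnj (T m z a)"]
              norm_triangle_ineq[of "u w - cnj (T m z a)" "cnj (T m z a) - d"] by simp
      also have "\<dots> < \<epsilon> * sqrt k + e / 2 + \<epsilon> * sqrt d"
        using 1 2 elim by (auto simp: dist_norm)
      also have "\<dots> \<le> e / 2 + \<epsilon> * (sqrt k + sqrt d + 1)"
        using \<epsilon>0 by (simp add: algebra_simps)
      also have "\<epsilon> * (sqrt k + sqrt d + 1) = e / 2"
        unfolding \<epsilon>_def using pos by (intro nonzero_eq_divide_eq[THEN iffD1]) auto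
      also have "e / 2 + e / 2 = e" by simp
      finally show ?case by (simp add: dist_norm)
    qed
  qed
  then show ?thesis using d0 unfolding u_def by blast
qed


section \<open>The upper bound for the inertia\<close>

lemma sum_delta_lessThan:
  fixes f :: "nat \<Rightarrow> 'a::comm_ring_1"
  assumes "i < n"
  shows "(\<Sum>k<n. (if i = k then 1 else 0) * f k) = f i"
    and "(\<Sum>k<n. f k * (if i = k then 1 else 0)) = f i"
    and "(\<Sum>k<n. f k * (if k = i then 1 else 0)) = f i"
  using assms by (simp_all add: if_distrib if_distribR cong: if_cong)

text \<open>What remains of the data after the substitution. It is instantiated with
  \<open>c = - et\<close>, \<open>e = ct - t * et\<close> and \<open>f = -1 / (\<phi> - t)\<close>,
  or \<open>f = 0\<close> for infinite \<phi>. The nodes enter through the Lyapunov identity for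
  \<open>Q\<close>, and \<open>lam\<close>, \<open>L\<close> fix a diagonalization of
  \<open>P\<close> whose negative entries are counted.\<close>

locale pick_core =
  fixes n :: nat and x c e :: "nat \<Rightarrow> real" and P Q :: "nat \<Rightarrow> nat \<Rightarrow> real"
    and lam :: "nat \<Rightarrow> real" and L :: "nat \<Rightarrow> nat \<Rightarrow> complex" and f :: "complex \<Rightarrow> complex"
  assumes inj_x: "inj_on x {..<n}"
    and e_nz: "i < n \<Longrightarrow> e i \<noteq> 0"
    and P_sym: "i < n \<Longrightarrow> j < n \<Longrightarrow> P i j = P j i"
    and Q_sym: "i < n \<Longrightarrow> j < n \<Longrightarrow> Q i j = Q j i"
    and PQ: "i < n \<Longrightarrow> k < n \<Longrightarrow> (\<Sum>j<n. P i j * Q j k) = (if i = k then 1 else 0)"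
    and lyapunov: "i < n \<Longrightarrow> j < n \<Longrightarrow> Q i j * (x i - x j) = e i * c j - c i * e j"
    and diag: "diagonalizes n (\<lambda>i j. cx (P i j)) lam L"
    and lam_nz: "k < n \<Longrightarrow> lam k \<noteq> 0"
    and psd: "nev_psd f"
begin

definition v :: "nat \<Rightarrow> complex \<Rightarrow> complex" where
  "v i z = (cx (e i) * f z - cx (c i)) / (z - cx (x i))"

definition pform :: "(nat \<Rightarrow> complex) \<Rightarrow> complex" where
  "pform u = (\<Sum>i<n. \<Sum>j<n. cnj (u i) * cx (P i j) * u j)"

definition ker :: "complex \<Rightarrow> complex \<Rightarrow> complex" where
  "ker z w = nev_kernel f z w + (\<Sum>i<n. \<Sum>j<n. cnj (v i w) * cx (P i j) * v j z)"

definition qform :: "(nat \<Rightarrow> complex) \<Rightarrow> complex" where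
  "qform s = (\<Sum>i<n. \<Sum>j<n. cnj (s i) * cx (Q i j) * s j)"

text \<open>A general vector for the form of \<open>P\<close>: the first part comes from points, the
  second from a candidate \<open>s\<close> for the orthogonal complement. It is written as
  \<open>Q s\<close> so that \<open>P\<close> maps it back to \<open>s\<close>.\<close>

definition comb :: "nat \<Rightarrow> (nat \<Rightarrow> complex) \<Rightarrow> (nat \<Rightarrow> complex) \<Rightarrow> (nat \<Rightarrow> complex) \<Rightarrow> nat \<Rightarrow> complex" where
  "comb m z a s i = (\<Sum>j<m. v i (z j) * a j) + (\<Sum>k<n. cx (Q i k) * s k)"

lemma PQ_apply:
  assumes "i < n"
  shows "(\<Sum>j<n. cx (P i j) * (\<Sum>k<n. cx (Q j k) * s k)) = s i"
proof -
  have "(\<Sum>j<n. cx (P i j) * (\<Sum>k<n. cx (Q j k) * s k)) =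
        (\<Sum>k<n. cx (\<Sum>j<n. P i j * Q j k) * s k)"
    unfolding sum_distrib_left of_real_sum sum_distrib_right
    by (subst sum.swap) (simp add: mult_ac)
  also have "\<dots> = (\<Sum>k<n. (if i = k then 1 else 0) * s k)"
    by (intro sum.cong refl) (simp add: PQ assms)
  also have "\<dots> = s i" by (rule sum_delta_lessThan(1)[OF assms])
  finally show ?thesis .
qed

text \<open>This links the two forms to be compared. Since \<open>P Q = 1\<close>, the cross term
  between the two parts of \<open>comb\<close> is given by the values of the combination of the
  \<open>v i\<close> with coefficients \<open>cnj (s i)\<close>, and the pure \<open>s\<close> term
  is \<open>qform s\<close>; the Gram form is subtracted because \<open>ker\<close> contains the
  kernel of \<open>f\<close>.\<close>

lemma pform_comb:
  "Re (pform (comb m z a s)) =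
     Re (\<Sum>i<m. \<Sum>j<m. cnj (a i) * ker (z j) (z i) * a j) - gram f {..<m} z a
     + 2 * Re (\<Sum>j<m. a j * (\<Sum>i<n. cnj (s i) * v i (z j))) + Re (qform s)"
proof -
  define p where "p = (\<lambda>i. \<Sum>j<m. v i (z j) * a j)"
  define r where "r = (\<lambda>i. \<Sum>k<n. cx (Q i k) * s k)"
  have Pr: "(\<Sum>j<n. cx (P i j) * r j) = s i" if "i < n" for i
    unfolding r_def by (rule PQ_apply[OF that])
  have comb: "comb m z a s = (\<lambda>i. p i + r i)" by (simp add: comb_def p_def r_def fun_eq_iff)
  have Pr': "(\<Sum>i<n. cnj (r i) * cx (P i j)) = cnj (s j)" if "j < n" for j
  proof -
    have "(\<Sum>i<n. cnj (r i) * cx (P i j)) = (\<Sum>i<n. cnj (cx (P j i) * r i))"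
      by (intro sum.cong refl) (simp add: P_sym[OF that])
    also have "\<dots> = cnj (s j)" using Pr[OF that] by (simp only: cnj_sum[symmetric])
    finally show ?thesis .
  qed
  have "pform (\<lambda>i. p i + r i) = (\<Sum>i<n. \<Sum>j<n. cnj (p i) * cx (P i j) * p j)
      + (\<Sum>i<n. cnj (p i) * (\<Sum>j<n. cx (P i j) * r j))
      + (\<Sum>i<n. \<Sum>j<n. cnj (r i) * cx (P i j) * p j)
      + (\<Sum>i<n. cnj (r i) * (\<Sum>j<n. cx (P i j) * r j))"
    by (simp add: pform_def sum.distrib sum_distrib_left algebra_simps)
  also have "(\<Sum>i<n. \<Sum>j<n. cnj (r i) * cx (P i j) * p j) = (\<Sum>j<n. (\<Sum>i<n. cnj (r i) * cx (P i j)) * p j)"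
    by (subst sum.swap) (simp add: sum_distrib_right)
  also have "\<dots> = (\<Sum>i<n. cnj (s i) * p i)" by (intro sum.cong refl) (simp add: Pr')
  also have "(\<Sum>i<n. cnj (p i) * (\<Sum>j<n. cx (P i j) * r j)) = cnj (\<Sum>i<n. cnj (s i) * p i)"
    unfolding cnj_sum by (intro sum.cong refl) (simp add: Pr)
  also have "(\<Sum>i<n. cnj (r i) * (\<Sum>j<n. cx (P i j) * r j)) = cnj (qform s)"
  proof -
    have "(\<Sum>i<n. cnj (r i) * (\<Sum>j<n. cx (P i j) * r j)) = (\<Sum>i<n. cnj (r i) * s i)"
      by (intro sum.cong refl) (simp add: Pr)
    also have "\<dots> = cnj (qform s)"
      by (simp add: r_def qform_def sum_distrib_right cnj_sum mult_ac sum_distrib_left)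
    finally show ?thesis .
  qed
  finally have "Re (pform (comb m z a s)) = Re (\<Sum>i<n. \<Sum>j<n. cnj (p i) * cx (P i j) * p j)
      + 2 * Re (\<Sum>i<n. cnj (s i) * p i) + Re (qform s)"
    unfolding comb by (simp only: plus_complex.simps cnj.simps)
  moreover have "(\<Sum>i<n. cnj (s i) * p i) = (\<Sum>j<m. a j * (\<Sum>i<n. cnj (s i) * v i (z j)))"
    unfolding p_def sum_distrib_left by (subst sum.swap) (simp add: mult_ac)
  moreover have "(\<Sum>i<m. \<Sum>j<m. cnj (a i) * ker (z j) (z i) * a j) =
     (\<Sum>i<m. \<Sum>j<m. cnj (a i) * nev_kernel f (z j) (z i) * a j) + (\<Sum>i<n. \<Sum>j<n. cnj (p i) * cx (P i j) * p j)"
  proof -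
    have "(\<Sum>i<n. \<Sum>j<n. cnj (p i) * cx (P i j) * p j) =
       (\<Sum>i<n. \<Sum>j<n. \<Sum>k<m. \<Sum>l<m. cnj (a k) * (cnj (v i (z k)) * cx (P i j) * v j (z l)) * a l)"
      unfolding p_def cnj_sum sum_distrib_left sum_distrib_right
      by (rule sum.cong[OF refl], rule sum.cong[OF refl], subst sum.swap,
          rule sum.cong[OF refl], rule sum.cong[OF refl]) (simp add: mult_ac)
    also have "\<dots> = (\<Sum>k<m. \<Sum>l<m. \<Sum>i<n. \<Sum>j<n. cnj (a k) * (cnj (v i (z k)) * cx (P i j) * v j (z l)) * a l)"
      \<comment> \<open>Four exchanges carry the point indices \<open>k\<close>, \<open>l\<close>
        outside the node indices \<open>i\<close>, \<open>j\<close>.\<close>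
      apply (subst (2) sum.swap)
      apply (subst (3) sum.swap)
      apply (subst (1) sum.swap)
      apply (subst (2) sum.swap)
      by (rule refl)
    also have "\<dots> = (\<Sum>k<m. \<Sum>l<m. cnj (a k) * (\<Sum>i<n. \<Sum>j<n. cnj (v i (z k)) * cx (P i j) * v j (z l)) * a l)"
      by (simp only: sum_distrib_left sum_distrib_right)
    finally show ?thesis
      by (simp add: ker_def distrib_left distrib_right sum.distrib)
  qed
  ultimately show ?thesis by (simp add: gram_def)
qed

lemma pform_diag: "Re (pform u) = (\<Sum>k<n. lam k * (cmod (\<Sum>j<n. L k j * u j))\<^sup>2)"
  unfolding pform_def diagonalizes_form[OF diag] by (rule Re_complex_of_real)

section \<open>Boundary limits at the nodes\<close>

definition diffq :: "nat \<Rightarrow> complex \<Rightarrow> complex" where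
  "diffq i z = (f z - cx (c i / e i)) / (z - cx (x i))"

text \<open>Approach along the vertical ray suffices to insert points near good nodes into Gram
  forms; \<open>ntlim\<close> is the stronger version that domination yields.\<close>

definition vlim :: "nat \<Rightarrow> real \<Rightarrow> bool" where
  "vlim i d \<longleftrightarrow> ((\<lambda>\<epsilon>. diffq i (Complex (x i) \<epsilon>)) \<longlongrightarrow> cx d) (at_right 0)"

text \<open>The Gram matrix in \<open>H\<close> of the functions \<open>v i\<close> when the angular
  derivatives \<open>d i\<close> exist. Its off-diagonal entries are difference quotients of
  boundary values and equal \<open>- Q i j\<close> by the Lyapunov identity, so
  \<open>\<Gamma> d + Q\<close> is diagonal.\<close>

definition \<Gamma> :: "(nat \<Rightarrow> real) \<Rightarrow> nat \<Rightarrow> nat \<Rightarrow> real" where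
  "\<Gamma> d i j = (if i = j then (e i)\<^sup>2 * d i else - Q i j)"

lemma Q_offdiag:
  assumes "i < n" "j < n" "i \<noteq> j"
  shows "e i * e j * (c i / e i - c j / e j) / (x i - x j) = - Q i j"
proof -
  have "x i \<noteq> x j" using inj_x assms by (auto simp: inj_on_def)
  moreover have "e i * e j * (c i / e i - c j / e j) = - (Q i j * (x i - x j))"
    unfolding lyapunov[OF assms(1,2)] using e_nz assms by (simp add: field_simps)
  ultimately show ?thesis by simp
qed

lemma v_eq_diffq: "i < n \<Longrightarrow> v i z = cx (e i) * diffq i z"
  using e_nz[of i] by (simp add: v_def diffq_def right_diff_distrib)

lemma vlim_value:
  assumes "vlim i d"
  shows "((\<lambda>\<epsilon>. f (Complex (x i) \<epsilon>)) \<longlongrightarrow> cx (c i / e i)) (at_right 0)"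
proof -
  have "((\<lambda>\<epsilon>. cx (c i / e i) + (Complex (x i) \<epsilon> - cx (x i)) * diffq i (Complex (x i) \<epsilon>))
      \<longlongrightarrow> cx (c i / e i) + (Complex (x i) 0 - cx (x i)) * d) (at_right 0)"
    using assms unfolding vlim_def
    by (intro tendsto_add tendsto_mult tendsto_diff tendsto_const tendsto_Complex tendsto_ident_at)
  then have "((\<lambda>\<epsilon>. cx (c i / e i) + (Complex (x i) \<epsilon> - cx (x i)) * diffq i (Complex (x i) \<epsilon>))
      \<longlongrightarrow> cx (c i / e i)) (at_right 0)"
    by (simp add: Complex_of_real)
  moreover have "\<forall>\<^sub>F \<epsilon> in at_right 0. cx (c i / e i) + (Complex (x i) \<epsilon> - cx (x i)) * diffq i (Complex (x i) \<epsilon>)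
      = f (Complex (x i) \<epsilon>)"
    using eventually_at_right_less[of "0::real"]
    by eventually_elim (simp add: diffq_def complex_eq_iff[of "Complex _ _"])
  ultimately show ?thesis by (rule Lim_transform_eventually)
qed

lemma kernel_boundary_limit:
  assumes "i < n" "j < n" "vlim i (d i)" "vlim j (d j)"
  shows "((\<lambda>\<epsilon>. cx (e i) * nev_kernel f (Complex (x j) \<epsilon>) (Complex (x i) \<epsilon>) * cx (e j)) \<longlongrightarrow> cx (\<Gamma> d i j)) (at_right 0)"
proof (cases "i = j")
  case True
  \<comment> \<open>For a real boundary value and \<open>z - x = \<i> * \<epsilon>\<close>, the real
    part of the difference quotient is exactly the diagonal kernel
    \<open>Im f / \<epsilon>\<close>.\<close>
  have "((\<lambda>\<epsilon>. cx (e i) * cx (Re (diffq i (Complex (x i) \<epsilon>))) * cx (e i)) \<longlongrightarrow> cx (e i) * cx (Re (cx (d i))) * cx (e i)) (at_right 0)"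
    using assms(3) unfolding vlim_def by (intro tendsto_intros)
  moreover have "\<forall>\<^sub>F \<epsilon> in at_right 0. cx (e i) * cx (Re (diffq i (Complex (x i) \<epsilon>))) * cx (e i) =
      cx (e i) * nev_kernel f (Complex (x j) \<epsilon>) (Complex (x i) \<epsilon>) * cx (e j)"
    using eventually_at_right_less[of "0::real"]
  proof eventually_elim
    case (elim \<epsilon>)
    have "Complex (x i) \<epsilon> - x i = \<i> * cx \<epsilon>" by (simp add: complex_eq_iff)
    then have "Re (diffq i (Complex (x i) \<epsilon>)) = Im (f (Complex (x i) \<epsilon>)) / \<epsilon>"
      using elim by (simp add: diffq_def Re_divide power2_eq_square)
    then show ?case using elim True by (simp add: nev_kernel_diag)
  qed
  ultimately have "((\<lambda>\<epsilon>. cx (e i) * nev_kernel f (Complex (x j) \<epsilon>) (Complex (x i) \<epsilon>) * cx (e j)) \<longlongrightarrow>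
      cx (e i) * cx (Re (cx (d i))) * cx (e i)) (at_right 0)"
    by (rule Lim_transform_eventually)
  then show ?thesis using True by (simp add: \<Gamma>_def power2_eq_square mult_ac)
next
  case False
  have "x i \<noteq> x j" using inj_x assms False by (auto simp: inj_on_def)
  then have "((\<lambda>\<epsilon>. cx (e i) * nev_kernel f (Complex (x j) \<epsilon>) (Complex (x i) \<epsilon>) * cx (e j)) \<longlongrightarrow>
     cx (e i) * ((cx (c j / e j) - cnj (cx (c i / e i))) / (Complex (x j) 0 - cnj (Complex (x i) 0))) * cx (e j)) (at_right 0)"
    unfolding nev_kernel_def
    by (intro tendsto_mult tendsto_divide tendsto_diff tendsto_const tendsto_cnj vlim_value[OF assms(3)]
         vlim_value[OF assms(4)] tendsto_Complex tendsto_ident_at) (simp add: complex_eq_iff)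
  also have "cx (e i) * ((cx (c j / e j) - cnj (cx (c i / e i))) / (Complex (x j) 0 - cnj (Complex (x i) 0))) * e j
      = cx (e j * e i * (c j / e j - c i / e i) / (x j - x i))"
    by (simp add: Complex_of_real)
  also have "\<dots> = cx (\<Gamma> d i j)"
    using Q_offdiag[of j i] assms False Q_sym[of i j] by (simp add: \<Gamma>_def)
  finally show ?thesis .
qed

text \<open>The kernel function at \<open>x i + \<i> \<epsilon>\<close>, multiplied by
  \<open>e i\<close>, converges weakly to \<open>v i\<close>; its pairing with \<open>v j\<close>
  therefore reproduces \<Gamma>.\<close>

lemma v_boundary_limit:
  assumes "i < n" "j < n" "vlim i (d i)" "vlim j (d j)"
  shows "((\<lambda>\<epsilon>. cx (e i) * v j (Complex (x i) \<epsilon>)) \<longlongrightarrow> cx (\<Gamma> d i j)) (at_right 0)"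
proof (cases "i = j")
  case True
  have "((\<lambda>\<epsilon>. cx (e i) * (cx (e i) * diffq i (Complex (x i) \<epsilon>))) \<longlongrightarrow>
      cx (e i) * (cx (e i) * cx (d i))) (at_right 0)"
    using assms(3) unfolding vlim_def by (intro tendsto_mult tendsto_const)
  then show ?thesis using True assms by (simp add: \<Gamma>_def power2_eq_square mult_ac v_eq_diffq)
next
  case False
  have "x i \<noteq> x j" using inj_x assms False by (auto simp: inj_on_def)
  then have "((\<lambda>\<epsilon>. cx (e i) * v j (Complex (x i) \<epsilon>)) \<longlongrightarrow>
     cx (e i) * ((e j * cx (c i / e i) - c j) / (Complex (x i) 0 - x j))) (at_right 0)"
    unfolding v_def
    by (intro tendsto_mult tendsto_divide tendsto_diff tendsto_const vlim_value[OF assms(3)]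
         tendsto_Complex tendsto_ident_at) (simp add: complex_eq_iff)
  also have "cx (e i) * ((e j * cx (c i / e i) - c j) / (Complex (x i) 0 - x j))
      = cx (e i * (e j * (c i / e i) - c j) / (x i - x j))"
    by (simp add: Complex_of_real)
  also have "e i * (e j * (c i / e i) - c j) = e i * e j * (c i / e i - c j / e j)"
    using e_nz assms by (simp add: field_simps)
  also have "cx (e i * e j * (c i / e i - c j / e j) / (x i - x j)) = cx (\<Gamma> d i j)"
    using Q_offdiag[of i j] assms False by (simp add: \<Gamma>_def)
  finally show ?thesis .
qed

text \<open>The points \<open>x i + \<i> \<epsilon>\<close> with weights \<open>- s i * e i\<close>
  are adjoined to a positive Gram form. In the limit they contribute \<open>s* \<Gamma> s\<close>,
  which is at most \<open>- s* Q s\<close> because \<open>\<Gamma> d + Q\<close> is diagonal with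
  nonpositive entries on \<open>A\<close>.\<close>

lemma boundary_dominates:
  fixes m :: nat
  assumes A: "A \<subseteq> {..<n}" "\<And>i. i \<in> A \<Longrightarrow> vlim i (d i)" "\<And>i. i \<in> A \<Longrightarrow> (e i)\<^sup>2 * d i \<le> - Q i i"
    and s: "\<And>i. i < n \<Longrightarrow> i \<notin> A \<Longrightarrow> s i = 0"
    and z: "\<And>j. j < m \<Longrightarrow> z j \<in> UHP"
  shows "2 * Re (\<Sum>j<m. a j * (\<Sum>i<n. cnj (s i) * v i (z j))) + Re (qform s) \<le> gram f {..<m} z a"
proof -
  have fin: "finite A" using A(1) finite_subset by auto
  define zz where "zz = (\<lambda>\<epsilon>. case_sum z (\<lambda>i. Complex (x i) \<epsilon>))"
  define aa where "aa = case_sum a (\<lambda>i. - (s i * cx (e i)))"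
  define X where "X = (\<lambda>\<epsilon>. \<Sum>j<m. \<Sum>i\<in>A. a j * (cnj (s i) * (cx (e i) * nev_kernel f (z j) (Complex (x i) \<epsilon>))))"
  define Y where "Y = (\<lambda>\<epsilon>. \<Sum>i\<in>A. \<Sum>j\<in>A. cnj (s i) * (cx (e i) * nev_kernel f (Complex (x j) \<epsilon>) (Complex (x i) \<epsilon>) * cx (e j)) * s j)"
  have expand: "gram f ({..<m} <+> A) (zz \<epsilon>) aa = gram f {..<m} z a - 2 * Re (X \<epsilon>) + Re (Y \<epsilon>)" for \<epsilon>
  proof -
    have "(\<Sum>i\<in>{..<m} <+> A. \<Sum>j\<in>{..<m} <+> A. cnj (aa i) * nev_kernel f (zz \<epsilon> j) (zz \<epsilon> i) * aa j) =
       (\<Sum>i<m. (\<Sum>j<m. cnj (a i) * nev_kernel f (z j) (z i) * a j) + (\<Sum>j\<in>A. cnj (a i) * nev_kernel f (Complex (x j) \<epsilon>) (z i) * (- (s j * cx (e j)))))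
       + (\<Sum>i\<in>A. (\<Sum>j<m. cnj (- (s i * cx (e i))) * nev_kernel f (z j) (Complex (x i) \<epsilon>) * a j) + (\<Sum>j\<in>A. cnj (- (s i * cx (e i))) * nev_kernel f (Complex (x j) \<epsilon>) (Complex (x i) \<epsilon>) * (- (s j * cx (e j)))))"
      unfolding sum.Plus[OF finite_lessThan fin] o_def by (simp add: aa_def zz_def)
    also have "\<dots> = (\<Sum>i<m. \<Sum>j<m. cnj (a i) * nev_kernel f (z j) (z i) * a j) - cnj (X \<epsilon>)
       + ((\<Sum>i\<in>A. \<Sum>j<m. - (a j * (cnj (s i) * (cx (e i) * nev_kernel f (z j) (Complex (x i) \<epsilon>))))) + Y \<epsilon>)"
      unfolding X_def Y_def sum.distrib cnj_sum sum_negf[symmetric] diff_conv_add_uminus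
      by (intro arg_cong2[of _ _ _ _ "(+)"] sum.cong refl) (simp_all add: cnj_nev_kernel mult_ac)
    also have "(\<Sum>i\<in>A. \<Sum>j<m. - (a j * (cnj (s i) * (cx (e i) * nev_kernel f (z j) (Complex (x i) \<epsilon>))))) = - X \<epsilon>"
      unfolding X_def by (subst sum.swap) (simp add: sum_negf)
    finally show ?thesis by (simp add: gram_def)
  qed
  have "(X \<longlongrightarrow> (\<Sum>j<m. \<Sum>i\<in>A. a j * (cnj (s i) * (cx (e i) * ((f (z j) - cnj (cx (c i / e i))) / (z j - cnj (Complex (x i) 0))))))) (at_right 0)"
    unfolding X_def nev_kernel_def
  proof (intro tendsto_sum tendsto_mult tendsto_divide tendsto_diff tendsto_const tendsto_cnj tendsto_Complex tendsto_ident_at)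
    fix i j assume "i \<in> A" "j \<in> {..<m}"
    then show "((\<lambda>\<epsilon>. f (Complex (x i) \<epsilon>)) \<longlongrightarrow> cx (c i / e i)) (at_right 0)"
      by (intro vlim_value[OF A(2)])
    show "z j - cnj (Complex (x i) 0) \<noteq> 0" using z[of j] \<open>j \<in> _\<close>
      by (auto simp: upper_half_plane_def complex_eq_iff)
  qed
  also have "(\<Sum>j<m. \<Sum>i\<in>A. a j * (cnj (s i) * (cx (e i) * ((f (z j) - cnj (cx (c i / e i))) / (z j - cnj (Complex (x i) 0))))))
      = (\<Sum>j<m. \<Sum>i\<in>A. a j * (cnj (s i) * v i (z j)))"
    using A(1) by (intro sum.cong refl) (auto simp: v_eq_diffq diffq_def Complex_of_real)
  finally have X: "(X \<longlongrightarrow> (\<Sum>j<m. \<Sum>i\<in>A. a j * (cnj (s i) * v i (z j)))) (at_right 0)" .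
  have Y: "(Y \<longlongrightarrow> (\<Sum>i\<in>A. \<Sum>j\<in>A. cnj (s i) * cx (\<Gamma> d i j) * s j)) (at_right 0)"
    unfolding Y_def
    by (intro tendsto_sum tendsto_mult tendsto_const kernel_boundary_limit) (use A in auto)
  have "\<forall>\<^sub>F \<epsilon> in at_right 0. 0 \<le> gram f {..<m} z a - 2 * Re (X \<epsilon>) + Re (Y \<epsilon>)"
    using eventually_at_right_less[of "0::real"]
  proof eventually_elim
    case (elim \<epsilon>)
    show ?case unfolding expand[symmetric]
      by (rule gram_nonneg[OF psd]) (use z elim fin in \<open>auto simp: zz_def\<close>)
  qed
  then have ineq: "0 \<le> gram f {..<m} z a - 2 * Re (\<Sum>j<m. \<Sum>i\<in>A. a j * (cnj (s i) * v i (z j)))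
      + Re (\<Sum>i\<in>A. \<Sum>j\<in>A. cnj (s i) * cx (\<Gamma> d i j) * s j)"
    by (intro tendsto_lowerbound[OF tendsto_add[OF tendsto_diff[OF tendsto_const
          tendsto_mult[OF tendsto_const tendsto_Re[OF X]]] tendsto_Re[OF Y]]]) auto
  have ext: "(\<Sum>i\<in>A. g i) = (\<Sum>i<n. g i)" if "\<And>i. s i = 0 \<Longrightarrow> g i = 0" for g :: "nat \<Rightarrow> complex"
    by (rule sum.mono_neutral_left) (use A(1) s that in auto)
  have lin: "(\<Sum>j<m. \<Sum>i\<in>A. a j * (cnj (s i) * v i (z j))) = (\<Sum>j<m. a j * (\<Sum>i<n. cnj (s i) * v i (z j)))"
    unfolding sum_distrib_left by (intro sum.cong refl ext) simp
  have "Re (\<Sum>i\<in>A. \<Sum>j\<in>A. cnj (s i) * cx (\<Gamma> d i j) * s j) + Re (qform s)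
     = Re (\<Sum>i\<in>A. \<Sum>j\<in>A. cnj (s i) * cx (\<Gamma> d i j + Q i j) * s j)"
  proof -
    have "qform s = (\<Sum>i\<in>A. \<Sum>j\<in>A. cnj (s i) * cx (Q i j) * s j)"
      unfolding qform_def by (subst ext, simp, intro sum.cong refl ext[symmetric]) simp
    then show ?thesis by (simp add: sum.distrib distrib_left distrib_right)
  qed
  also have "(\<Sum>i\<in>A. \<Sum>j\<in>A. cnj (s i) * cx (\<Gamma> d i j + Q i j) * s j) =
     (\<Sum>i\<in>A. \<Sum>j\<in>A. if j = i then cnj (s i) * cx ((e i)\<^sup>2 * d i + Q i i) * s i else 0)"
    by (intro sum.cong refl) (auto simp: \<Gamma>_def)
  also have "\<dots> = (\<Sum>i\<in>A. cx ((cmod (s i))\<^sup>2 * ((e i)\<^sup>2 * d i + Q i i)))"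
    unfolding of_real_mult[of "(cmod _)\<^sup>2"] cnj_mult_self[symmetric]
    using fin by (intro sum.cong refl) (simp add: mult_ac)
  also have "Re \<dots> = (\<Sum>i\<in>A. (cmod (s i))\<^sup>2 * ((e i)\<^sup>2 * d i + Q i i))"
    by (simp only: of_real_sum[symmetric] Re_complex_of_real)
  also have "\<dots> \<le> 0"
    by (intro sum_nonpos mult_nonneg_nonpos) (use A(3) in force)+
  finally show ?thesis using ineq unfolding lin by simp
qed

text \<open>Too large an index would leave a nonzero pair \<open>a\<close>, \<open>s\<close>, with
  \<open>s\<close> supported on \<open>A\<close>, \<open>a\<close> in the negative part of
  \<open>ker\<close> and \<open>comb\<close> in the positive part of \<open>P\<close>. But
  \<open>boundary_dominates\<close> makes the form of \<open>P\<close> at most that of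
  \<open>ker\<close>, so both vanish. Then \<open>a = 0\<close> and \<open>comb = 0\<close>, and
  applying \<open>P\<close> gives \<open>s = 0\<close>.\<close>

lemma inertia_upper_bound:
  assumes A: "A \<subseteq> {..<n}" "\<And>i. i \<in> A \<Longrightarrow> vlim i (d i)" "\<And>i. i \<in> A \<Longrightarrow> (e i)\<^sup>2 * d i \<le> - Q i i"
    and z: "\<And>j. j < m \<Longrightarrow> z j \<in> UHP"
    and diag': "diagonalizes m (\<lambda>i j. ker (z j) (z i)) lam' L'"
  shows "card {k. k < m \<and> lam' k < 0} + card A \<le> card {k. k < n \<and> lam k < 0}"
proof (rule ccontr)
  assume contra: "\<not> ?thesis"
  have fin: "finite A" using A(1) finite_subset by auto
  \<comment> \<open>Equations: the components of \<open>a\<close> with \<open>lam' k >= 0\<close>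
    and those of \<open>comb\<close> with \<open>lam k < 0\<close> vanish. Unknowns: the
    \<open>m\<close> weights and one \<open>s i\<close> for each node in \<open>A\<close>.\<close>
  define I where "I = {k. k < m \<and> lam' k \<ge> 0} <+> {k. k < n \<and> lam k < 0}"
  define J where "J = {..<m} <+> A"
  define coef where "coef = (\<lambda>i j. case i of
      Inl k \<Rightarrow> (case j of Inl j' \<Rightarrow> L' k j' | Inr _ \<Rightarrow> 0)
    | Inr k \<Rightarrow> (case j of Inl j' \<Rightarrow> (\<Sum>l<n. L k l * v l (z j')) | Inr i' \<Rightarrow> (\<Sum>l<n. L k l * cx (Q l i'))))"
  have "card {k. k < m \<and> lam' k \<ge> 0} + card {k. k < m \<and> lam' k < 0} = m"
  proof -
    have "card {k. k < m \<and> lam' k \<ge> 0} + card {k. k < m \<and> lam' k < 0} =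
        card ({k. k < m \<and> lam' k \<ge> 0} \<union> {k. k < m \<and> lam' k < 0})"
      by (rule card_Un_disjoint[symmetric]) auto
    also have "{k. k < m \<and> lam' k \<ge> 0} \<union> {k. k < m \<and> lam' k < 0} = {..<m}" by auto
    finally show ?thesis by simp
  qed
  then have "card I < card J"
    using contra fin by (simp add: I_def J_def card_Plus)
  moreover have "finite I" "finite J" using fin by (auto simp: I_def J_def)
  ultimately obtain t where t: "\<exists>j\<in>J. t j \<noteq> 0" "\<And>i. i \<in> I \<Longrightarrow> (\<Sum>j\<in>J. coef i j * t j) = 0"
    using homogeneous_system_nontrivial[of I J coef] by blast
  define a where "a = (\<lambda>j. t (Inl j))"
  define s where "s = (\<lambda>i. if i \<in> A then t (Inr i) else 0)"
  define u where "u = comb m z a s"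
  have sA: "(\<Sum>i<n. g i * s i) = (\<Sum>i\<in>A. g i * t (Inr i))" for g
    by (rule sum.mono_neutral_cong_right) (use A(1) in \<open>auto simp: s_def\<close>)
  have eq1: "(\<Sum>j<m. L' k j * a j) = 0" if "k < m" "lam' k \<ge> 0" for k
    using t(2)[of "Inl k"] that fin
    by (simp add: I_def J_def sum.Plus coef_def a_def InlI)
  have eq2: "(\<Sum>l<n. L k l * u l) = 0" if "k < n" "lam k < 0" for k
  proof -
    have "(\<Sum>l<n. L k l * u l) = (\<Sum>j<m. (\<Sum>l<n. L k l * v l (z j)) * a j) + (\<Sum>i<n. (\<Sum>l<n. L k l * cx (Q l i)) * s i)"
      unfolding u_def comb_def distrib_left sum.distrib sum_distrib_left sum_distrib_right
      by (intro arg_cong2[of _ _ _ _ "(+)"]; subst sum.swap) (simp_all add: mult_ac)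
    also have "\<dots> = 0"
      unfolding sA using t(2)[of "Inr k"] that fin
      by (simp add: I_def J_def sum.Plus coef_def a_def InrI)
    finally show ?thesis .
  qed
  have form': "Re (\<Sum>i<m. \<Sum>j<m. cnj (a i) * ker (z j) (z i) * a j) =
      (\<Sum>k<m. lam' k * (cmod (\<Sum>j<m. L' k j * a j))\<^sup>2)"
    unfolding diagonalizes_form[OF diag'] by (rule Re_complex_of_real)
  have neg: "lam' k * (cmod (\<Sum>j<m. L' k j * a j))\<^sup>2 \<le> 0" if "k < m" for k
    using eq1[of k] that by (cases "lam' k \<ge> 0") (auto simp: mult_nonpos_nonneg)
  have pos: "lam k * (cmod (\<Sum>j<n. L k j * u j))\<^sup>2 \<ge> 0" if "k < n" for k
    using eq2[of k] that by (cases "lam k < 0") auto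
  have "2 * Re (\<Sum>j<m. a j * (\<Sum>i<n. cnj (s i) * v i (z j))) + Re (qform s) \<le> gram f {..<m} z a"
    by (rule boundary_dominates[OF A _ z]) (auto simp: s_def)
  then have le: "Re (pform u) \<le> (\<Sum>k<m. lam' k * (cmod (\<Sum>j<m. L' k j * a j))\<^sup>2)"
    unfolding u_def pform_comb form' by simp
  have ge: "Re (pform u) \<ge> 0" unfolding pform_diag by (intro sum_nonneg) (use pos in auto)
  have le0: "(\<Sum>k<m. lam' k * (cmod (\<Sum>j<m. L' k j * a j))\<^sup>2) \<le> 0"
    by (intro sum_nonpos) (use neg in auto)
  have "lam' k * (cmod (\<Sum>j<m. L' k j * a j))\<^sup>2 = 0" if "k < m" for k
  proof -
    have "(\<Sum>k<m. - (lam' k * (cmod (\<Sum>j<m. L' k j * a j))\<^sup>2)) = 0"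
      using le ge le0 by (simp add: sum_negf)
    then have "\<forall>k\<in>{..<m}. - (lam' k * (cmod (\<Sum>j<m. L' k j * a j))\<^sup>2) = 0"
      by (subst (asm) sum_nonneg_eq_0_iff) (use neg in auto)
    then show ?thesis using that by simp
  qed
  then have "(\<Sum>j<m. L' k j * a j) = 0" if "k < m" for k
    using eq1[of k] that by fastforce
  then have a0: "a j = 0" if "j < m" for j
    using diagonalizes_inj[OF diag'] that by blast
  have "lam k * (cmod (\<Sum>j<n. L k j * u j))\<^sup>2 = 0" if "k < n" for k
    using sum_nonneg_eq_0_iff[of "{..<n}" "\<lambda>k. lam k * (cmod (\<Sum>j<n. L k j * u j))\<^sup>2"] pos le ge le0 that
    unfolding pform_diag by auto
  then have "(\<Sum>j<n. L k j * u j) = 0" if "k < n" for k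
    using lam_nz[OF that] that by auto
  then have u0: "u j = 0" if "j < n" for j
    using diagonalizes_inj[OF diag] that by blast
  have "s i = 0" if "i < n" for i
  proof -
    have "s i = (\<Sum>j<n. cx (P i j) * u j)"
      using PQ_apply[OF that, of s] by (simp add: u_def comb_def a0)
    then show ?thesis using u0 by simp
  qed
  then have "t (Inr i) = 0" if "i \<in> A" for i using A(1) that unfolding s_def by force
  moreover have "t (Inl j) = 0" if "j < m" for j using a0[OF that] by (simp add: a_def)
  ultimately show False using t(1) by (auto simp: J_def)
qed

end


section \<open>The lower bound for the inertia\<close>

text \<open>The solution \<open>a\<close> of \<open>G a = S\<close> maximizes the concave functional
  of \<open>b\<close> in the first conclusion: expand the form at \<open>a - b\<close>.\<close>

lemma hermitian_form_stationary:
  fixes G :: "nat \<Rightarrow> nat \<Rightarrow> complex"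
  assumes herm: "\<And>i j. i < N \<Longrightarrow> j < N \<Longrightarrow> G j i = cnj (G i j)"
    and psd: "\<And>h. 0 \<le> Re (\<Sum>i<N. \<Sum>j<N. cnj (h i) * G i j * h j)"
    and S: "\<And>k. k < N \<Longrightarrow> S k = (\<Sum>j<N. G k j * a j)"
  shows "2 * Re (\<Sum>k<N. b k * cnj (S k)) - Re (\<Sum>i<N. \<Sum>j<N. cnj (b i) * G i j * b j)
      \<le> Re (\<Sum>i<N. \<Sum>j<N. cnj (a i) * G i j * a j)"
    and "Re (\<Sum>k<N. a k * cnj (S k)) = Re (\<Sum>i<N. \<Sum>j<N. cnj (a i) * G i j * a j)"
proof -
  define g where "g = (\<lambda>b a. \<Sum>i<N. \<Sum>j<N. cnj (b i) * G i j * a j)"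
  have lin: "(\<Sum>k<N. b k * cnj (S k)) = cnj (g b a)" for b
    by (simp add: g_def S cnj_sum sum_distrib_left mult_ac)
  have sym: "cnj (g b a) = g a b" for a b
    unfolding g_def cnj_sum
    by (subst sum.swap) (intro sum.cong refl, simp add: herm[symmetric] mult_ac)
  have psd': "0 \<le> Re (g h h)" for h unfolding g_def by (rule psd)
  have "g (\<lambda>i. a i - b i) (\<lambda>i. a i - b i) = g a a - g a b - g b a + g b b"
    by (simp add: g_def sum_subtractf sum.distrib algebra_simps)
  then have "0 \<le> Re (g a a - g a b - cnj (g a b) + g b b)"
    using psd' by (metis sym)
  then have "2 * Re (g a b) - Re (g b b) \<le> Re (g a a)" by simp
  then show "2 * Re (\<Sum>k<N. b k * cnj (S k)) - Re (\<Sum>i<N. \<Sum>j<N. cnj (b i) * G i j * b j)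
      \<le> Re (\<Sum>i<N. \<Sum>j<N. cnj (a i) * G i j * a j)"
    unfolding lin sym unfolding g_def .
  show "Re (\<Sum>k<N. a k * cnj (S k)) = Re (\<Sum>i<N. \<Sum>j<N. cnj (a i) * G i j * a j)"
    unfolding lin sym unfolding g_def by (rule refl)
qed

section \<open>Compactness of the sphere of coefficient vectors\<close>

lemma continuous_on_apply: "continuous_on A (\<lambda>y :: 'a \<Rightarrow> 'b::topological_space. y i)"
  by (rule continuous_on_product_then_coordinatewise) (rule continuous_on_id)

lemma compact_coordinate_sphere:
  "compact {y :: nat \<Rightarrow> complex. (\<forall>i. i \<notin> B \<longrightarrow> y i = 0) \<and> (\<Sum>i<n. (cmod (y i))\<^sup>2) = 1}"
  if "B \<subseteq> {..<n}"
proof -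
  \<comment> \<open>Vectors are functions on all naturals, so compactness comes from Tychonoff's
    theorem: discs at the coordinates in \<open>B\<close>, the point 0 elsewhere.\<close>
  define S where "S = (\<lambda>i. if i \<in> B then cball (0::complex) 1 else {0})"
  have "compactin (product_topology (\<lambda>i. euclidean) UNIV) (PiE UNIV S)"
    unfolding compactin_PiE by (auto simp: S_def)
  then have cpt: "compact (PiE UNIV S)"
    by (simp add: euclidean_product_topology)
  have "closed {y :: nat \<Rightarrow> complex. (\<Sum>i<n. (cmod (y i))\<^sup>2) = 1}"
    by (intro closed_Collect_eq continuous_intros continuous_on_apply)
  then have "compact (PiE UNIV S \<inter> {y. (\<Sum>i<n. (cmod (y i))\<^sup>2) = 1})"
    by (rule compact_Int_closed[OF cpt])
  also have "PiE UNIV S \<inter> {y. (\<Sum>i<n. (cmod (y i))\<^sup>2) = 1} =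
      {y. (\<forall>i. i \<notin> B \<longrightarrow> y i = 0) \<and> (\<Sum>i<n. (cmod (y i))\<^sup>2) = 1}"
  proof (intro equalityI subsetI)
    fix y assume y: "y \<in> {y. (\<forall>i. i \<notin> B \<longrightarrow> y i = 0) \<and> (\<Sum>i<n. (cmod (y i))\<^sup>2) = 1}"
    have "cmod (y i) \<le> 1" if "i \<in> B" for i
    proof -
      have "(cmod (y i))\<^sup>2 \<le> (\<Sum>i<n. (cmod (y i))\<^sup>2)"
        by (rule member_le_sum) (use that \<open>B \<subseteq> {..<n}\<close> in auto)
      then show ?thesis using y power2_le_imp_le[of "cmod (y i)" 1] by simp
    qed
    then show "y \<in> PiE UNIV S \<inter> {y. (\<Sum>i<n. (cmod (y i))\<^sup>2) = 1}"
      using y by (auto simp: S_def)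
  next
    fix y assume "y \<in> PiE UNIV S \<inter> {y. (\<Sum>i<n. (cmod (y i))\<^sup>2) = 1}"
    then have y: "\<And>i. y i \<in> S i" "(\<Sum>i<n. (cmod (y i))\<^sup>2) = 1" by (auto simp: PiE_def)
    have "y i = 0" if "i \<notin> B" for i using y(1)[of i] that by (simp add: S_def)
    with y(2) show "y \<in> {y. (\<forall>i. i \<notin> B \<longrightarrow> y i = 0) \<and> (\<Sum>i<n. (cmod (y i))\<^sup>2) = 1}" by auto
  qed
  finally show ?thesis .
qed

section \<open>Domination of combinations of the \<open>v i\<close>\<close>

context pick_core
begin

definition vcomb :: "(nat \<Rightarrow> complex) \<Rightarrow> complex \<Rightarrow> complex" where
  "vcomb y z = (\<Sum>i<n. cnj (y i) * v i z)"

definition ntlim :: "nat \<Rightarrow> real \<Rightarrow> bool" where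
  "ntlim i d \<longleftrightarrow> (\<forall>M>0. (diffq i \<longlongrightarrow> cx d) (nt_at M (x i)))"

lemma ntlim_imp_vlim: "ntlim i d \<Longrightarrow> vlim i d"
  unfolding ntlim_def vlim_def
  by (rule filterlim_compose[OF _ filterlim_vertical[of 1]]) auto

lemma node_gap:
  assumes "i < n"
  obtains \<rho> where "\<rho> > 0" "\<And>j. j < n \<Longrightarrow> j \<noteq> i \<Longrightarrow> 2 * \<rho> \<le> \<bar>x i - x j\<bar>"
proof -
  define S where "S = insert 1 ((\<lambda>j. \<bar>x i - x j\<bar>) ` ({..<n} - {i}))"
  have "finite S" "S \<noteq> {}" by (auto simp: S_def)
  have pos: "s > 0" if "s \<in> S" for s
    using that inj_x \<open>i < n\<close> by (auto simp: S_def inj_on_def)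
  show ?thesis
  proof (rule that)
    show "Min S / 2 > 0" using pos[OF Min_in[OF \<open>finite S\<close> \<open>S \<noteq> {}\<close>]] by simp
    show "2 * (Min S / 2) \<le> \<bar>x i - x j\<bar>" if "j < n" "j \<noteq> i" for j
      using Min_le[OF \<open>finite S\<close>, of "\<bar>x i - x j\<bar>"] that by (simp add: S_def)
  qed
qed

text \<open>No control of \<open>f\<close> near \<open>x i\<close> is given in advance. With
  \<open>D = cmod (f z - \<eta>)\<close> and \<open>r = cmod (z - x i)\<close>, the
  \<open>i\<close>-th summand has size \<open>\<beta> * D / r\<close>, the others are bounded by a
  multiple of \<open>1 + D\<close>, and domination bounds the whole sum by the square root of a
  multiple of \<open>D / r\<close>. Absorbing the terms in \<open>D\<close> leaves
  \<open>D <= C * r\<close>.\<close>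

lemma dominated_imp_local_bound:
  assumes dom: "dominated f (vcomb y) cc" and i: "i < n" "y i \<noteq> 0" and M: "M > 0"
  shows "\<exists>C r. r > 0 \<and> (\<forall>z\<in>stolz_angle M (x i). cmod (z - cx (x i)) < r \<longrightarrow>
           cmod (f z - cx (c i / e i)) \<le> C * cmod (z - cx (x i)))"
proof -
  define \<eta> where "\<eta> = c i / e i"
  define \<beta> where "\<beta> = cmod (y i) * \<bar>e i\<bar>"
  have \<beta>: "\<beta> > 0" using i e_nz by (simp add: \<beta>_def)
  obtain \<rho> where \<rho>: "\<rho> > 0" "\<And>j. j < n \<Longrightarrow> j \<noteq> i \<Longrightarrow> 2 * \<rho> \<le> \<bar>x i - x j\<bar>"
    using node_gap[OF i(1)] by blast
  define C1 where "C1 = (\<Sum>j<n. cmod (y j) * (\<bar>e j\<bar> + \<bar>e j * \<eta> - c j\<bar>) / \<rho>)"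
  have C1: "C1 \<ge> 0" unfolding C1_def using \<rho>(1) by (intro sum_nonneg) auto
  have "dominated f (vcomb y) cc \<Longrightarrow> 0 \<le> cc"
    unfolding dominated_def by (drule spec[of _ 0]) (simp add: gram_def)
  then have cc: "cc \<ge> 0" using dom by blast
  define K where "K = cc * (M + 1)"
  have K: "K \<ge> 0" using cc M by (simp add: K_def)
  \<comment> \<open>The first bound keeps \<open>z\<close> at distance at least \<rho> from the
    other nodes, the second makes \<open>C1 * r * D\<close> at most a quarter of
    \<open>\<beta> * D\<close>.\<close>
  define r0 where "r0 = min \<rho> (\<beta> / (4 * (C1 + 1)))"
  have r0: "r0 > 0" using \<rho> \<beta> C1 by (simp add: r0_def)
  show ?thesis
  proof (rule exI[of _ "2 * (K / \<beta> + C1) / \<beta>"], rule exI[of _ r0], intro conjI ballI impI r0)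
    fix z assume z: "z \<in> stolz_angle M (x i)" and near: "cmod (z - cx (x i)) < r0"
    define r where "r = cmod (z - cx (x i))"
    define D where "D = cmod (f z - cx \<eta>)"
    have Imz: "Im z > 0" using z by (simp add: stolz_angle_def)
    have zU: "z \<in> UHP" using Imz by (simp add: upper_half_plane_def)
    have r: "r > 0" using Imz by (auto simp: r_def complex_eq_iff)
    have D: "D \<ge> 0" by (simp add: D_def)
    have vb: "cmod (v j z) \<le> (\<bar>e j\<bar> + \<bar>e j * \<eta> - c j\<bar>) / \<rho> * (1 + D)" if "j < n" "j \<noteq> i" for j
    proof -
      have num: "cx (e j) * f z - cx (c j) =
          cx (e j) * (f z - cx \<eta>) + cx (e j * \<eta> - c j)"
        by (simp add: algebra_simps)
      have "cmod (cx (e j) * f z - cx (c j)) \<le> \<bar>e j\<bar> * D + \<bar>e j * \<eta> - c j\<bar>"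
        unfolding num D_def by (rule order_trans[OF norm_triangle_ineq]) (simp add: norm_mult del: of_real_diff of_real_mult)
      also have "\<dots> \<le> (\<bar>e j\<bar> + \<bar>e j * \<eta> - c j\<bar>) * (1 + D)"
        using D by (simp add: algebra_simps)
      finally have n1: "cmod (cx (e j) * f z - cx (c j)) \<le> (\<bar>e j\<bar> + \<bar>e j * \<eta> - c j\<bar>) * (1 + D)" .
      have "2 * \<rho> \<le> cmod (cx (x i) - cx (x j))"
        using \<rho>(2)[OF that] by (simp flip: of_real_diff)
      also have "\<dots> \<le> r + cmod (z - cx (x j))"
        unfolding r_def using norm_triangle_ineq[of "cx (x i) - z" "z - cx (x j)"]
        by (simp add: norm_minus_commute)
      finally have n2: "\<rho> \<le> cmod (z - cx (x j))"
        using near unfolding r_def[symmetric] r0_def by simp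
      have "cmod (v j z) = cmod (cx (e j) * f z - cx (c j)) / cmod (z - cx (x j))"
        by (simp add: v_def norm_divide)
      also have "\<dots> \<le> (\<bar>e j\<bar> + \<bar>e j * \<eta> - c j\<bar>) * (1 + D) / \<rho>"
        by (rule frac_le) (use n1 n2 \<rho>(1) D in auto)
      finally show ?thesis by simp
    qed
    have "vcomb y z = cnj (y i) * v i z + (\<Sum>j\<in>{..<n}-{i}. cnj (y j) * v j z)"
      unfolding vcomb_def using i(1) by (simp add: sum.remove)
    then have "cnj (y i) * v i z = vcomb y z - (\<Sum>j\<in>{..<n}-{i}. cnj (y j) * v j z)" by simp
    then have "cmod (cnj (y i) * v i z) \<le> cmod (vcomb y z) + cmod (\<Sum>j\<in>{..<n}-{i}. cnj (y j) * v j z)"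
      by (simp only: norm_triangle_ineq4)
    also have "cmod (\<Sum>j\<in>{..<n}-{i}. cnj (y j) * v j z) \<le> (\<Sum>j\<in>{..<n}-{i}. cmod (y j) * (\<bar>e j\<bar> + \<bar>e j * \<eta> - c j\<bar>) / \<rho> * (1 + D))"
    proof (rule sum_norm_le)
      fix j assume "j \<in> {..<n} - {i}"
      then have "cmod (y j) * cmod (v j z) \<le> cmod (y j) * ((\<bar>e j\<bar> + \<bar>e j * \<eta> - c j\<bar>) / \<rho> * (1 + D))"
        by (intro mult_left_mono vb) auto
      then show "cmod (cnj (y j) * v j z) \<le> cmod (y j) * (\<bar>e j\<bar> + \<bar>e j * \<eta> - c j\<bar>) / \<rho> * (1 + D)"
        by (simp add: norm_mult)
    qed
    also have "\<dots> \<le> (\<Sum>j<n. cmod (y j) * (\<bar>e j\<bar> + \<bar>e j * \<eta> - c j\<bar>) / \<rho> * (1 + D))"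
      using \<rho>(1) D by (intro sum_mono2) auto
    also have "\<dots> = C1 * (1 + D)" by (simp add: C1_def sum_distrib_right)
    also have "cmod (cnj (y i) * v i z) = \<beta> * D / r"
      unfolding v_eq_diffq[OF i(1)] by (simp add: diffq_def norm_mult norm_divide \<beta>_def D_def r_def \<eta>_def)
    finally have main: "\<beta> * D \<le> r * cmod (vcomb y z) + C1 * r * (1 + D)"
      using r by (simp add: divide_le_eq algebra_simps)
    have "(cmod (vcomb y z))\<^sup>2 \<le> cc * (Im (f z) / Im z)"
      by (rule dominated_pointwise[OF dom psd zU])
    also have "\<dots> \<le> cc * (D * (M + 1) / r)"
    proof (rule mult_left_mono[OF _ cc])
      have "Im (f z) \<le> D"
        using abs_Im_le_cmod[of "f z - cx \<eta>"] by (simp add: D_def)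
      moreover have "r \<le> (M + 1) * Im z" unfolding r_def by (rule stolz_angle_norm_le[OF z])
      then have "1 / Im z \<le> (M + 1) / r" using r Imz by (simp add: field_simps)
      ultimately have "Im (f z) * (1 / Im z) \<le> D * ((M + 1) / r)"
        using D Imz by (intro mult_mono) auto
      then show "Im (f z) / Im z \<le> D * (M + 1) / r" by simp
    qed
    finally have F2: "(cmod (vcomb y z))\<^sup>2 \<le> cc * (D * (M + 1) / r)" .
    have "(r * cmod (vcomb y z))\<^sup>2 = r\<^sup>2 * (cmod (vcomb y z))\<^sup>2" by (simp add: power_mult_distrib)
    also have "\<dots> \<le> r\<^sup>2 * (cc * (D * (M + 1) / r))" by (rule mult_left_mono[OF F2]) simp
    also have "\<dots> = K * D * r" using r by (simp add: K_def power2_eq_square)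
    \<comment> \<open>Inequality of the means, weighted so that it costs only another quarter of
      \<open>\<beta> * D\<close>; half of that term survives on the left.\<close>
    also have "\<dots> \<le> (\<beta> * D / 4 + K * r / \<beta>)\<^sup>2"
    proof -
      have "0 \<le> (\<beta> * D / 4 - K * r / \<beta>)\<^sup>2" by simp
      also have "(\<beta> * D / 4 - K * r / \<beta>)\<^sup>2 = (\<beta> * D / 4 + K * r / \<beta>)\<^sup>2 - K * D * r"
        using \<beta> by (simp add: power2_eq_square field_simps)
      finally show ?thesis by simp
    qed
    finally have "r * cmod (vcomb y z) \<le> \<beta> * D / 4 + K * r / \<beta>"
      by (rule power2_le_imp_le) (use \<beta> D K r in auto)
    moreover have "C1 * r * D \<le> \<beta> * D / 4"
    proof -
      have "r \<le> \<beta> / (4 * (C1 + 1))" using near by (simp add: r_def r0_def)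
      then have "(C1 + 1) * r \<le> \<beta> / 4" using C1 by (simp add: field_simps)
      then have "C1 * r \<le> \<beta> / 4" using r by (simp add: algebra_simps)
      from mult_right_mono[OF this D] show ?thesis by simp
    qed
    ultimately have "\<beta> * D / 2 \<le> (K / \<beta> + C1) * r"
      using main by (simp add: algebra_simps)
    then have "D \<le> 2 * (K / \<beta> + C1) / \<beta> * r" using \<beta> by (simp add: field_simps)
    then show "cmod (f z - cx (c i / e i)) \<le> 2 * (K / \<beta> + C1) / \<beta> * cmod (z - cx (x i))"
      by (simp add: D_def r_def \<eta>_def)
  qed
qed

lemma dominated_imp_ntlim:
  assumes "dominated f (vcomb y) cc" "i < n" "y i \<noteq> 0"
  shows "\<exists>d\<ge>0. ntlim i d"
  using julia_caratheodory[OF psd dominated_imp_local_bound[OF assms]]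
  unfolding ntlim_def diffq_def by blast

lemma \<Gamma>_sym: "i < n \<Longrightarrow> j < n \<Longrightarrow> \<Gamma> d i j = \<Gamma> d j i"
  by (simp add: \<Gamma>_def Q_sym)

text \<open>Domination is tested at the points \<open>x i + \<i> \<epsilon>\<close> with weights
  \<open>y i * e i\<close>. The corresponding combinations of kernel functions tend to
  \<open>vcomb y\<close> itself, so the limit reads \<open>2 * N <= N + cc\<close> with
  \<open>N\<close> the squared norm of \<open>vcomb y\<close>. Adding \<open>qform y\<close> leaves
  the diagonal of \<open>\<Gamma> d + Q\<close>.\<close>

lemma dominated_imp_boundary_gram_le:
  assumes dom: "dominated f (vcomb y) cc"
    and A: "A = {i. i < n \<and> y i \<noteq> 0}" and lim: "\<And>i. i \<in> A \<Longrightarrow> vlim i (d i)"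
  shows "(\<Sum>i\<in>A. (cmod (y i))\<^sup>2 * ((e i)\<^sup>2 * d i + Q i i)) \<le> cc + Re (qform y)"
proof -
  have An: "A \<subseteq> {..<n}" using A by auto
  have fin: "finite A" using An finite_subset by auto
  define z where "z = (\<lambda>\<epsilon> i. Complex (x i) \<epsilon>)"
  define a where "a = (\<lambda>i. y i * cx (e i))"
  define X where "X = (\<lambda>\<epsilon>. \<Sum>i\<in>A. \<Sum>j\<in>A. y i * cnj (y j) * (cx (e i) * v j (z \<epsilon> i)))"
  define Y where "Y = (\<lambda>\<epsilon>. \<Sum>i\<in>A. \<Sum>j\<in>A. cnj (y i) * (cx (e i) * nev_kernel f (z \<epsilon> j) (z \<epsilon> i) * cx (e j)) * y j)"
  define N where "N = (\<Sum>i\<in>A. \<Sum>j\<in>A. cnj (y i) * cx (\<Gamma> d i j) * y j)"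
  have X: "(X \<longlongrightarrow> (\<Sum>i\<in>A. \<Sum>j\<in>A. y i * cnj (y j) * cx (\<Gamma> d i j))) (at_right 0)"
    unfolding X_def z_def
    by (intro tendsto_sum tendsto_mult tendsto_const v_boundary_limit) (use An lim in auto)
  have NX: "(\<Sum>i\<in>A. \<Sum>j\<in>A. y i * cnj (y j) * cx (\<Gamma> d i j)) = N"
    unfolding N_def
    by (subst sum.swap, intro sum.cong refl, subst \<Gamma>_sym) (use An in \<open>auto simp: mult_ac\<close>)
  have Y: "(Y \<longlongrightarrow> N) (at_right 0)"
    unfolding Y_def z_def N_def
    by (intro tendsto_sum tendsto_mult tendsto_const kernel_boundary_limit) (use An lim in auto)
  have ext: "(\<Sum>i<n. g i) = (\<Sum>i\<in>A. g i)" if "\<And>i. y i = 0 \<Longrightarrow> g i = 0" for g :: "nat \<Rightarrow> complex"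
    by (rule sum.mono_neutral_right) (use A that in auto)
  have "\<forall>\<^sub>F \<epsilon> in at_right 0. 2 * Re (X \<epsilon>) \<le> Re (Y \<epsilon>) + cc"
    using eventually_at_right_less[of "0::real"]
  proof eventually_elim
    case (elim \<epsilon>)
    have "2 * Re (\<Sum>i\<in>A. a i * vcomb y (z \<epsilon> i)) \<le> gram f A (z \<epsilon>) a + cc"
      by (rule dominated_reindex[OF dom fin]) (use elim in \<open>auto simp: z_def\<close>)
    moreover have "(\<Sum>i\<in>A. a i * vcomb y (z \<epsilon> i)) = X \<epsilon>"
      unfolding X_def vcomb_def a_def
      by (subst ext) (auto simp: sum_distrib_left mult_ac)
    moreover have "gram f A (z \<epsilon>) a = Re (Y \<epsilon>)"
      unfolding gram_def Y_def a_def by (simp add: mult_ac)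
    ultimately show ?case by simp
  qed
  then have "2 * Re N \<le> Re N + cc"
    by (intro tendsto_le[OF _ tendsto_add[OF tendsto_Re[OF Y] tendsto_const]
        tendsto_mult[OF tendsto_const tendsto_Re[OF X[unfolded NX]]]]) auto
  then have N: "Re N \<le> cc" by simp
  have "N + qform y = (\<Sum>i\<in>A. \<Sum>j\<in>A. cnj (y i) * cx (\<Gamma> d i j + Q i j) * y j)"
  proof -
    have "qform y = (\<Sum>i\<in>A. \<Sum>j\<in>A. cnj (y i) * cx (Q i j) * y j)"
      unfolding qform_def by (subst ext, simp, intro sum.cong refl ext) simp
    then show ?thesis by (simp add: N_def sum.distrib distrib_left distrib_right)
  qed
  also have "\<dots> = (\<Sum>i\<in>A. \<Sum>j\<in>A. if j = i then cnj (y i) * cx ((e i)\<^sup>2 * d i + Q i i) * y i else 0)"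
    by (intro sum.cong refl) (auto simp: \<Gamma>_def)
  also have "\<dots> = (\<Sum>i\<in>A. cx ((cmod (y i))\<^sup>2 * ((e i)\<^sup>2 * d i + Q i i)))"
    unfolding of_real_mult[of "(cmod _)\<^sup>2"] cnj_mult_self[symmetric]
    using fin by (intro sum.cong refl) (simp add: mult_ac)
  finally have "Re (N + qform y) = (\<Sum>i\<in>A. (cmod (y i))\<^sup>2 * ((e i)\<^sup>2 * d i + Q i i))"
    by (simp only: of_real_sum[symmetric] Re_complex_of_real)
  then show ?thesis using N by simp
qed

text \<open>Domination would give every node in the support of \<open>y\<close> a finite angular
  derivative. The diagonal form at \<open>y\<close> would then be nonpositive, although each of its
  terms is positive at bad nodes.\<close>

lemma not_dominated:
  assumes "\<And>i. i \<in> B \<Longrightarrow> i < n"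
    and bad: "\<And>i d. i \<in> B \<Longrightarrow> 0 \<le> d \<Longrightarrow> ntlim i d \<Longrightarrow> 0 < (e i)\<^sup>2 * d + Q i i"
    and y: "\<And>i. i \<notin> B \<Longrightarrow> y i = 0" and nz: "y k \<noteq> 0"
  shows "\<not> dominated f (vcomb y) (- Re (qform y))"
proof
  assume dom: "dominated f (vcomb y) (- Re (qform y))"
  define A where "A = {i. i < n \<and> y i \<noteq> 0}"
  have AB: "A \<subseteq> B" using y by (auto simp: A_def)
  have "\<exists>d. \<forall>i\<in>A. 0 \<le> d i \<and> ntlim i (d i)"
    by (rule bchoice) (use dominated_imp_ntlim[OF dom] in \<open>auto simp: A_def\<close>)
  then obtain d where d: "\<And>i. i \<in> A \<Longrightarrow> 0 \<le> d i \<and> ntlim i (d i)" by blast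
  have "(\<Sum>i\<in>A. (cmod (y i))\<^sup>2 * ((e i)\<^sup>2 * d i + Q i i)) \<le> - Re (qform y) + Re (qform y)"
    by (rule dominated_imp_boundary_gram_le[OF dom A_def]) (use d ntlim_imp_vlim in blast)
  moreover have "0 < (\<Sum>i\<in>A. (cmod (y i))\<^sup>2 * ((e i)\<^sup>2 * d i + Q i i))"
  proof (rule sum_pos)
    show "finite A" by (simp add: A_def)
    show "A \<noteq> {}" using nz y[of k] assms(1)[of k] by (auto simp: A_def)
    show "0 < (cmod (y i))\<^sup>2 * ((e i)\<^sup>2 * d i + Q i i)" if "i \<in> A" for i
      using bad[of i "d i"] d[OF that] AB that by (intro mult_pos_pos) (auto simp: A_def)
  qed
  ultimately show False by simp
qed

section \<open>Finite tests that refute domination by \<open>- qform y\<close>\<close>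

definition excess :: "nat \<Rightarrow> (nat \<Rightarrow> complex) \<Rightarrow> (nat \<Rightarrow> complex) \<Rightarrow> (nat \<Rightarrow> complex) \<Rightarrow> real" where
  "excess m z a y = 2 * Re (\<Sum>j<m. a j * vcomb y (z j)) + Re (qform y) - gram f {..<m} z a"

text \<open>Test points have to lie where the transform is analytic, that is, off the zeros of its
  denominator. This set \<Omega> is dense, and strict positivity survives a small move since
  \<open>f\<close> is continuous.\<close>

lemma excess_perturb:
  assumes cont: "continuous_on UHP f"
    and \<Omega>: "\<Omega> \<subseteq> UHP" "UHP \<subseteq> closure \<Omega>"
    and z: "\<And>j. j < m \<Longrightarrow> z j \<in> UHP" and pos: "excess m z a y > 0"
  shows "\<exists>z'. (\<forall>j<m. z' j \<in> \<Omega>) \<and> excess m z' a y > 0"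
proof -
  have "\<exists>s. \<forall>j\<in>{..<m}. (\<forall>k::nat. s j k \<in> \<Omega>) \<and> s j \<longlonglongrightarrow> z j"
  proof (rule bchoice, rule ballI)
    fix j assume "j \<in> {..<m}"
    then have "z j \<in> closure \<Omega>" using z \<Omega>(2) by auto
    then show "\<exists>s. (\<forall>k::nat. s k \<in> \<Omega>) \<and> s \<longlonglongrightarrow> z j" by (simp add: closure_sequential)
  qed
  then obtain s where s: "\<And>j k. j < m \<Longrightarrow> s j k \<in> \<Omega>" "\<And>j. j < m \<Longrightarrow> s j \<longlonglongrightarrow> z j"
    by auto
  have fs: "(\<lambda>k. f (s j k)) \<longlonglongrightarrow> f (z j)" if "j < m" for j
    by (rule continuous_on_tendsto_compose[OF cont s(2)[OF that] z[OF that]]) (intro always_eventually allI, use s(1)[OF that] \<Omega>(1) in auto)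
  have nz: "z j - cnj (z i) \<noteq> 0" if "i < m" "j < m" for i j
    using z[OF that(1)] z[OF that(2)] by (auto simp: upper_half_plane_def complex_eq_iff)
  have nz': "z j - cx (x i) \<noteq> 0" if "j < m" for i j
    using z[OF that] by (auto simp: upper_half_plane_def complex_eq_iff)
  have "(\<lambda>k. excess m (\<lambda>j. s j k) a y) \<longlonglongrightarrow> excess m z a y"
    unfolding excess_def gram_def vcomb_def v_def nev_kernel_def
    by (intro tendsto_add tendsto_diff tendsto_mult tendsto_const tendsto_Re tendsto_sum
        tendsto_divide tendsto_cnj fs s(2) nz nz') auto
  then have "\<forall>\<^sub>F k in sequentially. excess m (\<lambda>j. s j k) a y > 0"
    using pos by (rule order_tendstoD(1))
  then obtain k where "excess m (\<lambda>j. s j k) a y > 0"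
    using eventually_happens trivial_limit_sequentially by blast
  then show ?thesis using s(1) by (intro exI[of _ "\<lambda>j. s j k"]) auto
qed

lemma excess_scale:
  "excess m z (\<lambda>j. cx r * a j) (\<lambda>i. cx r * y i) = r\<^sup>2 * excess m z a y"
proof -
  have 1: "(\<Sum>j<m. (cx r * a j) * vcomb (\<lambda>i. cx r * y i) (z j)) =
      cx (r\<^sup>2) * (\<Sum>j<m. a j * vcomb y (z j))"
    by (simp add: vcomb_def sum_distrib_left mult_ac power2_eq_square)
  have 2: "qform (\<lambda>i. cx r * y i) = cx (r\<^sup>2) * qform y"
    by (simp add: qform_def sum_distrib_left mult_ac power2_eq_square)
  have "gram f {..<m} z (\<lambda>j. cx r * a j) = Re (cx (r\<^sup>2) *
     (\<Sum>i<m. \<Sum>j<m. cnj (a i) * nev_kernel f (z j) (z i) * a j))"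
    unfolding gram_def by (rule arg_cong[of _ _ Re], simp add: sum_distrib_left mult_ac power2_eq_square)
  then have 3: "gram f {..<m} z (\<lambda>j. cx r * a j) = r\<^sup>2 * gram f {..<m} z a"
    unfolding gram_def by (simp only: scaleR_conv_of_real[symmetric] scaleR_complex.simps)
  have Re_scale: "Re (cx s * w) = s * Re w" for s w by simp
  show ?thesis
    unfolding excess_def 1 2 3 Re_scale
    by (simp only: right_diff_distrib distrib_left mult.left_commute[of 2])
qed

text \<open>
  The penalty \<open>\<delta>\<close> leaves room to replace the possibly singular Gram matrix by an invertible one.
\<close>

lemma uniform_excess:
  assumes cont: "continuous_on UHP f"
    and \<Omega>: "\<Omega> \<subseteq> UHP" "UHP \<subseteq> closure \<Omega>"
    and B: "\<And>i. i \<in> B \<Longrightarrow> i < n"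
    and bad: "\<And>i d. i \<in> B \<Longrightarrow> 0 \<le> d \<Longrightarrow> ntlim i d \<Longrightarrow> 0 < (e i)\<^sup>2 * d + Q i i"
  shows "\<exists>N z \<delta>. 0 < N \<and> 0 < \<delta> \<and> (\<forall>k<N. z k \<in> \<Omega>) \<and>
    (\<forall>y. (\<forall>i. i \<notin> B \<longrightarrow> y i = 0) \<and> (\<exists>i. y i \<noteq> 0) \<longrightarrow>
       (\<exists>a. \<delta> * (\<Sum>k<N. (cmod (a k))\<^sup>2) < excess N z a y))"
proof -
  define T where "T = {y :: nat \<Rightarrow> complex. (\<forall>i. i \<notin> B \<longrightarrow> y i = 0) \<and> (\<Sum>i<n. (cmod (y i))\<^sup>2) = 1}"
  have cT: "compact T" unfolding T_def by (rule compact_coordinate_sphere) (use B in auto)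
  \<comment> \<open>Tests with an attached penalty: each defines an open set of vectors
    \<open>y\<close>, and by \<open>not_dominated\<close> these sets cover the sphere.\<close>
  define C where "C = {(m, z, a :: nat \<Rightarrow> complex, \<delta>) | m z a \<delta>. (\<forall>j<(m::nat). z j \<in> \<Omega>) \<and> (0::real) < \<delta>}"
  define U where "U = (\<lambda>(m, z, a, \<delta>). {y. \<delta> * (\<Sum>j<m. (cmod (a j))\<^sup>2) < excess m z a y})"
  have openU: "open (U t)" for t
  proof (cases t)
    case (fields m z a \<delta>)
    have "open {y. \<delta> * (\<Sum>j<m. (cmod (a j))\<^sup>2) < excess m z a y}"
      unfolding excess_def vcomb_def qform_def
      by (intro open_Collect_less continuous_intros continuous_on_apply)
    then show ?thesis by (simp add: U_def fields)
  qed
  have cover: "T \<subseteq> (\<Union>t\<in>C. U t)"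
  proof
    fix y assume y: "y \<in> T"
    have "\<exists>k. y k \<noteq> 0"
    proof (rule ccontr)
      assume "\<not> ?thesis"
      then show False using y by (simp add: T_def)
    qed
    then obtain k where "y k \<noteq> 0" by blast
    then have "\<not> dominated f (vcomb y) (- Re (qform y))"
      using not_dominated[of B y k] B bad y by (auto simp: T_def)
    then have "\<exists>(m::nat) z a. (\<forall>j<m. z j \<in> UHP) \<and> \<not> 2 * Re (\<Sum>j<m. a j * vcomb y (z j)) \<le> gram f {..<m} z a + - Re (qform y)"
      unfolding dominated_def by (simp only: not_all not_imp)
    then obtain m :: nat and z a where "\<forall>j<m. z j \<in> UHP" "\<not> 2 * Re (\<Sum>j<m. a j * vcomb y (z j)) \<le> gram f {..<m} z a + - Re (qform y)"
      by (elim exE conjE) blast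
    then have "\<forall>j<m. z j \<in> UHP" "excess m z a y > 0" by (auto simp: excess_def)
    then obtain z' where z': "\<forall>j<m. z' j \<in> \<Omega>" "excess m z' a y > 0"
      using excess_perturb[OF cont \<Omega>, of m z a y] by blast
    define s where "s = (\<Sum>j<m. (cmod (a j))\<^sup>2)"
    have s: "s \<ge> 0" unfolding s_def by (intro sum_nonneg) auto
    define \<delta> where "\<delta> = excess m z' a y / (s + 1)"
    have "\<delta> > 0" using z' s by (simp add: \<delta>_def)
    moreover have "\<delta> * s < excess m z' a y" using z' s by (simp add: \<delta>_def field_simps)
    ultimately have "(m, z', a, \<delta>) \<in> C" "y \<in> U (m, z', a, \<delta>)"
      using z' by (auto simp: C_def U_def s_def)
    then show "y \<in> (\<Union>t\<in>C. U t)" by blast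
  qed
  obtain C0 where C0: "C0 \<subseteq> C" "finite C0" "T \<subseteq> (\<Union>t\<in>C0. U t)"
    by (rule compactE_image[OF cT openU cover])
  have "\<i> \<in> closure \<Omega>" using \<Omega>(2) by (auto simp: upper_half_plane_def)
  then obtain p where p: "p \<in> \<Omega>" by (cases "\<Omega> = {}") auto
  \<comment> \<open>A dummy test with one point and weight 0 ensures that the list of points and the
    set of penalties, whose minimum is taken, are not empty.\<close>
  define C' where "C' = insert (1, (\<lambda>_. p), (\<lambda>_. 0), 1) C0"
  have C': "C' \<subseteq> C" "finite C'" "T \<subseteq> (\<Union>t\<in>C'. U t)"
    using C0 p by (auto simp: C'_def C_def)
  \<comment> \<open>The points of the finitely many tests are listed together; a single test is
    extended to the whole list by weight 0.\<close>
  define I where "I = Sigma C' (\<lambda>t. {..<fst t})"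
  have finI: "finite I" using C'(2) by (simp add: I_def)
  obtain h where h: "bij_betw h {..<card I} I"
    using ex_bij_betw_nat_finite[OF finI] by (auto simp: atLeast0LessThan)
  define N where "N = card I"
  have "((1, (\<lambda>_. p), (\<lambda>_. 0), 1), 0) \<in> I" by (auto simp: I_def C'_def)
  then have N0: "N > 0" unfolding N_def using finI by (auto simp: card_gt_0_iff)
  define zz where "zz = (\<lambda>k. fst (snd (fst (h k))) (snd (h k)))"
  have zz: "zz k \<in> \<Omega>" if "k < N" for k
  proof -
    have "h k \<in> I" using h that by (auto simp: bij_betw_def N_def)
    then have "fst (h k) \<in> C" "snd (h k) < fst (fst (h k))" using C'(1) by (auto simp: I_def)
    then show ?thesis unfolding C_def zz_def by (cases "fst (h k)") auto
  qed
  define \<delta> where "\<delta> = Min ((\<lambda>t. snd (snd (snd t))) ` C')"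
  have "C' \<noteq> {}" by (simp add: C'_def)
  have \<delta>le: "\<delta> \<le> snd (snd (snd t))" if "t \<in> C'" for t
    unfolding \<delta>_def using that C'(2) by (intro Min_le) auto
  have \<delta>0: "\<delta> > 0"
  proof -
    have "\<delta> \<in> (\<lambda>t. snd (snd (snd t))) ` C'"
      unfolding \<delta>_def using C'(2) \<open>C' \<noteq> {}\<close> by (intro Min_in) auto
    then show ?thesis using C'(1) by (auto simp: C_def)
  qed
  have sphere: "\<exists>a. \<delta> * (\<Sum>k<N. (cmod (a k))\<^sup>2) < excess N zz a y" if "y \<in> T" for y
  proof -
    obtain t where t: "t \<in> C'" "y \<in> U t" using C'(3) \<open>y \<in> T\<close> by blast
    obtain m z a \<delta>' where tt: "t = (m, z, a, \<delta>')" by (cases t)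
    define a' where "a' = (\<lambda>k. if fst (h k) = t then a (snd (h k)) else 0)"
    have sumI: "(\<Sum>q\<in>I. if fst q = t then g (snd q) else 0) = (\<Sum>j<m. g j)"
      for g :: "nat \<Rightarrow> 'z::comm_monoid_add"
    proof -
      have "(\<Sum>q\<in>I. if fst q = t then g (snd q) else 0) = (\<Sum>s\<in>C'. \<Sum>j<fst s. if s = t then g j else 0)"
        unfolding I_def using C'(2) by (subst sum.Sigma) (auto simp: case_prod_unfold)
      also have "\<dots> = (\<Sum>s\<in>C'. if s = t then (\<Sum>j<m. g j) else 0)"
        by (intro sum.cong refl) (simp add: tt)
      also have "\<dots> = (\<Sum>j<m. g j)" using t(1) C'(2) by simp
      finally show ?thesis .
    qed
    have sumN: "(\<Sum>k<N. if fst (h k) = t then g (snd (h k)) else 0) = (\<Sum>j<m. g j)"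
      for g :: "nat \<Rightarrow> 'z::comm_monoid_add"
      using sumI[of g] sum.reindex_bij_betw[OF h, of "\<lambda>q. if fst q = t then g (snd q) else 0"]
      by (simp add: N_def)
    have zt: "zz k = z (snd (h k))" if "fst (h k) = t" for k
      using that by (simp add: zz_def tt)
    have 1: "(\<Sum>k<N. a' k * vcomb y (zz k)) = (\<Sum>j<m. a j * vcomb y (z j))"
      unfolding sumN[of "\<lambda>j. a j * vcomb y (z j)", symmetric]
      by (intro sum.cong refl) (auto simp: a'_def zt)
    have 2: "(\<Sum>k<N. (cmod (a' k))\<^sup>2) = (\<Sum>j<m. (cmod (a j))\<^sup>2)"
      unfolding sumN[of "\<lambda>j. (cmod (a j))\<^sup>2", symmetric]
      by (intro sum.cong refl) (auto simp: a'_def)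
    have "(\<Sum>i<N. \<Sum>j<N. cnj (a' i) * nev_kernel f (zz j) (zz i) * a' j) =
       (\<Sum>i<m. \<Sum>j<m. cnj (a i) * nev_kernel f (z j) (z i) * a j)"
    proof -
      have "(\<Sum>j<N. cnj (a' i) * nev_kernel f (zz j) (zz i) * a' j) =
        (if fst (h i) = t then \<Sum>j<m. cnj (a (snd (h i))) * nev_kernel f (z j) (z (snd (h i))) * a j else 0)" for i
        unfolding sumN[of "\<lambda>j. cnj (a (snd (h i))) * nev_kernel f (z j) (z (snd (h i))) * a j", symmetric]
        by (auto simp: a'_def zt intro!: sum.cong)
      then show ?thesis
        using sumN[of "\<lambda>i. \<Sum>j<m. cnj (a i) * nev_kernel f (z j) (z i) * a j"] by simp
    qed
    then have 3: "excess N zz a' y = excess m z a y" by (simp only: excess_def gram_def 1)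
    have "\<delta> * (\<Sum>j<m. (cmod (a j))\<^sup>2) \<le> \<delta>' * (\<Sum>j<m. (cmod (a j))\<^sup>2)"
      using \<delta>le[OF t(1)] by (intro mult_right_mono sum_nonneg) (auto simp: tt)
    also have "\<dots> < excess m z a y" using t(2) by (simp add: U_def tt)
    finally show ?thesis unfolding 2[symmetric] 3[symmetric] by blast
  qed
  have "\<exists>a. \<delta> * (\<Sum>k<N. (cmod (a k))\<^sup>2) < excess N zz a y"
    if yB: "\<forall>i. i \<notin> B \<longrightarrow> y i = 0" and "y i \<noteq> 0" for y i
  proof -
    \<comment> \<open>Both sides are homogeneous of degree two under real scaling, so
      \<open>y\<close> may be normalized to the sphere.\<close>
    define r where "r = sqrt (\<Sum>i<n. (cmod (y i))\<^sup>2)"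
    have iB: "i < n" using that B by blast
    have "0 < (cmod (y i))\<^sup>2" using that by simp
    also have "\<dots> \<le> (\<Sum>i<n. (cmod (y i))\<^sup>2)" by (rule member_le_sum) (use iB in auto)
    finally have r: "r > 0" "r\<^sup>2 = (\<Sum>i<n. (cmod (y i))\<^sup>2)" by (auto simp: r_def)
    define y1 where "y1 = (\<lambda>i. y i / cx r)"
    have "(\<Sum>i<n. (cmod (y1 i))\<^sup>2) = (\<Sum>i<n. (cmod (y i))\<^sup>2) / r\<^sup>2"
      using r(1) by (simp add: y1_def norm_divide power_divide sum_divide_distrib)
    also have "\<dots> = 1" unfolding r(2)[symmetric] using r(1) by simp
    finally have "(\<Sum>i<n. (cmod (y1 i))\<^sup>2) = 1" .
    moreover have "y1 i = 0" if "i \<notin> B" for i using yB that by (simp add: y1_def)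
    ultimately have "y1 \<in> T" unfolding T_def by blast
    then obtain a where a: "\<delta> * (\<Sum>k<N. (cmod (a k))\<^sup>2) < excess N zz a y1" using sphere by blast
    have y: "y = (\<lambda>i. cx r * y1 i)" using r(1) by (simp add: y1_def)
    have "\<delta> * (\<Sum>k<N. (cmod (cx r * a k))\<^sup>2) = r\<^sup>2 * (\<delta> * (\<Sum>k<N. (cmod (a k))\<^sup>2))"
      by (simp add: norm_mult power_mult_distrib sum_distrib_left mult_ac)
    also have "\<dots> < r\<^sup>2 * excess N zz a y1" using a r(1) by (intro mult_strict_left_mono) auto
    also have "\<dots> = excess N zz (\<lambda>k. cx r * a k) y"
      unfolding y by (rule excess_scale[symmetric])
    finally show ?thesis by (rule exI[of _ "\<lambda>k. cx r * a k"])
  qed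
  then show ?thesis using N0 \<delta>0 zz by blast
qed

text \<open>The points are those of \<open>uniform_excess\<close>. If the bound failed, there would
  be a nonzero pair \<open>a\<close>, \<open>y\<close> with \<open>y\<close> supported on
  \<open>B\<close>, \<open>a\<close> in the nonnegative part of \<open>ker\<close>,
  \<open>comb\<close> in the negative part of \<open>P\<close>, and \<open>a\<close> stationary for
  the penalized excess. A stationary \<open>a\<close> is a maximizer, so for nonzero
  \<open>y\<close> its excess is positive, and \<open>pform_comb\<close> contradicts the signs. The
  additive form of the bound avoids truncated subtraction.\<close>

lemma inertia_lower_bound:
  assumes cont: "continuous_on UHP f"
    and \<Omega>: "\<Omega> \<subseteq> UHP" "UHP \<subseteq> closure \<Omega>"
    and B: "\<And>i. i \<in> B \<Longrightarrow> i < n"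
    and bad: "\<And>i d. i \<in> B \<Longrightarrow> 0 \<le> d \<Longrightarrow> ntlim i d \<Longrightarrow> 0 < (e i)\<^sup>2 * d + Q i i"
  shows "\<exists>N z. 0 < N \<and> (\<forall>k<N. z k \<in> \<Omega>) \<and>
    (\<forall>lam' L'. diagonalizes N (\<lambda>i j. ker (z j) (z i)) lam' L' \<longrightarrow>
       card {k. k < n \<and> lam k < 0} + card B \<le> card {k. k < N \<and> lam' k < 0} + n)"
proof -
  have "\<exists>N z \<delta>. 0 < N \<and> 0 < \<delta> \<and> (\<forall>k<N. z k \<in> \<Omega>) \<and>
    (\<forall>y. (\<forall>i. i \<notin> B \<longrightarrow> y i = 0) \<and> (\<exists>i. y i \<noteq> 0) \<longrightarrow>
       (\<exists>a. \<delta> * (\<Sum>k<N. (cmod (a k))\<^sup>2) < excess N z a y))"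
    by (rule uniform_excess[OF cont \<Omega>]) (fact B, fact bad)
  then obtain N z \<delta> where N: "0 < N" and \<delta>: "0 < \<delta>" and z': "\<forall>k<N. z k \<in> \<Omega>"
    and ex': "\<forall>y. (\<forall>i. i \<notin> B \<longrightarrow> y i = 0) \<and> (\<exists>i. y i \<noteq> 0) \<longrightarrow>
       (\<exists>a. \<delta> * (\<Sum>k<N. (cmod (a k))\<^sup>2) < excess N z a y)"
    by (elim exE conjE)
  have z: "z k \<in> \<Omega>" if "k < N" for k using z' that by simp
  have ex: "\<exists>a. \<delta> * (\<Sum>k<N. (cmod (a k))\<^sup>2) < excess N z a y"
    if "\<forall>i. i \<notin> B \<longrightarrow> y i = 0" "y i \<noteq> 0" for y i
    by (rule ex'[rule_format]) (use that in auto)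
  have finB: "finite B" using B by (meson finite_lessThan finite_subset lessThan_iff subsetI)
  have zU: "z k \<in> UHP" if "k < N" for k using z[OF that] \<Omega>(1) by blast
  \<comment> \<open>The penalty on the diagonal makes the Gram matrix definite, so stationarity
    forces \<open>a = 0\<close> when \<open>y = 0\<close>.\<close>
  define G where "G = (\<lambda>i j. nev_kernel f (z j) (z i) + (if i = j then cx \<delta> else 0))"
  have Gherm: "G j i = cnj (G i j)" for i j by (simp add: G_def cnj_nev_kernel)
  have Gform: "Re (\<Sum>i<N. \<Sum>j<N. cnj (h i) * G i j * h j) = gram f {..<N} z h + \<delta> * (\<Sum>k<N. (cmod (h k))\<^sup>2)" for h
  proof -
    have "(\<Sum>i<N. \<Sum>j<N. cnj (h i) * G i j * h j) = (\<Sum>i<N. \<Sum>j<N. cnj (h i) * nev_kernel f (z j) (z i) * h j)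
        + (\<Sum>i<N. \<Sum>j<N. if i = j then cnj (h i) * cx \<delta> * h j else 0)"
      unfolding sum.distrib[symmetric] by (intro sum.cong refl) (auto simp: G_def algebra_simps)
    also have "(\<Sum>i<N. \<Sum>j<N. if i = j then cnj (h i) * cx \<delta> * h j else 0) =
        (\<Sum>i<N. cx \<delta> * (cnj (h i) * h i))"
      by (intro sum.cong refl) (simp add: mult_ac)
    also have "\<dots> = cx (\<delta> * (\<Sum>k<N. (cmod (h k))\<^sup>2))"
      unfolding cnj_mult_self by (simp only: of_real_mult of_real_sum sum_distrib_left)
    finally show ?thesis by (simp only: gram_def plus_complex.simps Re_complex_of_real)
  qed
  have gram0: "0 \<le> gram f {..<N} z h" for h by (rule gram_nonneg[OF psd]) (use zU in auto)
  have Gpsd: "0 \<le> Re (\<Sum>i<N. \<Sum>j<N. cnj (h i) * G i j * h j)" for h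
    unfolding Gform using gram0[of h] \<delta> by (intro add_nonneg_nonneg mult_nonneg_nonneg sum_nonneg) auto
  have "card {k. k < n \<and> lam k < 0} + card B \<le> card {k. k < N \<and> lam' k < 0} + n"
    if diag': "diagonalizes N (\<lambda>i j. ker (z j) (z i)) lam' L'" for lam' L'
  proof (rule ccontr)
    assume contra: "\<not> ?thesis"
    have "card {k. k < n \<and> lam k > 0} + card {k. k < n \<and> lam k < 0} = n"
    proof -
      have "card {k. k < n \<and> lam k > 0} + card {k. k < n \<and> lam k < 0} =
          card ({k. k < n \<and> lam k > 0} \<union> {k. k < n \<and> lam k < 0})"
        by (rule card_Un_disjoint[symmetric]) auto
      also have "{k. k < n \<and> lam k > 0} \<union> {k. k < n \<and> lam k < 0} = {..<n}"
        using lam_nz by (auto simp: neq_iff)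
      finally show ?thesis by simp
    qed
    \<comment> \<open>The \<open>N\<close> stationarity equations are balanced by the
      \<open>N\<close> weights; what counts is \<open>card B\<close> against the number of negative
      \<open>lam'\<close> plus that of positive \<open>lam\<close>.\<close>
    define I where "I = {..<N} <+> ({k. k < N \<and> lam' k < 0} <+> {k. k < n \<and> lam k > 0})"
    define J where "J = {..<N} <+> B"
    define coef where "coef = (\<lambda>i j. case i of
        Inl k \<Rightarrow> (case j of Inl j' \<Rightarrow> G k j' | Inr i' \<Rightarrow> - cnj (v i' (z k)))
      | Inr (Inl k) \<Rightarrow> (case j of Inl j' \<Rightarrow> L' k j' | Inr _ \<Rightarrow> 0)
      | Inr (Inr k) \<Rightarrow> (case j of Inl j' \<Rightarrow> (\<Sum>l<n. L k l * v l (z j')) | Inr i' \<Rightarrow> (\<Sum>l<n. L k l * cx (Q l i'))))"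
    have "card I < card J"
      using contra finB \<open>card {k. k < n \<and> lam k > 0} + _ = n\<close> by (simp add: I_def J_def card_Plus)
    moreover have "finite I" "finite J" using finB by (auto simp: I_def J_def)
    ultimately obtain t where t: "\<exists>j\<in>J. t j \<noteq> 0" "\<And>i. i \<in> I \<Longrightarrow> (\<Sum>j\<in>J. coef i j * t j) = 0"
      using homogeneous_system_nontrivial[of I J coef] by blast
    define a where "a = (\<lambda>j. t (Inl j))"
    define y where "y = (\<lambda>i. if i \<in> B then t (Inr i) else 0)"
    define S where "S = (\<lambda>k. \<Sum>i<n. y i * cnj (v i (z k)))"
    have sB: "(\<Sum>i<n. g i * y i) = (\<Sum>i\<in>B. g i * t (Inr i))" for g
      by (rule sum.mono_neutral_cong_right) (use B in \<open>auto simp: y_def\<close>)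
    have sumJ: "(\<Sum>j\<in>J. g j) = (\<Sum>j<N. g (Inl j)) + (\<Sum>i\<in>B. g (Inr i))" for g :: "nat + nat \<Rightarrow> complex"
      unfolding J_def using finB by (simp add: sum.Plus)
    have stat: "S k = (\<Sum>j<N. G k j * a j)" if "k < N" for k
    proof -
      have "Inl k \<in> I" using that by (auto simp: I_def)
      from t(2)[OF this] have "(\<Sum>j<N. G k j * a j) + (\<Sum>i\<in>B. (- cnj (v i (z k))) * t (Inr i)) = 0"
        by (simp add: sumJ coef_def a_def)
      also have "(\<Sum>i\<in>B. (- cnj (v i (z k))) * t (Inr i)) = (\<Sum>i<n. (- cnj (v i (z k))) * y i)"
        by (rule sB[symmetric])
      also have "\<dots> = - S k" by (simp add: S_def sum_negf mult_ac)
      finally show ?thesis by simp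
    qed
    have eq1: "(\<Sum>j<N. L' k j * a j) = 0" if "k < N" "lam' k < 0" for k
    proof -
      have "Inr (Inl k) \<in> I" using that by (auto simp: I_def)
      from t(2)[OF this] show ?thesis by (simp add: sumJ coef_def a_def)
    qed
    define u where "u = comb N z a y"
    have eq2: "(\<Sum>l<n. L k l * u l) = 0" if "k < n" "lam k > 0" for k
    proof -
      have "(\<Sum>l<n. L k l * u l) = (\<Sum>j<N. (\<Sum>l<n. L k l * v l (z j)) * a j) + (\<Sum>i<n. (\<Sum>l<n. L k l * cx (Q l i)) * y i)"
        unfolding u_def comb_def distrib_left sum.distrib sum_distrib_left sum_distrib_right
        by (intro arg_cong2[of _ _ _ _ "(+)"]; subst sum.swap) (simp_all add: mult_ac)
      also have "\<dots> = 0"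
      proof -
        have "Inr (Inr k) \<in> I" using that by (auto simp: I_def)
        from t(2)[OF this] show ?thesis unfolding sB by (simp add: sumJ coef_def a_def)
      qed
      finally show ?thesis .
    qed
    have lin: "(\<Sum>k<N. b k * cnj (S k)) = (\<Sum>k<N. b k * vcomb y (z k))" for b
      by (simp add: S_def vcomb_def cnj_sum)
    note st = hermitian_form_stationary[of N G S a, OF Gherm Gpsd stat]
    have gramS: "Re (\<Sum>k<N. a k * vcomb y (z k)) = gram f {..<N} z a + \<delta> * (\<Sum>k<N. (cmod (a k))\<^sup>2)"
      using st(2) unfolding lin Gform .
    show False
    proof (cases "\<exists>i. y i \<noteq> 0")
      case True
      then obtain i where "y i \<noteq> 0" by blast
      then obtain b where b: "\<delta> * (\<Sum>k<N. (cmod (b k))\<^sup>2) < excess N z b y"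
        using ex[of y i] by (auto simp: y_def)
      have "2 * Re (\<Sum>k<N. b k * vcomb y (z k)) - (gram f {..<N} z b + \<delta> * (\<Sum>k<N. (cmod (b k))\<^sup>2))
          \<le> gram f {..<N} z a + \<delta> * (\<Sum>k<N. (cmod (a k))\<^sup>2)"
        using st(1)[of b] unfolding lin Gform .
      then have "\<delta> * (\<Sum>k<N. (cmod (a k))\<^sup>2) < excess N z a y"
        using b gramS unfolding excess_def by linarith
      moreover have "0 \<le> \<delta> * (\<Sum>k<N. (cmod (a k))\<^sup>2)"
        using \<delta> by (intro mult_nonneg_nonneg sum_nonneg) auto
      ultimately have pos: "excess N z a y > 0" by linarith
      have "Re (pform u) = Re (\<Sum>i<N. \<Sum>j<N. cnj (a i) * ker (z j) (z i) * a j) + excess N z a y"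
        unfolding u_def pform_comb excess_def vcomb_def by linarith
      moreover have "Re (\<Sum>i<N. \<Sum>j<N. cnj (a i) * ker (z j) (z i) * a j) \<ge> 0"
        unfolding diagonalizes_form[OF diag'] Re_complex_of_real
      proof (intro sum_nonneg)
        fix k assume "k \<in> {..<N}"
        then show "0 \<le> lam' k * (cmod (\<Sum>j<N. L' k j * a j))\<^sup>2"
          using eq1[of k] by (cases "lam' k < 0") auto
      qed
      moreover have "Re (pform u) \<le> 0"
        unfolding pform_diag
      proof (intro sum_nonpos)
        fix k assume "k \<in> {..<n}"
        then show "lam k * (cmod (\<Sum>j<n. L k j * u j))\<^sup>2 \<le> 0"
          using eq2[of k] by (cases "lam k > 0") (auto simp: mult_nonpos_nonneg)
      qed
      ultimately show False using pos by linarith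
    next
      case False
      then have y0: "y i = 0" for i by blast
      have "gram f {..<N} z a + \<delta> * (\<Sum>k<N. (cmod (a k))\<^sup>2) = 0"
        using gramS by (simp add: vcomb_def y0)
      moreover have "0 \<le> \<delta> * (\<Sum>k<N. (cmod (a k))\<^sup>2)"
        using \<delta> by (intro mult_nonneg_nonneg sum_nonneg) auto
      ultimately have "(\<Sum>k<N. (cmod (a k))\<^sup>2) = 0"
        using gram0[of a] \<delta> by (smt (verit) mult_eq_0_iff)
      then have "a k = 0" if "k < N" for k
        using that by (subst (asm) sum_nonneg_eq_0_iff) auto
      then show False using t(1) y0 by (auto simp: J_def a_def y_def split: if_splits) metis
    qed
  qed
  then show ?thesis using N z by blast
qed

end


section \<open>The Nevanlinna class\<close>

lemma open_upper_half_plane: "open UHP"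
  unfolding upper_half_plane_def by (rule open_halfspace_Im_gt)

lemma connected_upper_half_plane: "connected UHP"
  unfolding upper_half_plane_def by (intro convex_connected convex_halfspace_Im_gt)

section \<open>Kernel matrices and the functions of class 0\<close>

lemma kernel_matrix_carrier: "kernel_matrix f zs \<in> carrier_mat (length zs) (length zs)"
  by (simp add: kernel_matrix_def)

lemma kernel_matrix_index:
  "i < length zs \<Longrightarrow> j < length zs \<Longrightarrow> kernel_matrix f zs $$ (i, j) = nev_kernel f (zs ! j) (zs ! i)"
  by (simp add: kernel_matrix_def)

lemma kernel_matrix_inertia:
  obtains lam L where "diagonalizes (length zs) (\<lambda>i j. nev_kernel f (zs ! j) (zs ! i)) lam L"
    "num_neg_eigenvalues (kernel_matrix f zs) = card {k. k < length zs \<and> lam k < 0}"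
proof -
  obtain lam L where *: "diagonalizes (length zs) (\<lambda>i j. kernel_matrix f zs $$ (i, j)) lam L"
    "num_neg_eigenvalues (kernel_matrix f zs) = card {k. k < length zs \<and> lam k < 0}"
    by (rule hermitian_inertia[OF kernel_matrix_carrier, of zs f])
       (simp_all add: kernel_matrix_index cnj_nev_kernel)
  then have "diagonalizes (length zs) (\<lambda>i j. nev_kernel f (zs ! j) (zs ! i)) lam L"
    by (intro diagonalizes_cong[OF *(1)]) (simp add: kernel_matrix_index)
  with *(2) that show ?thesis by blast
qed

lemma nev_class_0_form_nonneg:
  fixes m :: nat
  assumes f: "f \<in> nev_class 0" and z: "\<And>j. j < m \<Longrightarrow> z j \<in> analyticity_domain f"
  shows "0 \<le> Re (\<Sum>i<m. \<Sum>j<m. cnj (a i) * nev_kernel f (z j) (z i) * a j)"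
proof (cases "m = 0")
  case False
  define zs where "zs = map z [0..<m]"
  have len: "length zs = m" and nth: "\<And>i. i < m \<Longrightarrow> zs ! i = z i" by (auto simp: zs_def)
  have "zs \<noteq> []" "set zs \<subseteq> analyticity_domain f" using False z by (auto simp: zs_def)
  then have "num_neg_eigenvalues (kernel_matrix f zs) \<le> 0"
    using f unfolding nev_class_def by blast
  moreover obtain lam L where lam: "diagonalizes m (\<lambda>i j. nev_kernel f (zs ! j) (zs ! i)) lam L"
    "num_neg_eigenvalues (kernel_matrix f zs) = card {k. k < m \<and> lam k < 0}"
    using kernel_matrix_inertia[of zs f] unfolding len by blast
  ultimately have "{k. k < m \<and> lam k < 0} = {}" by simp
  then have "lam k \<ge> 0" if "k < m" for k using that by force
  then have "0 \<le> Re (\<Sum>i<m. \<Sum>j<m. cnj (a i) * nev_kernel f (zs ! j) (zs ! i) * a j)"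
    unfolding diagonalizes_form[OF lam(1)] Re_complex_of_real by (intro sum_nonneg) auto
  then show ?thesis by (simp add: nth)
qed simp

lemma nev_class_0_Im_nonneg:
  assumes f: "f \<in> nev_class 0" and z: "z \<in> analyticity_domain f"
  shows "0 \<le> Im (f z)"
proof -
  have zU: "z \<in> UHP" using z by (simp add: analyticity_domain_def)
  have "0 \<le> Re (\<Sum>i<Suc 0. \<Sum>j<Suc 0. cnj 1 * nev_kernel f z z * 1)"
    using nev_class_0_form_nonneg[OF f, of "Suc 0" "\<lambda>_. z" "\<lambda>_. 1"] z by simp
  then have "0 \<le> Im (f z) / Im z" using nev_kernel_diag[OF zU] by simp
  then show ?thesis using zU by (simp add: upper_half_plane_def zero_le_divide_iff)
qed

text \<open>At a pole the reciprocal would extend holomorphically by 0 and, not being constant, take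
  values with positive imaginary part by the open mapping theorem. But reciprocals of numbers in the
  closed upper half plane have nonpositive imaginary part.\<close>

lemma nev_class_0_analyticity_domain:
  assumes f: "f \<in> nev_class 0"
  shows "analyticity_domain f = UHP"
proof (rule antisym)
  show "UHP \<subseteq> analyticity_domain f"
  proof
    fix p assume p: "p \<in> UHP"
    have nm: "f nicely_meromorphic_on UHP" using f by (simp add: nev_class_def)
    have "\<not> is_pole f p"
    proof
      assume pole: "is_pole f p"
      have mero: "f meromorphic_on {p}"
        using nm p unfolding nicely_meromorphic_on_def by (blast intro: meromorphic_on_subset)
      obtain r1 where r1: "r1 > 0" "f analytic_on ball p r1 - {p}"
        using meromorphic_on_isolated_singularity[OF mero] by (auto simp: isolated_singularity_at_def)
      obtain r2 where r2: "r2 > 0" "ball p r2 \<subseteq> UHP"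
        using open_upper_half_plane p openE by blast
      have "\<forall>\<^sub>F z in at p. f z \<noteq> 0" by (rule non_zero_neighbour_pole[OF pole])
      then obtain r3 where r3: "r3 > 0" "\<And>z. z \<noteq> p \<Longrightarrow> dist z p < r3 \<Longrightarrow> f z \<noteq> 0"
        unfolding eventually_at by auto
      define r where "r = min r1 (min r2 r3)"
      have r: "r > 0" using r1 r2 r3 by (simp add: r_def)
      define g where "g = (\<lambda>z. if z = p then 0 else inverse (f z))"
      have fhol: "f holomorphic_on ball p r - {p}"
        by (rule analytic_imp_holomorphic, rule analytic_on_subset[OF r1(2)]) (auto simp: r_def)
      have g: "g holomorphic_on ball p r"
        unfolding g_def
        by (rule is_pole_inverse_holomorphic[OF _ fhol pole])
           (use r3 in \<open>auto simp: r_def dist_commute\<close>)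
      have gim: "Im (g z) \<le> 0" if "z \<in> ball p r" for z
      proof (cases "z = p")
        case False
        have "f analytic_on {z}"
          by (rule analytic_on_subset[OF r1(2)]) (use that False in \<open>auto simp: r_def\<close>)
        moreover have "z \<in> UHP" using r2(2) that by (auto simp: r_def)
        ultimately have "0 \<le> Im (f z)"
          by (intro nev_class_0_Im_nonneg[OF f]) (simp add: analyticity_domain_def)
        then show ?thesis using False by (simp add: g_def divide_nonneg_nonneg)
      qed (simp add: g_def)
      have "p + cx (r/2) \<in> ball p r - {p}" using r by (auto simp: dist_norm)
      then have "g (p + cx (r/2)) \<noteq> 0"
        using r3(2)[of "p + cx (r/2)"] r by (auto simp: g_def r_def dist_norm)
      then have nonconst: "\<not> g constant_on ball p r"
        using \<open>p + _ \<in> _\<close> r unfolding constant_on_def by (metis DiffD1 centre_in_ball g_def)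
      have "open (g ` ball p r)"
        by (rule open_mapping_thm[OF g _ _ _ _ nonconst]) auto
      moreover have "0 \<in> g ` ball p r" using r by (auto simp: g_def intro!: image_eqI[of _ _ p])
      ultimately obtain s where s: "s > 0" "ball 0 s \<subseteq> g ` ball p r" by (meson openE)
      have "\<i> * cx (s/2) \<in> ball 0 s" using s by (simp add: norm_mult)
      then obtain z where "z \<in> ball p r" "g z = \<i> * cx (s/2)" using s(2) by (metis imageE subsetD)
      moreover from this(2) have "Im (g z) = s / 2" by (simp only:) simp
      ultimately show False using gim[of z] s(1) by simp
    qed
    then have "f analytic_on {p}" by (rule nicely_meromorphic_on_imp_analytic_at[OF nm p])
    then show "p \<in> analyticity_domain f" using p by (simp add: analyticity_domain_def)
  qed
qed (auto simp: analyticity_domain_def)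

lemma nev_class_0_holomorphic:
  assumes "f \<in> nev_class 0"
  shows "f holomorphic_on UHP"
proof -
  have "f analytic_on UHP"
    unfolding analytic_on_analytic_at[of f UHP]
    using nev_class_0_analyticity_domain[OF assms] by (auto simp: analyticity_domain_def)
  then show ?thesis by (rule analytic_imp_holomorphic)
qed

lemma nev_class_0_psd:
  assumes "f \<in> nev_class 0"
  shows "nev_psd f"
  unfolding nev_psd_def
  using nev_class_0_form_nonneg[OF assms] nev_class_0_analyticity_domain[OF assms] by auto

text \<open>A nonconstant \<open>f\<close> with a real value would, being open, also take values
  below the real axis; a constant \<open>f\<close> equals \<open>f \<i>\<close>. So one real number
  has to be avoided.\<close>

lemma nev_class_0_neq_real:
  assumes f: "f \<in> nev_class 0" and t: "t \<noteq> Re (f \<i>)" and z: "z \<in> UHP"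
  shows "f z \<noteq> cx t"
proof (cases "f constant_on UHP")
  case True
  have "\<i> \<in> UHP" by (simp add: upper_half_plane_def)
  then have "f z = f \<i>" using True z unfolding constant_on_def by metis
  then show ?thesis using t by auto
next
  case False
  have "open (f ` UHP)"
    by (rule open_mapping_thm[OF nev_class_0_holomorphic[OF f] open_upper_half_plane
          connected_upper_half_plane open_upper_half_plane subset_refl False])
  then obtain r where r: "r > 0" "ball (f z) r \<subseteq> f ` UHP"
    using z by (meson imageI openE)
  show ?thesis
  proof
    assume eq: "f z = cx t"
    have "cx t - \<i> * cx (r/2) \<in> ball (f z) r"
      using r(1) unfolding eq by (simp add: dist_norm norm_mult)
    then obtain p where "p \<in> UHP" "f p = cx t - \<i> * cx (r/2)"
      using r(2) by (metis imageE subsetD)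
    then show False
      using nev_psd_Im_nonneg[OF nev_class_0_psd[OF f], of p] r(1) by simp
  qed
qed

text \<open>The new kernel is the old one times the factor \<open>1 / (f - t)\<close> and a
  conjugate factor of the same kind, which is a diagonal congruence.\<close>

lemma nev_psd_moebius:
  assumes psd: "nev_psd f" and nz: "\<And>z. z \<in> UHP \<Longrightarrow> f z \<noteq> cx t"
  shows "nev_psd (\<lambda>z. - 1 / (f z - cx t))"
  unfolding nev_psd_def
proof (intro allI impI)
  fix m :: nat and z a assume z: "\<forall>j<m. z j \<in> UHP"
  define b where "b = (\<lambda>j. a j / (f (z j) - cx t))"
  have "cnj (a i) * nev_kernel (\<lambda>z. - 1 / (f z - cx t)) (z j) (z i) * a j =
        cnj (b i) * nev_kernel f (z j) (z i) * b j" if "i < m" "j < m" for i j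
  proof -
    have 1: "f (z j) - cx t \<noteq> 0" "f (z i) - cx t \<noteq> 0" using nz z that by auto
    then have 2: "cnj (f (z i)) - cx t \<noteq> 0"
      by (metis complex_cnj_complex_of_real complex_cnj_diff complex_cnj_zero_iff)
    have "- 1 / u - - 1 / w = (u - w) / (u * w)" if "u \<noteq> 0" "w \<noteq> 0" for u w :: complex
      using that by (simp add: field_simps)
    from this[OF 1(1) 2] have "nev_kernel (\<lambda>z. - 1 / (f z - cx t)) (z j) (z i) =
       (f (z j) - cnj (f (z i))) / ((f (z j) - cx t) * (cnj (f (z i)) - cx t)) / (z j - cnj (z i))"
      by (simp add: nev_kernel_def)
    then show ?thesis by (simp add: b_def nev_kernel_def mult_ac)
  qed
  then have "(\<Sum>i<m. \<Sum>j<m. cnj (a i) * nev_kernel (\<lambda>z. - 1 / (f z - cx t)) (z j) (z i) * a j) =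
     (\<Sum>i<m. \<Sum>j<m. cnj (b i) * nev_kernel f (z j) (z i) * b j)"
    by (intro sum.cong refl) auto
  then show "0 \<le> Re (\<Sum>i<m. \<Sum>j<m. cnj (a i) * nev_kernel (\<lambda>z. - 1 / (f z - cx t)) (z j) (z i) * a j)"
    using psd z unfolding nev_psd_def by simp
qed

lemma nev_psd_zero: "nev_psd (\<lambda>_. 0)"
  by (simp add: nev_psd_def nev_kernel_def)


section \<open>The boundary conditions\<close>

lemma eventually_stolz_angle:
  "\<forall>\<^sub>F z in nt_at M x. z \<in> stolz_angle M x \<and> z \<in> UHP \<and> z \<noteq> cx x"
  unfolding eventually_at using stolz_angle_subset by (intro exI[of _ 1]) auto

text \<open>The Cauchy estimate on discs of radius \<open>Im z / 2\<close>, applied to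
  \<open>f\<close> minus its linear approximation at \<open>x\<close>. These discs may leave the
  Stolz angle for \<open>M\<close> but stay in the one for \<open>2 * M + 1\<close>, hence limits in
  all Stolz angles are assumed.\<close>

lemma nt_limit_deriv:
  fixes f :: "complex \<Rightarrow> complex"
  assumes hol: "f holomorphic_on UHP"
    and lim: "\<And>M. M > 0 \<Longrightarrow> ((\<lambda>z. (f z - \<eta>) / (z - cx x)) \<longlongrightarrow> d) (nt_at M x)"
  shows "nt_limit (deriv f) (nhds d) x"
  unfolding nt_limit_def
proof (intro allI impI tendstoI)
  fix M e :: real assume M: "M > 0" and e: "e > 0"
  \<comment> \<open>The Cauchy estimate will bound the error by
    \<open>4 * (\<epsilon> * (M + 1))\<close>, which is \<open>e / 2\<close>.\<close>
  define \<epsilon> where "\<epsilon> = e / (8 * (M + 1))"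
  have \<epsilon>: "\<epsilon> > 0" using M e by (simp add: \<epsilon>_def)
  have "\<forall>\<^sub>F w in at (cx x) within stolz_angle (2*M+1) x. dist ((f w - \<eta>) / (w - cx x)) d < \<epsilon>"
    using M by (intro tendstoD[OF lim \<epsilon>]) simp
  then obtain r where r: "r > 0" "\<And>w. w \<in> stolz_angle (2*M+1) x \<Longrightarrow> w \<noteq> cx x \<Longrightarrow>
      dist w (cx x) < r \<Longrightarrow> dist ((f w - \<eta>) / (w - cx x)) d < \<epsilon>"
    unfolding eventually_at by auto
  have "\<forall>\<^sub>F z in nt_at M x. z \<in> stolz_angle M x \<and> dist z (cx x) < r / 2"
    unfolding eventually_at using r(1) by (intro exI[of _ "r/2"]) auto
  then show "\<forall>\<^sub>F z in nt_at M x. dist (deriv f z) d < e"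
  proof eventually_elim
    case (elim z)
    then have z: "z \<in> stolz_angle M x" and near: "cmod (z - cx x) < r / 2" by (auto simp: dist_norm)
    have Imz: "Im z > 0" using z by (simp add: stolz_angle_def)
    define g where "g = (\<lambda>w. f w - \<eta> - d * (w - cx x))"
    define \<rho> where "\<rho> = Im z / 2"
    have \<rho>: "\<rho> > 0" using Imz by (simp add: \<rho>_def)
    have w: "w \<in> UHP \<and> cmod (g w) \<le> 2 * \<epsilon> * (M + 1) * Im z" if "w \<in> cball z \<rho>" for w
    proof -
      have d1: "cmod (w - z) \<le> Im z / 2" using that by (simp add: \<rho>_def dist_norm norm_minus_commute)
      have Re: "\<bar>Re w - Re z\<bar> \<le> Im z / 2" and Im: "\<bar>Im w - Im z\<bar> \<le> Im z / 2"
        using abs_Re_le_cmod[of "w - z"] abs_Im_le_cmod[of "w - z"] d1 by simp_all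
      have Imw: "Im w \<ge> Im z / 2" using Im by linarith
      have "\<bar>Re w - x\<bar> \<le> \<bar>Re w - Re z\<bar> + \<bar>Re z - x\<bar>" by linarith
      also have "\<dots> \<le> Im z / 2 + M * Im z" using Re z by (simp add: stolz_angle_def)
      also have "\<dots> = (2 * M + 1) * (Im z / 2)" by (simp add: field_simps)
      also have "\<dots> \<le> (2 * M + 1) * Im w" using Imw M by (intro mult_left_mono) auto
      finally have ws: "w \<in> stolz_angle (2*M+1) x" using Imw Imz by (simp add: stolz_angle_def)
      have wx: "w \<noteq> cx x" using Imw Imz by auto
      have "Im z \<le> cmod (z - cx x)" using abs_Im_le_cmod[of "z - cx x"] by simp
      moreover have "cmod (w - cx x) \<le> cmod (w - z) + cmod (z - cx x)"
        using norm_triangle_ineq[of "w - z" "z - cx x"] by simp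
      ultimately have d2: "cmod (w - cx x) \<le> 2 * cmod (z - cx x)"
        using d1 norm_ge_zero[of "z - cx x"] by linarith
      have "dist w (cx x) < r" using d2 near by (simp add: dist_norm)
      then have "cmod ((f w - \<eta>) / (w - cx x) - d) \<le> \<epsilon>"
        using r(2)[OF ws wx] by (simp add: dist_norm)
      moreover have "g w = ((f w - \<eta>) / (w - cx x) - d) * (w - cx x)"
      proof -
        have "(A / b - d) * b = A - d * b" if "b \<noteq> 0" for A b :: complex
          using that by (simp add: left_diff_distrib)
        from this[of "w - cx x"] show ?thesis using wx by (simp add: g_def)
      qed
      ultimately have "cmod (g w) \<le> \<epsilon> * cmod (w - cx x)"
        by (simp add: norm_mult mult_right_mono)
      also have "\<dots> \<le> \<epsilon> * (2 * ((M + 1) * Im z))"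
        using d2 stolz_angle_norm_le[OF z] \<epsilon> by (intro mult_left_mono) auto
      finally have "cmod (g w) \<le> 2 * \<epsilon> * (M + 1) * Im z" by (simp add: mult_ac)
      moreover have "w \<in> UHP" using Imw Imz by (simp add: upper_half_plane_def)
      ultimately show ?thesis by blast
    qed
    have ghol: "g holomorphic_on UHP" unfolding g_def by (intro holomorphic_intros hol)
    have sub: "cball z \<rho> \<subseteq> UHP" using w by blast
    have "norm ((deriv ^^ 1) g z) \<le> fact 1 * (2 * \<epsilon> * (M + 1) * Im z) / \<rho> ^ 1"
    proof (rule Cauchy_inequality)
      show "g holomorphic_on ball z \<rho>" using ghol sub by (meson ball_subset_cball holomorphic_on_subset)
      show "continuous_on (cball z \<rho>) g"
        using holomorphic_on_imp_continuous_on[OF holomorphic_on_subset[OF ghol sub]] .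
      show "cmod (g w) \<le> 2 * \<epsilon> * (M + 1) * Im z" if "norm (z - w) = \<rho>" for w
        using w[of w] that by (simp add: dist_norm)
    qed (rule \<rho>)
    also have "fact 1 * (2 * \<epsilon> * (M + 1) * Im z) / \<rho> ^ 1 = 4 * (\<epsilon> * (M + 1))"
      using Imz by (simp add: \<rho>_def)
    also have "\<epsilon> * (M + 1) = e / 8"
    proof -
      have "e / (8 * m) * m = e / 8" if "m \<noteq> 0" for m :: real using that by simp
      from this[of "M + 1"] show ?thesis using M by (simp add: \<epsilon>_def)
    qed
    also have "4 * (e / 8) = e / 2" by simp
    finally have "cmod (deriv g z) \<le> e / 2" by simp
    moreover have "deriv g z = deriv f z - d"
    proof -
      have zU: "z \<in> UHP" using Imz by (simp add: upper_half_plane_def)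
      have "(f has_field_derivative deriv f z) (at z)"
        using holomorphic_derivI[OF hol _ zU] by (simp add: upper_half_plane_def open_halfspace_Im_gt)
      then have "(g has_field_derivative deriv f z - d) (at z)"
        unfolding g_def by (auto intro!: derivative_eq_intros)
      then show ?thesis by (simp add: DERIV_imp_deriv)
    qed
    ultimately show ?case using e by (simp add: dist_norm)
  qed
qed

lemma nt_limit_vertical:
  assumes "nt_limit f F x"
  shows "filterlim (\<lambda>\<epsilon>. f (Complex x \<epsilon>)) F (at_right 0)"
  by (rule filterlim_compose[OF _ filterlim_vertical[of 1]]) (use assms in \<open>auto simp: nt_limit_def\<close>)

text \<open>A converse along the vertical ray: the derivative of \<open>f w - d * w\<close> is small
  on a vertical segment ending at \<open>x\<close>, so its increments are bounded by the mean value
  inequality; the lower end point then tends to \<open>x\<close>.\<close>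

lemma vertical_difference_quotient:
  fixes f :: "complex \<Rightarrow> complex"
  assumes hol: "f holomorphic_on UHP"
    and lim: "nt_limit f (nhds \<eta>) x" "nt_limit (deriv f) (nhds d) x"
  shows "((\<lambda>\<epsilon>. (f (Complex x \<epsilon>) - \<eta>) / (Complex x \<epsilon> - cx x)) \<longlongrightarrow> d) (at_right 0)"
proof (rule tendstoI)
  fix e :: real assume e: "e > 0"
  have v: "((\<lambda>\<epsilon>. f (Complex x \<epsilon>)) \<longlongrightarrow> \<eta>) (at_right 0)" "((\<lambda>\<epsilon>. deriv f (Complex x \<epsilon>)) \<longlongrightarrow> d) (at_right 0)"
    using lim by (auto intro: nt_limit_vertical)
  have "\<forall>\<^sub>F \<epsilon> in at_right 0. dist (deriv f (Complex x \<epsilon>)) d < e / 2"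
    by (rule tendstoD[OF v(2)]) (use e in simp)
  then obtain b where b: "b > 0" "\<And>\<epsilon>. 0 < \<epsilon> \<Longrightarrow> \<epsilon> < b \<Longrightarrow> dist (deriv f (Complex x \<epsilon>)) d < e / 2"
    unfolding eventually_at_right_field by auto
  define g where "g = (\<lambda>w. f w - d * w)"
  \<comment> \<open>The open vertical segment, written as an intersection of half planes to obtain
    convexity.\<close>
  define S where "S = {w. Re w \<ge> x} \<inter> {w. Re w \<le> x} \<inter> {w. 0 < Im w} \<inter> {w. Im w < b}"
  have cvx: "convex S" unfolding S_def
    by (intro convex_Int convex_halfspace_Im_gt convex_halfspace_Im_lt convex_halfspace_Re_ge convex_halfspace_Re_le)
  have bound: "norm (g p - g q) \<le> (e / 2) * norm (p - q)" if "p \<in> S" "q \<in> S" for p q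
  proof (rule field_differentiable_bound[OF cvx _ _ that])
    fix w assume w: "w \<in> S"
    then have wU: "w \<in> UHP" by (simp add: S_def upper_half_plane_def)
    have "(f has_field_derivative deriv f w) (at w)"
      using holomorphic_derivI[OF hol _ wU] by (simp add: upper_half_plane_def open_halfspace_Im_gt)
    then have "(g has_field_derivative deriv f w - d * 1) (at w)"
      unfolding g_def by (intro derivative_intros) auto
    then show "(g has_field_derivative deriv f w - d * 1) (at w within S)"
      by (rule has_field_derivative_at_within)
    have "w = Complex x (Im w)" using w by (simp add: S_def complex_eq_iff)
    then show "norm (deriv f w - d * 1) \<le> e / 2"
      using b(2)[of "Im w"] w by (auto simp: S_def dist_norm)
  qed
  have "\<forall>\<^sub>F \<epsilon> in at_right 0. \<epsilon> < b" unfolding eventually_at_right_field using b(1) by blast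
  then show "\<forall>\<^sub>F \<epsilon> in at_right 0. dist ((f (Complex x \<epsilon>) - \<eta>) / (Complex x \<epsilon> - cx x)) d < e"
    using eventually_at_right_less[of "0::real"]
  proof eventually_elim
    case (elim \<epsilon>)
    define z where "z = Complex x \<epsilon>"
    have glim: "((\<lambda>s. norm (g z - g (Complex x s))) \<longlongrightarrow> norm (g z - (\<eta> - d * Complex x 0))) (at_right 0)"
      unfolding g_def by (intro tendsto_intros v(1) tendsto_Complex)
    have rlim: "((\<lambda>s. (e / 2) * norm (z - Complex x s)) \<longlongrightarrow> (e / 2) * norm (z - Complex x 0)) (at_right 0)"
      by (intro tendsto_intros tendsto_Complex)
    have "\<forall>\<^sub>F s in at_right 0. norm (g z - g (Complex x s)) \<le> (e / 2) * norm (z - Complex x s)"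
      unfolding eventually_at_right_field
    proof (intro exI[of _ b] conjI allI impI b(1))
      fix s :: real assume "0 < s" "s < b"
      then show "norm (g z - g (Complex x s)) \<le> (e / 2) * norm (z - Complex x s)"
        by (intro bound) (use elim in \<open>auto simp: S_def z_def\<close>)
    qed
    then have "norm (g z - (\<eta> - d * Complex x 0)) \<le> (e / 2) * norm (z - Complex x 0)"
      by (intro tendsto_le[OF _ rlim glim]) auto
    moreover have zx: "z - cx x \<noteq> 0" using elim by (auto simp: z_def complex_eq_iff)
    moreover have "g z - (\<eta> - d * Complex x 0) = ((f z - \<eta>) / (z - cx x) - d) * (z - cx x)"
    proof -
      have "(A / b - d) * b = A - d * b" if "b \<noteq> 0" for A b :: complex
        using that by (simp add: left_diff_distrib)
      from this[OF zx] show ?thesis by (simp add: g_def Complex_of_real right_diff_distrib)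
    qed
    ultimately have "norm ((f z - \<eta>) / (z - cx x) - d) * norm (z - cx x) \<le> (e / 2) * norm (z - cx x)"
      by (simp add: norm_mult Complex_of_real)
    then have "norm ((f z - \<eta>) / (z - cx x) - d) \<le> e / 2" using zx by simp
    then show ?case using e by (simp add: z_def dist_norm)
  qed
qed

section \<open>The conditions as inequalities, and their behaviour under the substitution\<close>

definition cond46 :: "ext_fun \<Rightarrow> real \<Rightarrow> real \<Rightarrow> real \<Rightarrow> real \<Rightarrow> bool" where
  "cond46 \<phi> x c e p \<longleftrightarrow> (if e \<noteq> 0
     then cond_C4 \<phi> x c e p \<or> cond_C5 \<phi> x c e p \<or> cond_C6 \<phi> x c e p
     else cond_C4' \<phi> x c p \<or> cond_C5' \<phi> x c p \<or> cond_C6' \<phi> x c p)"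

text \<open>The three conditions exhaust the closed interval from 0 to \<open>- p / e^2\<close>: the
  points below its upper end, a positive upper end, and the degenerate interval consisting of
  0.\<close>

lemma cond46_finite_iff:
  assumes "e \<noteq> 0"
  shows "cond46 \<phi> x c e p \<longleftrightarrow> bd_value \<phi> x (cx (c / e)) \<and>
     (\<exists>d. bd_deriv \<phi> x (cx d) \<and> 0 \<le> d \<and> e\<^sup>2 * d \<le> - p)"
proof -
  have e2: "e\<^sup>2 > 0" using assms by simp
  have eq: "(0 \<le> d \<and> d < - p / e\<^sup>2) \<or> (d = - p / e\<^sup>2 \<and> - p / e\<^sup>2 > 0) \<or> (d = p \<and> p = 0) \<longleftrightarrow> 0 \<le> d \<and> e\<^sup>2 * d \<le> - p" for d
  proof -
    have "e\<^sup>2 * d \<le> - p \<longleftrightarrow> d \<le> - p / e\<^sup>2" using e2 by (subst pos_le_divide_eq[OF e2]) (simp add: mult.commute)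
    moreover have "p = 0" if "- p / e\<^sup>2 = 0" using that e2 by simp
    ultimately show ?thesis by (cases "p = 0") (auto simp: le_less)
  qed
  show ?thesis
    unfolding cond46_def cond_C4_def cond_C5_def cond_C6_def eq[symmetric]
    using assms by (simp only: not_False_eq_True if_True) blast
qed

lemma cond46_infinite_iff:
  assumes "c \<noteq> 0"
  shows "cond46 \<phi> x c 0 p \<longleftrightarrow> bd_value_infinite \<phi> x \<and> (\<exists>r. bd_inv_residue \<phi> x r \<and> 0 \<le> - r \<and> c\<^sup>2 * (- r) \<le> - p)"
proof -
  have c2: "c\<^sup>2 > 0" using assms by simp
  have eq: "(0 \<le> - r \<and> - r < - p / c\<^sup>2) \<or> (r = p / c\<^sup>2 \<and> p / c\<^sup>2 < 0) \<or> (r = p \<and> p = 0) \<longleftrightarrow> 0 \<le> - r \<and> c\<^sup>2 * (- r) \<le> - p" for r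
  proof -
    have "c\<^sup>2 * (- r) \<le> - p \<longleftrightarrow> - r \<le> - p / c\<^sup>2" by (subst pos_le_divide_eq[OF c2]) (simp add: mult.commute)
    moreover have "p = 0" if "- p / c\<^sup>2 = 0" using that c2 by simp
    ultimately show ?thesis by (cases "p = 0") (auto simp: le_less)
  qed
  show ?thesis
    unfolding cond46_def cond_C4'_def cond_C5'_def cond_C6'_def eq[symmetric]
    by (simp only: simp_thms if_False) blast
qed

lemma tendsto_at_infinity_inverse:
  fixes f :: "'a \<Rightarrow> complex"
  assumes "((\<lambda>z. inverse (f z)) \<longlongrightarrow> 0) F" "\<forall>\<^sub>F z in F. f z \<noteq> 0"
  shows "filterlim f at_infinity F"
proof -
  have "filterlim (\<lambda>z. inverse (f z)) (at 0) F"
    using assms by (auto simp: filterlim_at elim: eventually_mono)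
  then have "filterlim (\<lambda>z. inverse (inverse (f z))) at_infinity F"
    by (rule filterlim_compose[OF filterlim_inverse_at_infinity])
  then show ?thesis by simp
qed

text \<open>
  The substitution \<open>g = -1 / (f - t)\<close> turns the finite and the infinite boundary values of \<open>f\<close> into
  finite ones, with \<open>e' = c - t e\<close> in place of \<open>e\<close>.
\<close>

lemma cond46_imp_vertical_limit:
  fixes f :: "complex \<Rightarrow> complex" and x c e p t :: real
  assumes hol: "f holomorphic_on UHP"
    and ft: "\<And>z. z \<in> UHP \<Longrightarrow> f z \<noteq> cx t"
    and e': "c - t * e \<noteq> 0" and cond: "cond46 (Fin f) x c e p"
  shows "\<exists>d. ((\<lambda>\<epsilon>. (- 1 / (f (Complex x \<epsilon>) - cx t) - cx (- e / (c - t * e))) /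
           (Complex x \<epsilon> - cx x)) \<longlongrightarrow> cx d) (at_right 0) \<and> (c - t * e)\<^sup>2 * d \<le> - p"
proof (cases "e = 0")
  case False
  define \<eta> where "\<eta> = c / e"
  obtain d where d: "nt_limit f (nhds (cx \<eta>)) x" "nt_limit (deriv f) (nhds (cx d)) x" "e\<^sup>2 * d \<le> - p"
    using cond unfolding cond46_finite_iff[OF False] by (auto simp: \<eta>_def)
  have \<eta>t: "\<eta> - t \<noteq> 0" using e' False by (simp add: \<eta>_def field_simps)
  have v: "((\<lambda>\<epsilon>. f (Complex x \<epsilon>)) \<longlongrightarrow> cx \<eta>) (at_right 0)"
    by (rule nt_limit_vertical[OF d(1)])
  have q: "((\<lambda>\<epsilon>. (f (Complex x \<epsilon>) - cx \<eta>) / (Complex x \<epsilon> - cx x)) \<longlongrightarrow> cx d) (at_right 0)"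
    by (rule vertical_difference_quotient[OF hol d(1,2)])
  have "((\<lambda>\<epsilon>. (f (Complex x \<epsilon>) - cx \<eta>) / (Complex x \<epsilon> - cx x) /
      ((f (Complex x \<epsilon>) - cx t) * cx (\<eta> - t))) \<longlongrightarrow>
      cx d / ((cx \<eta> - cx t) * cx (\<eta> - t))) (at_right 0)"
    using \<eta>t by (intro tendsto_divide q tendsto_mult tendsto_diff v tendsto_const) (simp flip: of_real_diff)
  moreover have "\<forall>\<^sub>F \<epsilon> in at_right 0. (f (Complex x \<epsilon>) - cx \<eta>) / (Complex x \<epsilon> - cx x) /
      ((f (Complex x \<epsilon>) - cx t) * cx (\<eta> - t)) =
      (- 1 / (f (Complex x \<epsilon>) - cx t) - cx (- e / (c - t * e))) / (Complex x \<epsilon> - cx x)"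
    using eventually_at_right_less[of "0::real"]
  proof eventually_elim
    case (elim \<epsilon>)
    have 1: "f (Complex x \<epsilon>) - cx t \<noteq> 0" using ft[of "Complex x \<epsilon>"] elim by simp
    have 2: "- e / (c - t * e) = - 1 / (\<eta> - t)" using False e' \<eta>t by (simp add: \<eta>_def field_simps)
    have 3: "cx \<eta> - cx t \<noteq> 0" using \<eta>t by (simp flip: of_real_diff)
    have "- 1 / (w - cx t) - - 1 / (cx \<eta> - cx t) =
       (w - cx \<eta>) / ((w - cx t) * (cx \<eta> - cx t))"
      if "w - cx t \<noteq> 0" for w
      using that 3 by (simp add: field_simps)
    from this[OF 1] show ?case unfolding 2 by simp
  qed
  ultimately have "((\<lambda>\<epsilon>. (- 1 / (f (Complex x \<epsilon>) - cx t) - cx (- e / (c - t * e))) /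
      (Complex x \<epsilon> - cx x)) \<longlongrightarrow>
      cx d / ((cx \<eta> - cx t) * cx (\<eta> - t))) (at_right 0)"
    by (rule Lim_transform_eventually)
  also have "cx d / ((cx \<eta> - cx t) * cx (\<eta> - t)) =
      cx (d / (\<eta> - t)\<^sup>2)"
    by (simp add: power2_eq_square)
  finally have l: "((\<lambda>\<epsilon>. (- 1 / (f (Complex x \<epsilon>) - cx t) - cx (- e / (c - t * e))) /
      (Complex x \<epsilon> - cx x)) \<longlongrightarrow> cx (d / (\<eta> - t)\<^sup>2)) (at_right 0)" .
  have "c - t * e = e * (\<eta> - t)" using False by (simp add: \<eta>_def field_simps)
  then have "(c - t * e)\<^sup>2 * (d / (\<eta> - t)\<^sup>2) = e\<^sup>2 * d" using \<eta>t by (simp add: power_mult_distrib)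
  then show ?thesis using l d(3) by (intro exI[of _ "d / (\<eta> - t)\<^sup>2"]) simp
next
  case True
  have c: "c \<noteq> 0" using e' True by simp
  obtain r where r: "bd_inv_residue (Fin f) x r" "c\<^sup>2 * (- r) \<le> - p"
    using cond unfolding True cond46_infinite_iff[OF c] by auto
  \<comment> \<open>For \<open>e = 0\<close> the boundary value of the substituted function is 0 and
    its difference quotient is \<open>-1 / (g - t * (z - x))\<close>. The limit is minus the
    reciprocal of the limit of \<open>g\<close>, hence 0 if that is infinite.\<close>
  define g where "g = (\<lambda>z. (z - cx x) * f z)"
  have zx: "((\<lambda>\<epsilon>. cx t * (Complex x \<epsilon> - cx x)) \<longlongrightarrow> 0) (at_right 0)"
  proof -
    have "((\<lambda>\<epsilon>. cx t * (Complex x \<epsilon> - cx x)) \<longlongrightarrow> cx t * (Complex x 0 - cx x)) (at_right 0)"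
      by (intro tendsto_intros tendsto_Complex)
    then show ?thesis by (simp add: Complex_of_real)
  qed
  have "((\<lambda>\<epsilon>. - 1 / (g (Complex x \<epsilon>) - cx t * (Complex x \<epsilon> - cx x))) \<longlongrightarrow> - cx r) (at_right 0)"
    using r(1) unfolding bd_inv_residue.simps g_def[symmetric]
  proof (elim disjE exE conjE)
    fix K assume K: "nt_limit g (nhds K) x" "K \<noteq> 0" "cx r = 1 / K"
    have "((\<lambda>\<epsilon>. g (Complex x \<epsilon>)) \<longlongrightarrow> K) (at_right 0)"
      by (rule nt_limit_vertical[OF K(1)])
    then have "((\<lambda>\<epsilon>. - 1 / (g (Complex x \<epsilon>) - cx t * (Complex x \<epsilon> - cx x))) \<longlongrightarrow> - 1 / (K - 0)) (at_right 0)"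
      using K(2) by (intro tendsto_divide tendsto_const tendsto_diff zx) auto
    then show ?thesis using K(3) by simp
  next
    assume K: "nt_limit g at_infinity x" "r = 0"
    have "filterlim (\<lambda>\<epsilon>. g (Complex x \<epsilon>)) at_infinity (at_right 0)"
      by (rule nt_limit_vertical[OF K(1)])
    from tendsto_add_filterlim_at_infinity'[OF this tendsto_minus[OF zx]]
    have "filterlim (\<lambda>\<epsilon>. g (Complex x \<epsilon>) - cx t * (Complex x \<epsilon> - cx x)) at_infinity (at_right 0)"
      by simp
    then have "((\<lambda>\<epsilon>. - 1 / (g (Complex x \<epsilon>) - cx t * (Complex x \<epsilon> - cx x))) \<longlongrightarrow> 0) (at_right 0)"
      by (rule tendsto_divide_0[OF tendsto_const])
    then show ?thesis using K(2) by simp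
  qed
  moreover have "- 1 / (f (Complex x \<epsilon>) - cx t) / (Complex x \<epsilon> - cx x) =
      - 1 / (g (Complex x \<epsilon>) - cx t * (Complex x \<epsilon> - cx x))" for \<epsilon>
    by (simp add: g_def algebra_simps)
  ultimately show ?thesis using r(2) True by (intro exI[of _ "- r"]) simp
qed

text \<open>The inverse substitution \<open>f = t - 1 / h\<close>. For nonzero \<open>e\<close> the
  difference quotient of \<open>f\<close> converges, and \<open>nt_limit_deriv\<close> passes to the
  derivative that the conditions speak of; for \<open>e = 0\<close> the limit of
  \<open>(z - x) * f\<close> is read off from that of \<open>q\<close>.\<close>

lemma nt_limits_imp_cond46:
  fixes f :: "complex \<Rightarrow> complex" and x c e p t d :: real
  assumes hol: "f holomorphic_on UHP"
    and ft: "\<And>z. z \<in> UHP \<Longrightarrow> f z \<noteq> cx t"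
    and e': "c - t * e \<noteq> 0"
    and lim: "\<And>M. M > 0 \<Longrightarrow> ((\<lambda>z. (- 1 / (f z - cx t) - cx (- e / (c - t * e))) /
           (z - cx x)) \<longlongrightarrow> cx d) (nt_at M x)"
    and d: "0 \<le> d" "(c - t * e)\<^sup>2 * d \<le> - p"
  shows "cond46 (Fin f) x c e p"
proof -
  define h where "h = (\<lambda>z. - 1 / (f z - cx t))"
  define \<theta> where "\<theta> = - e / (c - t * e)"
  define q where "q = (\<lambda>z. (h z - cx \<theta>) / (z - cx x))"
  let ?F = "\<lambda>M. nt_at M x"
  have q: "(q \<longlongrightarrow> cx d) (?F M)" if "M > 0" for M
    using lim[OF that] unfolding q_def h_def \<theta>_def .
  have zx: "((\<lambda>z. z - cx x) \<longlongrightarrow> 0) (?F M)" for M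
  proof -
    have "((\<lambda>z. z - cx x) \<longlongrightarrow> cx x - cx x) (?F M)" by (intro tendsto_intros)
    then show ?thesis by simp
  qed
  have h: "(h \<longlongrightarrow> cx \<theta>) (?F M)" if "M > 0" for M
  proof -
    have "((\<lambda>z. cx \<theta> + q z * (z - cx x)) \<longlongrightarrow> cx \<theta> + cx d * 0) (?F M)"
      by (intro tendsto_intros q that zx)
    moreover have "\<forall>\<^sub>F z in ?F M. cx \<theta> + q z * (z - cx x) = h z"
      using eventually_stolz_angle[of M x] by eventually_elim (simp add: q_def)
    ultimately show ?thesis by (simp add: Lim_transform_eventually)
  qed
  have fh: "f z = cx t - 1 / h z" "h z \<noteq> 0" if "z \<in> UHP" for z
    using ft[OF that] by (simp_all add: h_def)
  show ?thesis
  proof (cases "e = 0")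
    case False
    define \<eta> where "\<eta> = c / e"
    have \<eta>t: "\<eta> - t \<noteq> 0" using e' False by (simp add: \<eta>_def field_simps)
    have \<theta>: "\<theta> = - 1 / (\<eta> - t)" "\<theta> \<noteq> 0" using False e' \<eta>t by (simp_all add: \<theta>_def \<eta>_def field_simps)
    define d' where "d' = d * (\<eta> - t)\<^sup>2"
    have lim': "((\<lambda>z. (f z - cx \<eta>) / (z - cx x)) \<longlongrightarrow> cx d') (?F M)" if M: "M > 0" for M
    proof -
      have "((\<lambda>z. q z / (h z * cx \<theta>)) \<longlongrightarrow> cx d / (cx \<theta> * cx \<theta>)) (?F M)"
        using \<theta>(2) by (intro tendsto_intros q h M) auto
      moreover have "cx d / (cx \<theta> * cx \<theta>) = cx d'"
        using \<eta>t by (simp add: \<theta>(1) d'_def power2_eq_square)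
      moreover have "\<forall>\<^sub>F z in ?F M. q z / (h z * cx \<theta>) = (f z - cx \<eta>) / (z - cx x)"
        using eventually_stolz_angle[of M x]
      proof eventually_elim
        case (elim z)
        have \<eta>: "cx \<eta> = cx t - 1 / cx \<theta>"
          using \<eta>t by (simp add: \<theta>(1))
        have "f z - cx \<eta> = (h z - cx \<theta>) / (h z * cx \<theta>)"
        proof -
          have fz: "f z = cx t - 1 / h z" "h z \<noteq> 0" using fh elim by auto
          show ?thesis unfolding \<eta> fz(1) using fz(2) \<theta>(2) by (simp add: field_simps)
        qed
        then show ?case by (simp add: q_def)
      qed
      ultimately show ?thesis by (simp add: Lim_transform_eventually)
    qed
    have "nt_limit f (nhds (cx \<eta>)) x"
      unfolding nt_limit_def
    proof (intro allI impI)
      fix M :: real assume M: "M > 0"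
      have "((\<lambda>z. cx \<eta> + (f z - cx \<eta>) / (z - cx x) * (z - cx x)) \<longlongrightarrow>
          cx \<eta> + cx d' * 0) (?F M)"
        by (intro tendsto_add tendsto_mult tendsto_const lim'[OF M] zx)
      moreover have "\<forall>\<^sub>F z in ?F M. cx \<eta> + (f z - cx \<eta>) / (z - cx x) * (z - cx x) = f z"
        using eventually_stolz_angle[of M x] by eventually_elim simp
      ultimately show "(f \<longlongrightarrow> cx \<eta>) (?F M)" by (simp add: Lim_transform_eventually)
    qed
    moreover have "nt_limit (deriv f) (nhds (cx d')) x"
      by (rule nt_limit_deriv[OF hol lim'])
    moreover have "e\<^sup>2 * d' = (c - t * e)\<^sup>2 * d"
    proof -
      have "c - t * e = e * (\<eta> - t)" using False by (simp add: \<eta>_def field_simps)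
      then show ?thesis by (simp add: d'_def power_mult_distrib)
    qed
    moreover have "0 \<le> d'" using d(1) by (simp add: d'_def)
    ultimately show ?thesis
      unfolding cond46_finite_iff[OF False] using d(2) by (auto simp: \<eta>_def intro!: exI[of _ d'])
  next
    case True
    have c: "c \<noteq> 0" using e' True by simp
    have \<theta>: "\<theta> = 0" using True by (simp add: \<theta>_def)
    have hz: "\<forall>\<^sub>F z in ?F M. h z \<noteq> 0 \<and> f z = cx t - 1 / h z \<and> z \<noteq> cx x" for M
      using eventually_stolz_angle[of M x] by eventually_elim (use fh in auto)
    have "nt_limit f at_infinity x"
      unfolding nt_limit_def
    proof (intro allI impI)
      fix M :: real assume M: "M > 0"
      have "filterlim (\<lambda>z. - inverse (h z)) at_infinity (?F M)"
      proof (rule tendsto_at_infinity_inverse)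
        have "((\<lambda>z. - h z) \<longlongrightarrow> - cx \<theta>) (?F M)" by (intro tendsto_intros h M)
        then show "((\<lambda>z. inverse (- inverse (h z))) \<longlongrightarrow> 0) (?F M)" by (simp add: \<theta>)
        show "\<forall>\<^sub>F z in ?F M. - inverse (h z) \<noteq> 0" using hz[of M] by eventually_elim simp
      qed
      then have "filterlim (\<lambda>z. cx t + - inverse (h z)) at_infinity (?F M)"
        by (rule tendsto_add_filterlim_at_infinity[OF tendsto_const])
      then show "filterlim f at_infinity (?F M)"
        by (rule filterlim_mono_eventually[OF _ order_refl order_refl])
           (use hz[of M] in \<open>eventually_elim, simp add: inverse_eq_divide\<close>)
    qed
    moreover have "bd_inv_residue (Fin f) x (- d)"
    proof -
      define g where "g = (\<lambda>z. (z - cx x) * f z)"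
      have gq: "\<forall>\<^sub>F z in ?F M. (z - cx x) * cx t + - inverse (q z) = g z \<and> q z \<noteq> 0" for M
        using hz[of M]
      proof eventually_elim
        case (elim z)
        then have "f z = cx t - 1 / h z" by blast
        then show ?case
          using elim by (simp only: g_def q_def \<theta>) (simp add: right_diff_distrib)
      qed
      show ?thesis
      \<comment> \<open>A vanishing \<open>d\<close> means that \<open>(z - x) * f\<close> tends to
        infinity, in accordance with the convention that the reciprocal is then 0.\<close>
      proof (cases "d = 0")
        case True
        have "filterlim g at_infinity (?F M)" if M: "M > 0" for M
        proof -
          have "filterlim (\<lambda>z. - inverse (q z)) at_infinity (?F M)"
          proof (rule tendsto_at_infinity_inverse)
            have "((\<lambda>z. - q z) \<longlongrightarrow> - cx d) (?F M)" by (intro tendsto_intros q M)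
            then show "((\<lambda>z. inverse (- inverse (q z))) \<longlongrightarrow> 0) (?F M)" by (simp add: True)
            show "\<forall>\<^sub>F z in ?F M. - inverse (q z) \<noteq> 0" using gq[of M] by eventually_elim simp
          qed
          then have "filterlim (\<lambda>z. (z - cx x) * cx t + - inverse (q z)) at_infinity (?F M)"
            by (rule tendsto_add_filterlim_at_infinity[OF tendsto_mult[OF zx tendsto_const]])
          then show ?thesis
            by (rule filterlim_mono_eventually[OF _ order_refl order_refl])
               (use gq[of M] in \<open>eventually_elim, simp\<close>)
        qed
        then show ?thesis using True by (simp add: nt_limit_def g_def)
      next
        case False
        have "(g \<longlongrightarrow> - inverse (cx d)) (?F M)" if M: "M > 0" for M
        proof -
          have "((\<lambda>z. (z - cx x) * cx t + - inverse (q z)) \<longlongrightarrow>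
             0 * cx t + - inverse (cx d)) (?F M)"
            using False by (intro tendsto_intros zx q M) auto
          moreover have "\<forall>\<^sub>F z in ?F M. (z - cx x) * cx t + - inverse (q z) = g z"
            using gq[of M] by eventually_elim simp
          ultimately show ?thesis by (simp add: Lim_transform_eventually)
        qed
        then have "nt_limit g (nhds (- inverse (cx d))) x" by (simp add: nt_limit_def)
        then show ?thesis
          using False unfolding bd_inv_residue.simps g_def
          by (intro disjI1 exI[of _ "- inverse (cx d)"]) (simp add: inverse_eq_divide)
      qed
    qed
    ultimately show ?thesis
      unfolding True cond46_infinite_iff[OF c] using d True by (auto intro!: exI[of _ "- d"])
  qed
qed

lemma cond46_Infty_iff:
  assumes "e \<noteq> 0 \<or> c \<noteq> 0"
  shows "cond46 Infty x c e p \<longleftrightarrow> e = 0 \<and> p \<le> 0"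
proof (cases "e = 0")
  case True
  then have "c \<noteq> 0" using assms by simp
  then show ?thesis unfolding True cond46_infinite_iff[OF \<open>c \<noteq> 0\<close>] by auto
qed (simp add: cond46_finite_iff)


section \<open>The Pick matrix and the transfer matrix\<close>

text \<open>A right inverse of a square matrix exhibits it as a unit, so \<open>mat_inverse\<close>
  does return a matrix, and uniqueness identifies it.\<close>

lemma mat_inv_eqI:
  fixes A B :: "'a::field Matrix.mat"
  assumes A: "A \<in> carrier_mat n n" and B: "B \<in> carrier_mat n n" and AB: "A * B = 1\<^sub>m n"
  shows "mat_inv A = B"
proof -
  have BA: "B * A = 1\<^sub>m n" by (rule mat_mult_left_right_inverse[OF A B AB])
  have "A \<in> Units (ring_mat TYPE('a) n ())"
    using A B AB BA by (auto simp: Units_def ring_mat_simps)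
  then obtain B' where B': "mat_inverse A = Some B'"
    using mat_inverse(1)[OF A, of "()"] by (cases "mat_inverse A") auto
  then have "A * B' = 1\<^sub>m n" "B' \<in> carrier_mat n n" using mat_inverse(2)[OF A] by blast+
  have "B' = (B * A) * B'" unfolding BA using \<open>B' \<in> _\<close> by simp
  also have "\<dots> = B * (A * B')" by (rule assoc_mult_mat[OF B A \<open>B' \<in> _\<close>])
  also have "\<dots> = B" unfolding \<open>A * B' = _\<close> using B by simp
  finally show ?thesis using B' by simp
qed

section \<open>The Pick matrix, its inverse and the Lyapunov identities\<close>

locale pick_data =
  fixes n l :: nat and x w \<gamma> \<xi> :: "nat \<Rightarrow> real"
  assumes data: "interpolation_data n l x \<xi>"
    and invertible: "invertible_mat (pick_matrix n l x w \<gamma> \<xi>)"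
begin

abbreviation "PM \<equiv> pick_matrix n l x w \<gamma> \<xi>"
definition "QM = mat_inv PM"
definition p :: "nat \<Rightarrow> nat \<Rightarrow> real" where "p i j = PM $$ (i, j)"
definition q :: "nat \<Rightarrow> nat \<Rightarrow> real" where "q i j = QM $$ (i, j)"
definition cr :: "nat \<Rightarrow> real" where "cr j = (if j < l then w j else \<xi> j)"
definition er :: "nat \<Rightarrow> real" where "er j = (if j < l then 1 else 0)"
definition ct :: "nat \<Rightarrow> real" where "ct i = (C_row n l w \<xi> * QM) $$ (0, i)"
definition et :: "nat \<Rightarrow> real" where "et i = (E_row n l * QM) $$ (0, i)"

lemma PM_carrier: "PM \<in> carrier_mat n n" by (simp add: pick_matrix_def)

lemma PM_QM: "PM * QM = 1\<^sub>m n" and QM_PM: "QM * PM = 1\<^sub>m n" and QM_carrier: "QM \<in> carrier_mat n n"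
proof -
  obtain B where B: "PM * B = 1\<^sub>m n" "B * PM = 1\<^sub>m (dim_row B)"
    using invertible PM_carrier unfolding invertible_mat_def inverts_mat_def by auto
  have "dim_col B = n" using arg_cong[OF B(1), of dim_col] by simp
  moreover have "dim_row B = n" using arg_cong[OF B(2), of dim_col] PM_carrier by simp
  ultimately have BC: "B \<in> carrier_mat n n" by auto
  then have "QM = B" unfolding QM_def by (intro mat_inv_eqI[OF PM_carrier _ B(1)])
  then show "PM * QM = 1\<^sub>m n" "QM * PM = 1\<^sub>m n" "QM \<in> carrier_mat n n" using B BC by auto
qed

lemma pq: "i < n \<Longrightarrow> k < n \<Longrightarrow> (\<Sum>j<n. p i j * q j k) = (if i = k then 1 else 0)"
  using arg_cong[OF PM_QM, of "\<lambda>A. A $$ (i, k)"] PM_carrier QM_carrier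
  by (simp add: scalar_prod_def p_def q_def atLeast0LessThan)

lemma qp: "i < n \<Longrightarrow> k < n \<Longrightarrow> (\<Sum>j<n. q i j * p j k) = (if i = k then 1 else 0)"
  using arg_cong[OF QM_PM, of "\<lambda>A. A $$ (i, k)"] PM_carrier QM_carrier
  by (simp add: scalar_prod_def p_def q_def atLeast0LessThan)

lemma p_sym: "i < n \<Longrightarrow> j < n \<Longrightarrow> p i j = p j i"
  by (auto simp: p_def pick_matrix_def diff_divide_swap[of "w i"])

lemma q_sym: "i < n \<Longrightarrow> j < n \<Longrightarrow> q i j = q j i"
proof -
  have "transpose_mat PM = PM"
    by (intro eq_matI) (use p_sym PM_carrier in \<open>auto simp: p_def\<close>)
  then have "transpose_mat QM * PM = 1\<^sub>m n"
    using arg_cong[OF PM_QM, of transpose_mat] transpose_mult[OF PM_carrier QM_carrier] by simp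
  then have "transpose_mat QM * PM * QM = QM" using QM_carrier by simp
  moreover have "transpose_mat QM * PM * QM = transpose_mat QM * (PM * QM)"
    by (rule assoc_mult_mat) (use PM_carrier QM_carrier in auto)
  ultimately have "transpose_mat QM = QM" using PM_QM QM_carrier by simp
  then show "i < n \<Longrightarrow> j < n \<Longrightarrow> q i j = q j i"
    using QM_carrier unfolding q_def by (metis carrier_matD index_transpose_mat(1))
qed

lemma ct_eq: "i < n \<Longrightarrow> ct i = (\<Sum>j<n. cr j * q j i)"
  using QM_carrier by (simp add: ct_def C_row_def cr_def q_def scalar_prod_def atLeast0LessThan)

lemma et_eq: "i < n \<Longrightarrow> et i = (\<Sum>j<n. er j * q j i)"
  using QM_carrier by (simp add: et_def E_row_def er_def q_def scalar_prod_def atLeast0LessThan)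

lemma inj_x: "inj_on x {..<n}"
  using data by (simp add: interpolation_data_def)

text \<open>In matrix form \<open>P X - X P = E* C - C* E\<close>; the entries of the Pick matrix
  are made for it.\<close>

lemma lyapunov_p:
  assumes "i < n" "j < n"
  shows "p i j * (x j - x i) = er i * cr j - cr i * er j"
proof -
  have "x j \<noteq> x i" if "i \<noteq> j" using inj_x assms that by (auto simp: inj_on_def)
  then show ?thesis
    using assms by (auto simp: p_def pick_matrix_def er_def cr_def field_simps)
qed

lemma p_apply:
  assumes "i < n"
  shows "(\<Sum>j<n. p i j * ct j) = cr i" "(\<Sum>j<n. p i j * et j) = er i"
proof -
  have *: "(\<Sum>j<n. p i j * (\<Sum>k<n. g k * q k j)) = g i" for g
  proof -
    have "(\<Sum>j<n. p i j * (\<Sum>k<n. g k * q k j)) = (\<Sum>k<n. g k * (\<Sum>j<n. p i j * q k j))"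
      unfolding sum_distrib_left by (subst sum.swap) (simp add: mult_ac)
    also have "\<dots> = (\<Sum>k<n. g k * (\<Sum>j<n. p i j * q j k))"
      by (intro sum.cong refl arg_cong2[of _ _ _ _ "(*)"]) (simp add: q_sym)
    also have "\<dots> = (\<Sum>k<n. g k * (if i = k then 1 else 0))"
      by (intro sum.cong refl) (simp add: pq assms)
    also have "\<dots> = g i" by (rule sum_delta_lessThan(2)[OF assms])
    finally show ?thesis .
  qed
  show "(\<Sum>j<n. p i j * ct j) = cr i" "(\<Sum>j<n. p i j * et j) = er i"
    using *[of cr] *[of er] by (simp_all add: ct_eq et_eq)
qed

text \<open>Multiplication of the identity for \<open>P\<close> by \<open>Q\<close> on both sides
  turns \<open>P X - X P\<close> into \<open>X Q - Q X\<close>, and the rows \<open>C\<close>,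
  \<open>E\<close> into \<open>C Q\<close>, \<open>E Q\<close>.\<close>

lemma lyapunov_q:
  assumes i: "i < n" and j: "j < n"
  shows "q i j * (x i - x j) = et i * ct j - ct i * et j"
proof -
  have "(\<Sum>k<n. \<Sum>m<n. q i k * (p k m * (x m - x k)) * q m j) =
     (\<Sum>k<n. \<Sum>m<n. q i k * p k m * (x m * q m j)) - (\<Sum>k<n. \<Sum>m<n. q i k * x k * (p k m * q m j))"
    unfolding sum_subtractf[symmetric] by (intro sum.cong refl) (simp add: algebra_simps)
  also have "(\<Sum>k<n. \<Sum>m<n. q i k * p k m * (x m * q m j)) = (\<Sum>m<n. (\<Sum>k<n. q i k * p k m) * (x m * q m j))"
    by (subst sum.swap) (simp add: sum_distrib_right)
  also have "\<dots> = (\<Sum>m<n. (if i = m then 1 else 0) * (x m * q m j))"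
    by (intro sum.cong refl) (simp add: qp i)
  also have "\<dots> = x i * q i j" by (rule sum_delta_lessThan(1)[OF i])
  also have "(\<Sum>k<n. \<Sum>m<n. q i k * x k * (p k m * q m j)) = (\<Sum>k<n. q i k * x k * (\<Sum>m<n. p k m * q m j))"
    by (simp add: sum_distrib_left)
  also have "\<dots> = (\<Sum>k<n. q i k * x k * (if k = j then 1 else 0))"
    by (intro sum.cong refl) (simp add: pq j)
  also have "\<dots> = q i j * x j" by (rule sum_delta_lessThan(3)[OF j])
  finally have "q i j * (x i - x j) = (\<Sum>k<n. \<Sum>m<n. q i k * (p k m * (x m - x k)) * q m j)"
    by (simp add: algebra_simps)
  also have "\<dots> = (\<Sum>k<n. \<Sum>m<n. q i k * (er k * cr m - cr k * er m) * q m j)"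
    by (intro sum.cong refl) (simp add: lyapunov_p)
  also have "\<dots> = (\<Sum>k<n. \<Sum>m<n. (er k * q k i) * (cr m * q m j)) - (\<Sum>k<n. \<Sum>m<n. (cr k * q k i) * (er m * q m j))"
    unfolding sum_subtractf[symmetric] by (intro sum.cong refl) (simp add: q_sym i algebra_simps)
  also have "\<dots> = et i * ct j - ct i * et j"
    by (simp add: sum_product[symmetric] et_eq ct_eq i j)
  finally show ?thesis .
qed

text \<open>If both vanished, \<open>lyapunov_q\<close> would kill the \<open>i\<close>-th column of
  \<open>Q\<close> off the diagonal. Then \<open>ct i = cr i * q i i\<close> and
  \<open>et i = er i * q i i\<close> with \<open>q i i\<close> nonzero, so
  \<open>cr i = er i = 0\<close>; but \<open>er i = 1\<close> for \<open>i < l\<close>, and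
  otherwise \<open>cr i = \<xi> i\<close> is nonzero.\<close>

lemma ct_et_nonzero:
  assumes i: "i < n"
  shows "ct i \<noteq> 0 \<or> et i \<noteq> 0"
proof (rule ccontr)
  assume "\<not> ?thesis"
  then have 0: "ct i = 0" "et i = 0" by auto
  have off: "q j i = 0" if "j < n" "j \<noteq> i" for j
    using lyapunov_q[OF that(1) i] inj_x that i 0 by (auto simp: inj_on_def)
  have single: "(\<Sum>j<n. g j * q j i) = g i * q i i" for g
    by (subst sum.remove[of _ i]) (use i off in auto)
  have "q i i \<noteq> 0" using pq[OF i i] single[of "p i"] by auto
  then have "cr i = 0" "er i = 0"
    using 0 by (simp_all add: ct_eq et_eq i single)
  then show False
    using data i by (auto simp: cr_def er_def interpolation_data_def split: if_splits)
qed

text \<open>The first factors \<open>f + C v\<close> and \<open>g + E v\<close> are the entries of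
  \<open>\<Theta>(z)\<close> applied to the column of \<open>f\<close> and \<open>g\<close>, so this
  is the J-property of \<Theta> in bilinear form. Leaving \<open>z'\<close> and the second column
  free covers both conjugate points, for the kernel, and \<open>z' = z\<close>, for the
  determinant.\<close>

lemma bilinear_identity:
  fixes f g f' g' z z' :: complex
  assumes z: "\<And>i. i < n \<Longrightarrow> z \<noteq> cx (x i)" "\<And>i. i < n \<Longrightarrow> z' \<noteq> cx (x i)"
  defines "v \<equiv> \<lambda>i. (cx (et i) * f - cx (ct i) * g) / (z - cx (x i))"
    and "v' \<equiv> \<lambda>i. (cx (et i) * f' - cx (ct i) * g') / (z' - cx (x i))"
  shows "(f + (\<Sum>i<n. cx (cr i) * v i)) * (g' + (\<Sum>i<n. cx (er i) * v' i)) -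
         (g + (\<Sum>i<n. cx (er i) * v i)) * (f' + (\<Sum>i<n. cx (cr i) * v' i)) =
         f * g' - g * f' + (z - z') * (\<Sum>i<n. \<Sum>j<n. v' i * cx (p i j) * v j)"
proof -
  let ?r = complex_of_real
  define cv where "cv = (\<Sum>i<n. ?r (cr i) * v i)"
  define ev where "ev = (\<Sum>i<n. ?r (er i) * v i)"
  define cv' where "cv' = (\<Sum>i<n. ?r (cr i) * v' i)"
  define ev' where "ev' = (\<Sum>i<n. ?r (er i) * v' i)"
  have vz: "?r (et j) * f - ?r (ct j) * g = (z - ?r (x j)) * v j" if "j < n" for j
    using z(1)[OF that] by (simp add: v_def)
  have vz': "?r (et j) * f' - ?r (ct j) * g' = (z' - ?r (x j)) * v' j" if "j < n" for j
    using z(2)[OF that] by (simp add: v'_def)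
  \<comment> \<open>Since \<open>P\<close> maps \<open>ct\<close>, \<open>et\<close> to
    \<open>cr\<close>, \<open>er\<close>, the mixed terms become forms in \<open>P\<close> with the
    factors \<open>z - x j\<close> and \<open>- (z' - x i)\<close>. The Lyapunov identity gives the
    last term the factor \<open>x j - x i\<close>, and the three add up to
    \<open>z - z'\<close>.\<close>
  have row: "?r (er i) * h - ?r (cr i) * k = (\<Sum>j<n. ?r (p i j) * (?r (et j) * h - ?r (ct j) * k))" if "i < n" for i h k
  proof -
    have "(\<Sum>j<n. ?r (p i j) * (?r (et j) * h - ?r (ct j) * k)) =
        ?r (\<Sum>j<n. p i j * et j) * h - ?r (\<Sum>j<n. p i j * ct j) * k"
      unfolding of_real_sum sum_distrib_right sum_subtractf[symmetric]
      by (intro sum.cong refl) (simp add: algebra_simps)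
    then show ?thesis by (simp add: p_apply that)
  qed
  have 1: "f * ev' - g * cv' = (\<Sum>i<n. \<Sum>j<n. v' i * ?r (p i j) * ((z - ?r (x j)) * v j))"
  proof -
    have "f * ev' - g * cv' = (\<Sum>i<n. v' i * (?r (er i) * f - ?r (cr i) * g))"
      unfolding ev'_def cv'_def sum_distrib_left sum_subtractf[symmetric]
      by (intro sum.cong refl) (simp add: algebra_simps)
    also have "\<dots> = (\<Sum>i<n. v' i * (\<Sum>j<n. ?r (p i j) * ((z - ?r (x j)) * v j)))"
      by (intro sum.cong refl) (simp add: row vz)
    finally show ?thesis by (simp add: sum_distrib_left mult_ac)
  qed
  have 2: "cv * g' - ev * f' = - (\<Sum>i<n. \<Sum>j<n. v' i * ?r (p i j) * ((z' - ?r (x i)) * v j))"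
  proof -
    have "ev * f' - cv * g' = (\<Sum>i<n. v i * (?r (er i) * f' - ?r (cr i) * g'))"
      unfolding ev_def cv_def sum_distrib_right sum_subtractf[symmetric]
      by (intro sum.cong refl) (simp add: algebra_simps)
    also have "\<dots> = (\<Sum>i<n. v i * (\<Sum>j<n. ?r (p i j) * ((z' - ?r (x j)) * v' j)))"
      by (intro sum.cong refl) (simp add: row vz')
    also have "\<dots> = (\<Sum>i<n. \<Sum>j<n. v' j * ?r (p j i) * ((z' - ?r (x j)) * v i))"
      unfolding sum_distrib_left by (intro sum.cong refl) (simp add: p_sym mult_ac)
    also have "\<dots> = (\<Sum>i<n. \<Sum>j<n. v' i * ?r (p i j) * ((z' - ?r (x i)) * v j))"
      by (rule sum.swap)
    finally show ?thesis by (simp add: algebra_simps)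
  qed
  have 3: "cv * ev' - ev * cv' = (\<Sum>i<n. \<Sum>j<n. v' i * ?r (p i j) * ((?r (x j) - ?r (x i)) * v j))"
  proof -
    have "cv * ev' - ev * cv' = ev' * cv - cv' * ev" by (simp add: mult.commute)
    also have "\<dots> = (\<Sum>i<n. \<Sum>j<n. v' i * ?r (er i * cr j - cr i * er j) * v j)"
      unfolding ev'_def cv_def cv'_def ev_def sum_product sum_subtractf[symmetric]
      by (intro sum.cong refl) (simp add: algebra_simps)
    also have "\<dots> = (\<Sum>i<n. \<Sum>j<n. v' i * ?r (p i j) * ((?r (x j) - ?r (x i)) * v j))"
      by (intro sum.cong refl) (simp add: lyapunov_p[symmetric])
    finally show ?thesis .
  qed
  have "(f + cv) * (g' + ev') - (g + ev) * (f' + cv') =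
      f * g' - g * f' + ((f * ev' - g * cv') + (cv * g' - ev * f') + (cv * ev' - ev * cv'))"
    by (simp add: algebra_simps)
  also have "(f * ev' - g * cv') + (cv * g' - ev * f') + (cv * ev' - ev * cv') =
     (z - z') * (\<Sum>i<n. \<Sum>j<n. v' i * ?r (p i j) * v j)"
    unfolding 1 2 3 sum_negf[symmetric] sum.distrib[symmetric] sum_distrib_left
    by (intro sum.cong refl) (simp add: algebra_simps)
  finally show ?thesis by (simp only: cv_def ev_def cv'_def ev'_def)
qed

end

section \<open>Entries of \<Theta> and homogeneous coordinates of the transform\<close>

lemma mult_mat_entry:
  assumes "A \<in> carrier_mat r m" "B \<in> carrier_mat m k" "i < r" "j < k"
  shows "(A * B) $$ (i, j) = (\<Sum>l<m. A $$ (i, l) * B $$ (l, j))"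
  using assms by (auto simp: scalar_prod_def atLeast0LessThan intro!: sum.cong)

context pick_data
begin

lemma Theta_entries:
  assumes z: "\<And>i. i < n \<Longrightarrow> z \<noteq> cx (x i)"
  shows "Theta n l x w \<gamma> \<xi> z $$ (0, 0) = 1 + (\<Sum>i<n. cx (cr i * et i) / (z - cx (x i)))"
    and "Theta n l x w \<gamma> \<xi> z $$ (0, 1) = - (\<Sum>i<n. cx (cr i * ct i) / (z - cx (x i)))"
    and "Theta n l x w \<gamma> \<xi> z $$ (1, 0) = (\<Sum>i<n. cx (er i * et i) / (z - cx (x i)))"
    and "Theta n l x w \<gamma> \<xi> z $$ (1, 1) = 1 - (\<Sum>i<n. cx (er i * ct i) / (z - cx (x i)))"
proof -
  let ?r = complex_of_real
  \<comment> \<open>The rows \<open>C\<close>, \<open>E\<close> are indexed as \<open>m 0\<close>,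
    \<open>m 1\<close>, and the rows \<open>C Q\<close>, \<open>E Q\<close> as \<open>mt 0\<close>,
    \<open>mt 1\<close>; multiplication by \<open>J_mat\<close> exchanges the two columns up to
    factors \<open>\<i>\<close> and \<open>- \<i>\<close>.\<close>
  define m where "m = (\<lambda>a::nat. if a = 0 then cr else er)"
  define mt where "mt = (\<lambda>a::nat. if a = 0 then ct else et)"
  define CE where "CE = of_real_mat (C_row n l w \<xi> @\<^sub>r E_row n l)"
  have CE: "CE = Matrix.mat 2 n (\<lambda>(a, j). ?r (m a j))"
    by (intro eq_matI) (auto simp: CE_def append_rows_def C_row_def E_row_def m_def cr_def er_def less_Suc_eq numeral_2_eq_2)
  have adj: "mat_adjoint CE = Matrix.mat n 2 (\<lambda>(j, a). ?r (m a j))"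
    unfolding CE by (intro eq_matI) (auto simp: mat_adjoint_def mat_of_rows_def)
  define D where "D = Matrix.mat n n (\<lambda>(i, j). if i = j then 1 / (z - ?r (x i)) else 0)"
  have D: "mat_inv (z \<cdot>\<^sub>m 1\<^sub>m n - of_real_mat (node_matrix n x)) = D"
  proof (rule mat_inv_eqI)
    show "(z \<cdot>\<^sub>m 1\<^sub>m n - of_real_mat (node_matrix n x)) * D = 1\<^sub>m n"
    proof (intro eq_matI)
      fix i j assume "i < dim_row (1\<^sub>m n :: complex Matrix.mat)" "j < dim_col (1\<^sub>m n :: complex Matrix.mat)"
      then have ij: "i < n" "j < n" by auto
      have "((z \<cdot>\<^sub>m 1\<^sub>m n - of_real_mat (node_matrix n x)) * D) $$ (i, j) =
         (\<Sum>k<n. (if i = k then 1 else 0) * ((z - ?r (x i)) * (if k = j then 1 / (z - ?r (x k)) else 0)))"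
        using ij by (auto simp: scalar_prod_def D_def node_matrix_def mat_diag_def atLeast0LessThan intro!: sum.cong)
      also have "\<dots> = (z - ?r (x i)) * (if i = j then 1 / (z - ?r (x i)) else 0)"
        by (rule sum_delta_lessThan(1)[OF ij(1)])
      also have "\<dots> = 1\<^sub>m n $$ (i, j)" using ij z[of i] by auto
      finally show "((z \<cdot>\<^sub>m 1\<^sub>m n - of_real_mat (node_matrix n x)) * D) $$ (i, j) = 1\<^sub>m n $$ (i, j)" .
    qed (auto simp: D_def node_matrix_def mat_diag_def)
  qed (auto simp: D_def node_matrix_def mat_diag_def)
  have Q: "mat_inv (of_real_mat PM) = of_real_mat QM"
  proof (rule mat_inv_eqI)
    show "of_real_mat PM * of_real_mat QM = 1\<^sub>m n"
    proof (intro eq_matI)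
      fix i j assume "i < dim_row (1\<^sub>m n :: complex Matrix.mat)" "j < dim_col (1\<^sub>m n :: complex Matrix.mat)"
      then have ij: "i < n" "j < n" by auto
      have "(of_real_mat PM * of_real_mat QM) $$ (i, j) = ?r (\<Sum>k<n. p i k * q k j)"
        using ij PM_carrier QM_carrier by (simp add: scalar_prod_def p_def q_def atLeast0LessThan)
      then show "(of_real_mat PM * of_real_mat QM) $$ (i, j) = 1\<^sub>m n $$ (i, j)"
        using ij by (simp only: pq) simp
    qed (use PM_carrier QM_carrier in auto)
  qed (use PM_carrier QM_carrier in auto)
  have Jm: "J_mat \<in> carrier_mat 2 2" by (simp add: J_mat_def mat_of_rows_list_def numeral_2_eq_2)
  have Jij: "J_mat $$ (0, 0) = 0" "J_mat $$ (0, 1) = - \<i>" "J_mat $$ (1, 0) = \<i>" "J_mat $$ (1, 1) = 0"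
    by (simp_all add: J_mat_def mat_of_rows_list_def)
  have CEc: "CE \<in> carrier_mat 2 n" and adjc: "mat_adjoint CE \<in> carrier_mat n 2"
    and Dc: "D \<in> carrier_mat n n" and Qc: "of_real_mat QM \<in> carrier_mat n n"
    unfolding adj by (simp_all add: CE D_def QM_carrier)
  have mt: "(\<Sum>j<n. q i j * m a j) = mt a i" if "i < n" for i a
  proof -
    have "(\<Sum>j<n. q i j * m a j) = (\<Sum>j<n. m a j * q j i)"
      by (intro sum.cong refl) (simp add: q_sym that)
    then show ?thesis by (simp add: mt_def m_def ct_eq et_eq that)
  qed
  have core: "(CE * D * of_real_mat QM * mat_adjoint CE) $$ (a, b) = (\<Sum>i<n. ?r (m a i * mt b i) / (z - ?r (x i)))"
    if ab: "a < 2" "b < 2" for a b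
  proof -
    have CD: "(CE * D) $$ (a, i) = ?r (m a i) / (z - ?r (x i))" if "i < n" for i
    proof -
      have "(CE * D) $$ (a, i) = (\<Sum>k<n. (?r (m a k) / (z - ?r (x k))) * (if k = i then 1 else 0))"
        using ab that by (auto simp: CE D_def scalar_prod_def atLeast0LessThan intro!: sum.cong)
      then show ?thesis by (simp only: sum_delta_lessThan(3)[OF that])
    qed
    have dims: "CE * D \<in> carrier_mat 2 n" by (rule mult_carrier_mat[OF CEc Dc])
    have "(CE * D * of_real_mat QM * mat_adjoint CE) $$ (a, b) =
       (\<Sum>j<n. (\<Sum>i<n. (CE * D) $$ (a, i) * ?r (q i j)) * ?r (m b j))"
      unfolding mult_mat_entry[OF mult_carrier_mat[OF dims Qc] adjc ab]
      by (intro sum.cong refl) (use ab QM_carrier in \<open>simp add: mult_mat_entry[OF dims Qc ab(1)] adj q_def\<close>)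
    also have "\<dots> = (\<Sum>i<n. (CE * D) $$ (a, i) * ?r (\<Sum>j<n. q i j * m b j))"
      unfolding sum_distrib_right of_real_sum sum_distrib_left by (subst sum.swap) (simp add: mult_ac)
    also have "\<dots> = (\<Sum>i<n. ?r (m a i * mt b i) / (z - ?r (x i)))"
      by (intro sum.cong refl) (simp add: mt CD)
    finally show ?thesis .
  qed
  define S where "S = (\<lambda>a b. \<Sum>i<n. ?r (m a i * mt b i) / (z - ?r (x i)))"
  have dimC: "CE * D * of_real_mat QM * mat_adjoint CE \<in> carrier_mat 2 2"
    by (intro mult_carrier_mat[of _ _ n] CEc Dc Qc adjc)
  have Th: "Theta n l x w \<gamma> \<xi> z = 1\<^sub>m 2 - \<i> \<cdot>\<^sub>m (CE * D * of_real_mat QM * mat_adjoint CE * J_mat)"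
    by (simp add: Theta_def Let_def D Q CE_def[symmetric])
  have prod: "(CE * D * of_real_mat QM * mat_adjoint CE * J_mat) $$ (a, b) = S a 0 * J_mat $$ (0, b) + S a 1 * J_mat $$ (1, b)"
    if ab: "a < 2" "b < 2" for a b
  proof -
    have "(CE * D * of_real_mat QM * mat_adjoint CE * J_mat) $$ (a, b) =
      (\<Sum>k<2. (CE * D * of_real_mat QM * mat_adjoint CE) $$ (a, k) * J_mat $$ (k, b))"
      by (rule mult_mat_entry[OF dimC Jm ab])
    then show ?thesis using core[of a 0] core[of a 1] ab by (simp add: S_def numeral_2_eq_2)
  qed
  have ent: "Theta n l x w \<gamma> \<xi> z $$ (a, b) = (if a = b then 1 else 0) - \<i> * (S a 0 * J_mat $$ (0, b) + S a 1 * J_mat $$ (1, b))"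
    if ab: "a < 2" "b < 2" for a b
    unfolding Th prod[OF ab, symmetric]
    using ab by (simp add: carrier_matD[OF CEc] carrier_matD[OF Jm] carrier_matD[OF adjc])
  have ii: "\<i> * (s * \<i>) = - s" for s by (simp add: mult.left_commute[of \<i> s])
  show "Theta n l x w \<gamma> \<xi> z $$ (0, 0) = 1 + (\<Sum>i<n. ?r (cr i * et i) / (z - ?r (x i)))"
    "Theta n l x w \<gamma> \<xi> z $$ (0, 1) = - (\<Sum>i<n. ?r (cr i * ct i) / (z - ?r (x i)))"
    "Theta n l x w \<gamma> \<xi> z $$ (1, 0) = (\<Sum>i<n. ?r (er i * et i) / (z - ?r (x i)))"
    "Theta n l x w \<gamma> \<xi> z $$ (1, 1) = 1 - (\<Sum>i<n. ?r (er i * ct i) / (z - ?r (x i)))"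
    by (simp_all add: ent Jij Jij[unfolded One_nat_def] S_def m_def mt_def ii)
qed

text \<open>Homogeneous coordinates. Here \<open>f\<close> stands for the substituted function
  \<open>h = -1 / (\<phi> - t)\<close>, so that \<phi> is the quotient of \<open>1 - t * h\<close>
  by \<open>- h\<close>, with \<open>h = 0\<close> representing infinity. Applying \<Theta> to this
  column gives \<open>numer\<close> and \<open>denom\<close>, whose quotient is the transform of
  \<phi>.\<close>

definition numer :: "real \<Rightarrow> (complex \<Rightarrow> complex) \<Rightarrow> complex \<Rightarrow> complex" where
  "numer t f z = 1 - cx t * f z + (\<Sum>i<n. cx (cr i) *
     ((cx (ct i - t * et i) * f z - cx (- et i)) / (z - cx (x i))))"

definition denom :: "real \<Rightarrow> (complex \<Rightarrow> complex) \<Rightarrow> complex \<Rightarrow> complex" where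
  "denom t f z = - f z + (\<Sum>i<n. cx (er i) *
     ((cx (ct i - t * et i) * f z - cx (- et i)) / (z - cx (x i))))"

lemma upper_half_plane_not_node: "z \<in> UHP \<Longrightarrow> z \<noteq> cx (x i)"
  by (auto simp: upper_half_plane_def)

lemma numer_denom_pair:
  fixes t :: real and f :: "complex \<Rightarrow> complex"
  assumes "z \<in> UHP"
  defines "v \<equiv> \<lambda>i. (cx (et i) * (1 - cx t * f z) - cx (ct i) * (- f z)) / (z - cx (x i))"
  shows "numer t f z = (1 - cx t * f z) + (\<Sum>i<n. cx (cr i) * v i)"
    and "denom t f z = (- f z) + (\<Sum>i<n. cx (er i) * v i)"
proof -
  have "(cx (ct i - t * et i) * f z - cx (- et i)) / (z - cx (x i)) = v i" for i
    by (simp add: v_def algebra_simps)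
  then show "numer t f z = (1 - cx t * f z) + (\<Sum>i<n. cx (cr i) * v i)"
    "denom t f z = (- f z) + (\<Sum>i<n. cx (er i) * v i)"
    by (simp_all only: numer_def denom_def)
qed

text \<open>The transfer matrix \<open>\<Theta>(z)\<close> has determinant 1: take \<open>z' = z\<close> in the bilinear identity.\<close>

lemma numer_denom_not_both_zero:
  assumes z: "z \<in> UHP" and "denom t f z = 0"
  shows "numer t f z \<noteq> 0"
proof
  assume num: "numer t f z = 0"
  have no: "z \<noteq> cx (x i)" for i using upper_half_plane_not_node[OF z] .
  have *: "(1 - cx t * f z) * g' - (- f z) * f' = 0" for f' g'
    using bilinear_identity[of z z "1 - cx t * f z" "- f z" g' f', OF no no]
    unfolding numer_denom_pair(1)[OF z, of t f, symmetric] numer_denom_pair(2)[OF z, of t f, symmetric] num assms(2)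
    by simp
  from *[of 0 1] have "f z = 0" by simp
  with *[of 1 0] show False by simp
qed

text \<open>The bilinear identity at \<open>z\<close> and \<open>cnj w'\<close>, with the conjugate
  column in second place; the data are real, so conjugation passes to the arguments. The left side
  is the numerator of the kernel of \<open>numer / denom\<close> after clearing
  denominators.\<close>

lemma numer_denom_kernel:
  assumes z: "z \<in> UHP" and w: "w' \<in> UHP"
  shows "numer t f z * cnj (denom t f w') - denom t f z * cnj (numer t f w') =
    (z - cnj w') * (nev_kernel f z w' + (\<Sum>i<n. \<Sum>j<n.
      cnj ((cx (ct i - t * et i) * f w' - cx (- et i)) / (w' - cx (x i))) *
      cx (p i j) *
      ((cx (ct j - t * et j) * f z - cx (- et j)) / (z - cx (x j)))))"
proof -
  have no: "z \<noteq> cx (x i)" for i using upper_half_plane_not_node[OF z] .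
  have no': "cnj w' \<noteq> cx (x i)" for i
    using w by (auto simp: upper_half_plane_def complex_eq_iff)
  define f1 where "f1 = 1 - cx t * f z"
  define f2 where "f2 = 1 - cx t * cnj (f w')"
  have v: "(cx (et i) * f1 - cx (ct i) * (- f z)) / (z - cx (x i)) =
     (cx (ct i - t * et i) * f z - cx (- et i)) / (z - cx (x i))" for i
    by (simp add: f1_def algebra_simps)
  have v': "(cx (et i) * f2 - cx (ct i) * (- cnj (f w'))) / (cnj w' - cx (x i)) =
     cnj ((cx (ct i - t * et i) * f w' - cx (- et i)) / (w' - cx (x i)))" for i
    by (simp add: f2_def algebra_simps)
  have nz: "z - cnj w' \<noteq> 0" using z w by (auto simp: upper_half_plane_def complex_eq_iff)
  have num: "numer t f z = f1 + (\<Sum>i<n. cx (cr i) *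
     ((cx (ct i - t * et i) * f z - cx (- et i)) / (z - cx (x i))))"
    by (simp only: numer_def f1_def)
  have cnum: "cnj (numer t f w') = f2 + (\<Sum>i<n. cx (cr i) *
     cnj ((cx (ct i - t * et i) * f w' - cx (- et i)) / (w' - cx (x i))))"
    unfolding numer_def f2_def complex_cnj_add cnj_sum complex_cnj_mult[of "cx _"] by simp
  have cden: "cnj (denom t f w') = - cnj (f w') + (\<Sum>i<n. cx (er i) *
     cnj ((cx (ct i - t * et i) * f w' - cx (- et i)) / (w' - cx (x i))))"
    unfolding denom_def complex_cnj_add cnj_sum complex_cnj_mult[of "cx _"] by simp
  have "f1 * (- cnj (f w')) - (- f z) * f2 = f z - cnj (f w')" by (simp add: f1_def f2_def algebra_simps)
  also have "\<dots> = (z - cnj w') * nev_kernel f z w'" using nz by (simp add: nev_kernel_def)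
  finally have wr: "f1 * (- cnj (f w')) - (- f z) * f2 = (z - cnj w') * nev_kernel f z w'" .
  show ?thesis
    using bilinear_identity[of z "cnj w'" f1 "- f z" "- cnj (f w')" f2, OF no no']
    unfolding v v' wr num cnum cden denom_def[of t f z] by (simp only: distrib_left)
qed

end


section \<open>The linear fractional transformation\<close>

text \<open>As \<open>a\<close> and \<open>b\<close> have no common zero, the poles of the quotient
  are exactly the zeros of \<open>b\<close>. So the domain of analyticity is known, and it is dense
  because these zeros are isolated.\<close>

lemma remove_sings_quotient:
  assumes a: "a holomorphic_on UHP" and b: "b holomorphic_on UHP"
    and nz: "\<And>z. z \<in> UHP \<Longrightarrow> b z = 0 \<Longrightarrow> a z \<noteq> 0"
    and ex: "\<exists>z\<in>UHP. b z \<noteq> 0"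
    and g: "\<And>z. z \<in> UHP \<Longrightarrow> g z = a z / b z"
  shows "remove_sings g nicely_meromorphic_on UHP"
    and "analyticity_domain (remove_sings g) = {z \<in> UHP. b z \<noteq> 0}"
    and "\<And>z. z \<in> UHP \<Longrightarrow> b z \<noteq> 0 \<Longrightarrow> remove_sings g z = a z / b z"
    and "UHP \<subseteq> closure {z \<in> UHP. b z \<noteq> 0}"
proof -
  have evU: "\<forall>\<^sub>F w in nhds z. w \<in> UHP" if "z \<in> UHP" for z
    using eventually_nhds_in_open[OF open_upper_half_plane that] .
  have an: "a analytic_on UHP" "b analytic_on UHP"
    using a b by (simp_all add: analytic_on_open open_upper_half_plane)
  have "(\<lambda>z. a z / b z) meromorphic_on UHP"
    using an by (intro meromorphic_on_divide analytic_on_imp_meromorphic_on)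
  moreover have "g meromorphic_on UHP \<longleftrightarrow> (\<lambda>z. a z / b z) meromorphic_on UHP"
  proof (rule meromorphic_on_cong[OF _ refl])
    fix z assume "z \<in> UHP"
    from evU[OF this] have "\<forall>\<^sub>F w in nhds z. g w = a w / b w"
      by eventually_elim (simp add: g)
    then show "\<forall>\<^sub>F w in at z. g w = a w / b w" by (simp add: eventually_at_filter eventually_mono)
  qed
  ultimately have gm: "g meromorphic_on UHP" by simp
  then show "remove_sings g nicely_meromorphic_on UHP" by (rule remove_sings_nicely_meromorphic)
  have iso: "\<forall>\<^sub>F w in at z. b w \<noteq> 0" if z: "z \<in> UHP" for z
  proof (cases "b z = 0")
    case True
    obtain \<beta> where "\<beta> \<in> UHP" "b \<beta> \<noteq> 0" using ex by blast
    then obtain r where "0 < r" "\<And>w. w \<in> ball z r - {z} \<Longrightarrow> b w \<noteq> 0"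
      using isolated_zeros[OF b open_upper_half_plane connected_upper_half_plane z True] by metis
    then show ?thesis unfolding eventually_at by (intro exI[of _ r]) (auto simp: dist_commute)
  next
    case False
    have "isCont b z"
      using holomorphic_on_imp_continuous_on[OF b] open_upper_half_plane z by (simp add: continuous_on_eq_continuous_at)
    then show ?thesis using False by (intro tendsto_imp_eventually_ne[of b "b z"]) (simp_all add: isCont_def)
  qed
  have gan: "g analytic_on {z}" if z: "z \<in> UHP" "b z \<noteq> 0" for z
  proof -
    have "(\<lambda>z. a z / b z) analytic_on {z}"
      using z an by (intro analytic_on_divide) (auto intro: analytic_on_subset)
    moreover have ev: "\<forall>\<^sub>F w in nhds z. g w = a w / b w"
      using evU[OF z(1)] by eventually_elim (simp add: g)
    ultimately show ?thesis by (simp add: analytic_at_cong[OF ev refl])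
  qed
  show val: "remove_sings g z = a z / b z" if "z \<in> UHP" "b z \<noteq> 0" for z
    using remove_sings_at_analytic[OF gan[OF that]] g[OF that(1)] by simp
  show "analyticity_domain (remove_sings g) = {z \<in> UHP. b z \<noteq> 0}"
  proof (intro equalityI subsetI)
    fix z assume "z \<in> {z \<in> UHP. b z \<noteq> 0}"
    then have z: "z \<in> UHP" "b z \<noteq> 0" by auto
    have "remove_sings g analytic_on {z}"
      using gan[OF z] by (simp add: analytic_at_cong[OF eventually_remove_sings_eq_nhds[OF gan[OF z]] refl])
    then show "z \<in> analyticity_domain (remove_sings g)" using z by (simp add: analyticity_domain_def)
  next
    fix z assume "z \<in> analyticity_domain (remove_sings g)"
    then have z: "z \<in> UHP" and anz: "remove_sings g analytic_on {z}" by (auto simp: analyticity_domain_def)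
    have "b z \<noteq> 0"
    proof
      assume b0: "b z = 0"
      have cont: "isCont h z" if "h holomorphic_on UHP" for h
        using holomorphic_on_imp_continuous_on[OF that] open_upper_half_plane z by (simp add: continuous_on_eq_continuous_at)
      \<comment> \<open>If the quotient were analytic at a zero of \<open>b\<close>, its product
        with \<open>b\<close> would tend to 0 there, whereas it tends to the nonzero value
        \<open>a z\<close>.\<close>
      have "((\<lambda>w. remove_sings g w * b w) \<longlongrightarrow> remove_sings g z * b z) (at z)"
        using analytic_at_imp_isCont[OF anz] cont[OF b] unfolding isCont_def by (intro tendsto_mult)
      moreover have "\<forall>\<^sub>F w in at z. remove_sings g w * b w = a w"
        using iso[OF z] evU[OF z, THEN eventually_nhds_conv_at[THEN iffD1, THEN conjunct1]]
        by eventually_elim (simp add: val)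
      ultimately have "(a \<longlongrightarrow> remove_sings g z * b z) (at z)" by (rule Lim_transform_eventually)
      moreover have "(a \<longlongrightarrow> a z) (at z)" using cont[OF a] by (simp add: isCont_def)
      ultimately have "a z = remove_sings g z * b z" by (rule tendsto_unique[OF trivial_limit_at, rotated])
      then show False using nz[OF z b0] b0 by simp
    qed
    then show "z \<in> {z \<in> UHP. b z \<noteq> 0}" using z by simp
  qed
  show "UHP \<subseteq> closure {z \<in> UHP. b z \<noteq> 0}"
  proof
    fix z assume z: "z \<in> UHP"
    have "\<forall>\<^sub>F w in at z. w \<in> UHP \<and> b w \<noteq> 0"
      using iso[OF z] evU[OF z, THEN eventually_nhds_conv_at[THEN iffD1, THEN conjunct1]]
      by eventually_elim simp
    then have ev: "\<forall>\<^sub>F w in at z. w \<in> {z \<in> UHP. b z \<noteq> 0}" by simp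
    have "\<forall>\<^sub>F w in at z. w \<in> closure {z \<in> UHP. b z \<noteq> 0}"
      using ev by (rule eventually_mono) (rule subsetD[OF closure_subset])
    then show "z \<in> closure {z \<in> UHP. b z \<noteq> 0}"
      by (rule Lim_in_closed_set[OF closed_closure _ trivial_limit_at tendsto_ident_at])
  qed
qed

section \<open>The index of the transform\<close>

context pick_data
begin

lemma numer_holomorphic:
  assumes "f holomorphic_on UHP"
  shows "numer t f holomorphic_on UHP" "denom t f holomorphic_on UHP"
  unfolding numer_def[abs_def] denom_def[abs_def]
  by (intro holomorphic_on_add holomorphic_on_diff holomorphic_on_minus holomorphic_on_mult
      holomorphic_on_sum holomorphic_on_divide holomorphic_on_const holomorphic_on_ident assms,
      simp add: upper_half_plane_not_node)+

text \<open>By \<open>numer_denom_kernel\<close> a diagonal congruence by the denominators turns the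
  kernel matrices of the transform into those of \<open>ker\<close>, so both inertia bounds apply.
  Good nodes lower the index by \<open>card A\<close> at every set of points; with the complement of
  \<open>A\<close> as \<open>B\<close>, the lower bound supplies points where nothing more is
  lost.\<close>

lemma inertia_of_transform:
  assumes psd: "nev_psd f" and hol: "f holomorphic_on UHP"
    and t: "\<And>i. i < n \<Longrightarrow> ct i - t * et i \<noteq> 0"
    and A: "A \<subseteq> {..<n}"
    and good: "\<And>i. i \<in> A \<Longrightarrow> \<exists>d. ((\<lambda>\<epsilon>. (f (Complex (x i) \<epsilon>) - cx (- et i / (ct i - t * et i))) /
           (Complex (x i) \<epsilon> - cx (x i))) \<longlongrightarrow> cx d) (at_right 0) \<and> (ct i - t * et i)\<^sup>2 * d \<le> - q i i"
    and bad: "\<And>i d. i < n \<Longrightarrow> i \<notin> A \<Longrightarrow> 0 \<le> d \<Longrightarrow>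
       (\<And>M. M > 0 \<Longrightarrow> ((\<lambda>z. (f z - cx (- et i / (ct i - t * et i))) /
           (z - cx (x i))) \<longlongrightarrow> cx d) (nt_at M (x i))) \<Longrightarrow>
       0 < (ct i - t * et i)\<^sup>2 * d + q i i"
  defines "\<kappa> \<equiv> num_neg_eigenvalues (of_real_mat PM)"
  shows "card A \<le> \<kappa>"
    and "\<exists>z\<in>UHP. denom t f z \<noteq> 0 \<Longrightarrow>
      (\<And>z. z \<in> UHP \<Longrightarrow> g z = numer t f z / denom t f z) \<Longrightarrow> remove_sings g \<in> nev_class (\<kappa> - card A)"
proof -
  obtain lam L where lamL: "diagonalizes n (\<lambda>i j. of_real_mat PM $$ (i, j)) lam L"
    and \<kappa>: "\<kappa> = card {k. k < n \<and> lam k < 0}"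
  proof (rule hermitian_inertia)
    show "of_real_mat PM \<in> carrier_mat n n" using PM_carrier by simp
    show "of_real_mat PM $$ (j, i) = cnj (of_real_mat PM $$ (i, j))" if "i < n" "j < n" for i j
      using that PM_carrier p_sym[OF that] by (simp add: p_def)
  qed (rule that, assumption, simp add: \<kappa>_def)
  have diag: "diagonalizes n (\<lambda>i j. cx (p i j)) lam L"
    by (rule diagonalizes_cong[OF lamL]) (use PM_carrier in \<open>simp add: p_def\<close>)
  have lam_nz: "lam k \<noteq> 0" if "k < n" for k
  proof (rule diagonalizes_nonzero[OF diag that])
    fix a assume a: "\<forall>i<n. (\<Sum>j<n. cx (p i j) * a j) = 0"
    show "\<forall>j<n. a j = 0"
    proof (intro allI impI)
      fix i assume i: "i < n"
      have "0 = (\<Sum>k<n. cx (q i k) * (\<Sum>j<n. cx (p k j) * a j))" using a by simp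
      also have "\<dots> = (\<Sum>j<n. cx (\<Sum>k<n. q i k * p k j) * a j)"
        unfolding sum_distrib_left of_real_sum sum_distrib_right by (subst sum.swap) (simp add: mult_ac)
      also have "\<dots> = (\<Sum>j<n. (if i = j then 1 else 0) * a j)"
        by (intro sum.cong refl) (simp add: qp i)
      also have "\<dots> = a i" by (rule sum_delta_lessThan(1)[OF i])
      finally show "a i = 0" by simp
    qed
  qed
  \<comment> \<open>The substitution sends \<open>ct / et\<close> to
    \<open>- et / (ct - t * et)\<close>. The underlying change of the pair has determinant 1, so the
    right side of the Lyapunov identity keeps its form.\<close>
  interpret pick_core n x "\<lambda>i. - et i" "\<lambda>i. ct i - t * et i" p q lam L f
  proof unfold_locales
    show "q i j * (x i - x j) = (ct i - t * et i) * - et j - - et i * (ct j - t * et j)"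
      if "i < n" "j < n" for i j
      unfolding lyapunov_q[OF that] by (simp add: algebra_simps)
  qed (fact inj_x t p_sym q_sym pq diag lam_nz psd)+
  have "\<exists>d. \<forall>i\<in>A. vlim i (d i) \<and> (ct i - t * et i)\<^sup>2 * d i \<le> - q i i"
    by (rule bchoice) (use good in \<open>auto simp: vlim_def diffq_def\<close>)
  then obtain d where d: "\<And>i. i \<in> A \<Longrightarrow> vlim i (d i)" "\<And>i. i \<in> A \<Longrightarrow> (ct i - t * et i)\<^sup>2 * d i \<le> - q i i"
    by blast
  have upper: "card {k. k < m \<and> lam' k < 0} + card A \<le> \<kappa>"
    if "\<And>j. j < m \<Longrightarrow> z j \<in> UHP" "diagonalizes m (\<lambda>i j. ker (z j) (z i)) lam' L'"
    for m z lam' L'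
    unfolding \<kappa> by (rule inertia_upper_bound[OF A _ _ _ that(2)]) (use d that in auto)
  \<comment> \<open>The empty set of points already bounds \<open>card A\<close>, whatever the
    denominator is.\<close>
  have "diagonalizes 0 (\<lambda>i j. ker (undefined j) (undefined i)) lam L" by (simp add: diagonalizes_def)
  from upper[OF _ this] show kA: "card A \<le> \<kappa>" by simp
  assume ex: "\<exists>z\<in>UHP. denom t f z \<noteq> 0"
    and g: "\<And>z. z \<in> UHP \<Longrightarrow> g z = numer t f z / denom t f z"
  define \<Omega> where "\<Omega> = {z \<in> UHP. denom t f z \<noteq> 0}"
  have rq: "remove_sings g nicely_meromorphic_on UHP"
    "analyticity_domain (remove_sings g) = \<Omega>"
    "\<And>z. z \<in> UHP \<Longrightarrow> denom t f z \<noteq> 0 \<Longrightarrow> remove_sings g z = numer t f z / denom t f z"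
    "UHP \<subseteq> closure \<Omega>"
    unfolding \<Omega>_def
    using remove_sings_quotient[OF numer_holomorphic[OF hol, of t] numer_denom_not_both_zero ex g] by blast+
  have \<Omega>U: "\<Omega> \<subseteq> UHP" by (auto simp: \<Omega>_def)
  have kernel: "ker z w' = cnj (denom t f w') * nev_kernel (remove_sings g) z w' * denom t f z"
    if "z \<in> \<Omega>" "w' \<in> \<Omega>" for z w'
  proof -
    have z: "z \<in> UHP" "w' \<in> UHP" "denom t f z \<noteq> 0" "denom t f w' \<noteq> 0"
      using that by (auto simp: \<Omega>_def)
    have nz: "z - cnj w' \<noteq> 0" using z(1,2) by (auto simp: upper_half_plane_def complex_eq_iff)
    have "ker z w' = (numer t f z * cnj (denom t f w') - denom t f z * cnj (numer t f w')) / (z - cnj w')"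
      unfolding numer_denom_kernel[OF z(1,2)] using nz by (simp add: ker_def v_def)
    also have "numer t f z * cnj (denom t f w') - denom t f z * cnj (numer t f w') =
        cnj (denom t f w') * (numer t f z / denom t f z - cnj (numer t f w' / denom t f w')) * denom t f z"
      using z(3,4) by (simp add: field_simps)
    finally show ?thesis
      using rq(3)[OF z(1,3)] rq(3)[OF z(2,4)] by (simp add: nev_kernel_def)
  qed
  have inertia: "\<exists>lam' L'. diagonalizes (length zs) (\<lambda>i j. ker (zs ! j) (zs ! i)) lam' L' \<and>
     num_neg_eigenvalues (kernel_matrix (remove_sings g) zs) = card {k. k < length zs \<and> lam' k < 0}"
    if zs: "set zs \<subseteq> \<Omega>" for zs
  proof -
    obtain lam' L' where 1: "diagonalizes (length zs) (\<lambda>i j. nev_kernel (remove_sings g) (zs ! j) (zs ! i)) lam' L'"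
      and 2: "num_neg_eigenvalues (kernel_matrix (remove_sings g) zs) = card {k. k < length zs \<and> lam' k < 0}"
      by (rule kernel_matrix_inertia)
    have mem: "zs ! j \<in> \<Omega>" if "j < length zs" for j using zs that by (meson nth_mem subsetD)
    have "diagonalizes (length zs) (\<lambda>i j. cnj (denom t f (zs ! i)) * nev_kernel (remove_sings g) (zs ! j) (zs ! i) * denom t f (zs ! j))
        lam' (\<lambda>k j. L' k j * denom t f (zs ! j))"
      by (rule diagonalizes_scale[OF 1]) (use mem in \<open>auto simp: \<Omega>_def\<close>)
    then have "diagonalizes (length zs) (\<lambda>i j. ker (zs ! j) (zs ! i)) lam' (\<lambda>k j. L' k j * denom t f (zs ! j))"
      by (rule diagonalizes_cong) (simp add: kernel mem)
    with 2 show ?thesis by blast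
  qed
  have ub: "num_neg_eigenvalues (kernel_matrix (remove_sings g) zs) + card A \<le> \<kappa>" if zs: "set zs \<subseteq> \<Omega>" for zs
  proof -
    obtain lam' L' where 1: "diagonalizes (length zs) (\<lambda>i j. ker (zs ! j) (zs ! i)) lam' L'"
     and 2: "num_neg_eigenvalues (kernel_matrix (remove_sings g) zs) = card {k. k < length zs \<and> lam' k < 0}"
      using inertia[OF zs] by blast
    show ?thesis unfolding 2
      by (rule upper[OF _ 1]) (use zs \<Omega>U nth_mem in blast)
  qed
  have "\<exists>N z. 0 < N \<and> (\<forall>k<N. z k \<in> \<Omega>) \<and> (\<forall>lam' L'. diagonalizes N (\<lambda>i j. ker (z j) (z i)) lam' L' \<longrightarrow>
       card {k. k < n \<and> lam k < 0} + card ({..<n} - A) \<le> card {k. k < N \<and> lam' k < 0} + n)"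
  proof (rule inertia_lower_bound[OF holomorphic_on_imp_continuous_on[OF hol] \<Omega>U rq(4)])
    show "0 < (ct i - t * et i)\<^sup>2 * d + q i i" if "i \<in> {..<n} - A" "0 \<le> d" "ntlim i d" for i d
      by (rule bad) (use that in \<open>auto simp: ntlim_def diffq_def[abs_def]\<close>)
  qed auto
  then obtain N z where N: "0 < N" "\<forall>k<N. z k \<in> \<Omega>"
    and lower: "\<forall>lam' L'. diagonalizes N (\<lambda>i j. ker (z j) (z i)) lam' L' \<longrightarrow>
       card {k. k < n \<and> lam k < 0} + card ({..<n} - A) \<le> card {k. k < N \<and> lam' k < 0} + n"
    by (elim exE conjE)
  define zs where "zs = map z [0..<N]"
  have zs: "length zs = N" "zs \<noteq> []" "set zs \<subseteq> \<Omega>" using N by (auto simp: zs_def)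
  obtain lam' L' where 1: "diagonalizes N (\<lambda>i j. ker (zs ! j) (zs ! i)) lam' L'"
     and 2: "num_neg_eigenvalues (kernel_matrix (remove_sings g) zs) = card {k. k < N \<and> lam' k < 0}"
    using inertia[OF zs(3)] unfolding zs(1) by blast
  have "diagonalizes N (\<lambda>i j. ker (z j) (z i)) lam' L'"
    by (rule diagonalizes_cong[OF 1]) (simp add: zs_def)
  with lower have "\<kappa> + card ({..<n} - A) \<le> num_neg_eigenvalues (kernel_matrix (remove_sings g) zs) + n"
    unfolding 2 \<kappa> by blast
  moreover have "card ({..<n} - A) + card A = n"
    using A card_mono[of "{..<n}" A] by (subst card_Diff_subset) (auto intro: finite_subset)
  ultimately have "num_neg_eigenvalues (kernel_matrix (remove_sings g) zs) = \<kappa> - card A"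
    using ub[OF zs(3)] by simp
  moreover have "num_neg_eigenvalues (kernel_matrix (remove_sings g) zs') \<le> \<kappa> - card A" if "set zs' \<subseteq> \<Omega>" for zs'
    using ub[OF that] by simp
  ultimately show "remove_sings g \<in> nev_class (\<kappa> - card A)"
    unfolding nev_class_def mem_Collect_eq rq(2) using rq(1) zs by blast
qed

lemma cond_C46_iff: "cond_C46 n l x w \<gamma> \<xi> \<phi> i \<longleftrightarrow> cond46 \<phi> (x i) (ct i) (et i) (q i i)"
  by (simp only: cond_C46_def cond46_def Let_def ct_def et_def q_def QM_def)

lemma lin_frac_in_nev_class:
  assumes \<phi>: "\<phi> \<in> ext_nev_class 0"
  defines "A \<equiv> {i. i < n \<and> cond_C46 n l x w \<gamma> \<xi> \<phi> i}" and "\<kappa> \<equiv> num_neg_eigenvalues (of_real_mat PM)"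
  shows "card A \<le> \<kappa> \<and> lin_frac (Theta n l x w \<gamma> \<xi>) \<phi> \<in> ext_nev_class (\<kappa> - card A)"
proof -
  have An: "A \<subseteq> {..<n}" by (auto simp: A_def)
  let ?\<Theta> = "Theta n l x w \<gamma> \<xi>"
  \<comment> \<open>Avoiding \<open>ct i / et i\<close> makes every \<open>ct i - s * et i\<close>
    nonzero, and avoiding \<open>Re (f \<i>)\<close> makes \<open>f - s\<close> free of zeros. Where
    \<open>et i = 0\<close>, the quotient has the default value 0, whose exclusion does no
    harm.\<close>
  obtain s where s: "s \<notin> (\<lambda>i. ct i / et i) ` {..<n} \<union> (case \<phi> of Fin f \<Rightarrow> {Re (f \<i>)} | Infty \<Rightarrow> {})"
    using ex_new_if_finite[OF infinite_UNIV_char_0, of "(\<lambda>i. ct i / et i) ` {..<n} \<union> (case \<phi> of Fin f \<Rightarrow> {Re (f \<i>)} | Infty \<Rightarrow> {})"]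
    by (cases \<phi>) auto
  have t: "ct i - s * et i \<noteq> 0" if "i < n" for i
  proof (cases "et i = 0")
    case True
    then show ?thesis using ct_et_nonzero[OF that] by simp
  next
    case False
    moreover have "s \<noteq> ct i / et i" using s that by auto
    ultimately show ?thesis by (simp add: eq_divide_eq)
  qed
  have \<Theta>: "?\<Theta> z $$ (0, 0) = 1 + (\<Sum>i<n. cx (cr i * et i) / (z - cx (x i)))"
    "?\<Theta> z $$ (0, 1) = - (\<Sum>i<n. cx (cr i * ct i) / (z - cx (x i)))"
    "?\<Theta> z $$ (1, 0) = (\<Sum>i<n. cx (er i * et i) / (z - cx (x i)))"
    "?\<Theta> z $$ (1, 1) = 1 - (\<Sum>i<n. cx (er i * ct i) / (z - cx (x i)))"
    if "z \<in> UHP" for z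
    using Theta_entries upper_half_plane_not_node[OF that] by auto
  consider f where "\<phi> = Fin f" "f \<in> nev_class 0" | "\<phi> = Infty"
    using \<phi> by (auto simp: ext_nev_class_def)
  then show ?thesis
  proof cases
    case 1
    have fs: "f z \<noteq> cx s" if "z \<in> UHP" for z
      by (rule nev_class_0_neq_real[OF 1(2) _ that]) (use s 1 in auto)
    have fs': "f z - cx s \<noteq> 0" if "z \<in> UHP" for z using fs[OF that] by simp
    have fhol: "f holomorphic_on UHP" by (rule nev_class_0_holomorphic[OF 1(2)])
    define h where "h = (\<lambda>z. - 1 / (f z - cx s))"
    have hhol: "h holomorphic_on UHP"
      unfolding h_def using fs' by (intro holomorphic_intros fhol) auto
    have hpsd: "nev_psd h"
      unfolding h_def by (rule nev_psd_moebius[OF nev_class_0_psd[OF 1(2)] fs])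
    have good: "\<exists>d. ((\<lambda>\<epsilon>. (h (Complex (x i) \<epsilon>) - cx (- et i / (ct i - s * et i))) /
           (Complex (x i) \<epsilon> - cx (x i))) \<longlongrightarrow> cx d) (at_right 0) \<and> (ct i - s * et i)\<^sup>2 * d \<le> - q i i"
      if "i \<in> A" for i
      unfolding h_def
      by (rule cond46_imp_vertical_limit[OF fhol fs t]) (use that 1(1) in \<open>auto simp: A_def cond_C46_iff\<close>)
    have bad: "0 < (ct i - s * et i)\<^sup>2 * d + q i i"
      if "i < n" "i \<notin> A" "0 \<le> d" and lim: "\<And>M. M > 0 \<Longrightarrow> ((\<lambda>z. (h z - cx (- et i / (ct i - s * et i))) /
           (z - cx (x i))) \<longlongrightarrow> cx d) (nt_at M (x i))" for i d
    proof (rule ccontr)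
      assume "\<not> ?thesis"
      then have "(ct i - s * et i)\<^sup>2 * d \<le> - q i i" by simp
      then have "cond46 (Fin f) (x i) (ct i) (et i) (q i i)"
        by (intro nt_limits_imp_cond46[OF fhol fs t[OF that(1)] lim[unfolded h_def] that(3)])
      then show False using that(1,2) 1(1) by (simp add: A_def cond_C46_iff)
    qed
    have main1: "card A \<le> \<kappa>"
      unfolding \<kappa>_def by (rule inertia_of_transform(1)[OF hpsd hhol _ An]) (fact t good bad)+
    have main2: "remove_sings g \<in> nev_class (\<kappa> - card A)"
      if "\<exists>z\<in>UHP. denom s h z \<noteq> 0"
        "\<And>z. z \<in> UHP \<Longrightarrow> g z = numer s h z / denom s h z" for g
      unfolding \<kappa>_def by (rule inertia_of_transform(2)[OF hpsd hhol _ An]) (fact t good bad that)+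
    \<comment> \<open>Both coordinates carry the same nonvanishing factor
      \<open>1 / (f - s)\<close>, which cancels in the quotient.\<close>
    have num: "numer s h z = (?\<Theta> z $$ (0, 0) * f z + ?\<Theta> z $$ (0, 1)) / (f z - cx s)"
     and den: "denom s h z = (?\<Theta> z $$ (1, 0) * f z + ?\<Theta> z $$ (1, 1)) / (f z - cx s)"
      if z: "z \<in> UHP" for z
    proof -
      have smd: "(cx (ct i - s * et i) * h z - cx (- et i)) / (z - cx (x i)) =
          (cx (et i) * f z - cx (ct i)) / (z - cx (x i)) / (f z - cx s)" for i
      proof -
        have "cx (ct i - s * et i) * h z - cx (- et i) =
            (cx (et i) * f z - cx (ct i)) / (f z - cx s)"
          using fs'[OF z] by (simp add: h_def field_simps)
        then show ?thesis by simp
      qed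
      have split: "(\<Sum>i<n. cx (g i) * ((cx (et i) * f z - cx (ct i)) / (z - cx (x i)) / (f z - cx s)))
         = ((\<Sum>i<n. cx (g i * et i) / (z - cx (x i))) * f z - (\<Sum>i<n. cx (g i * ct i) / (z - cx (x i)))) / (f z - cx s)" for g
        unfolding sum_distrib_right sum_subtractf[symmetric] sum_divide_distrib
        by (intro sum.cong refl) (simp add: diff_divide_distrib right_diff_distrib mult_ac)
      have one: "1 - cx s * h z = f z / (f z - cx s)"
        using fs'[OF z] by (simp add: h_def field_simps)
      have hz: "- h z = 1 / (f z - cx s)" by (simp add: h_def)
      show "numer s h z = (?\<Theta> z $$ (0, 0) * f z + ?\<Theta> z $$ (0, 1)) / (f z - cx s)"
        unfolding numer_def smd split one \<Theta>[OF z] add_divide_distrib[symmetric]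
        by (simp add: algebra_simps)
      show "denom s h z = (?\<Theta> z $$ (1, 0) * f z + ?\<Theta> z $$ (1, 1)) / (f z - cx s)"
        unfolding denom_def smd split hz \<Theta>[OF z] add_divide_distrib[symmetric]
        by (simp add: algebra_simps)
    qed
    show ?thesis
    proof (cases "\<forall>z\<in>analyticity_domain f. ?\<Theta> z $$ (1, 0) * f z + ?\<Theta> z $$ (1, 1) = 0")
      case True
      \<comment> \<open>An identically vanishing denominator gives \<open>Infty\<close>, a member of
        every extended class.\<close>
      then show ?thesis using main1 1(1) by (simp add: ext_nev_class_def)
    next
      case False
      then have ex: "\<exists>z\<in>UHP. denom s h z \<noteq> 0"
        unfolding nev_class_0_analyticity_domain[OF 1(2)] using den fs' by auto
      have "remove_sings (\<lambda>z. (?\<Theta> z $$ (0, 0) * f z + ?\<Theta> z $$ (0, 1)) / (?\<Theta> z $$ (1, 0) * f z + ?\<Theta> z $$ (1, 1)))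
         \<in> nev_class (\<kappa> - card A)"
        by (rule main2[OF ex]) (use fs' in \<open>simp add: num den\<close>)
      then show ?thesis using main1 False 1(1) by (auto simp: ext_nev_class_def)
    qed
  next
    case 2
    \<comment> \<open>For infinite \<phi> the substituted function is 0. Its difference quotient at
      a node is a constant divided by \<open>z - x i\<close>, which converges only if
      \<open>et i = 0\<close>, and then to 0; this matches the reciprocal residue 0 of
      \<open>Infty\<close>.\<close>
    have condA: "i \<in> A \<longleftrightarrow> i < n \<and> et i = 0 \<and> q i i \<le> 0" for i
      using ct_et_nonzero[of i] cond46_Infty_iff[of "et i" "ct i" "x i" "q i i"] 2 by (auto simp: A_def cond_C46_iff)
    have bad: "0 < (ct i - s * et i)\<^sup>2 * d + q i i"
      if "i < n" "i \<notin> A" "0 \<le> d" and lim: "\<And>M. M > 0 \<Longrightarrow> ((\<lambda>z. (0 - cx (- et i / (ct i - s * et i))) /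
           (z - cx (x i))) \<longlongrightarrow> cx d) (nt_at M (x i))" for i d
    proof -
      let ?F = "nt_at 1 (x i)"
      define \<theta> where "\<theta> = 0 - cx (- et i / (ct i - s * et i))"
      have "((\<lambda>z. \<theta> / (z - cx (x i)) * (z - cx (x i))) \<longlongrightarrow> cx d * (cx (x i) - cx (x i))) ?F"
        unfolding \<theta>_def by (intro tendsto_mult lim tendsto_intros) simp
      moreover have "\<forall>\<^sub>F z in ?F. \<theta> / (z - cx (x i)) * (z - cx (x i)) = \<theta>"
        using eventually_stolz_angle[of 1 "x i"] by eventually_elim simp
      ultimately have "((\<lambda>_. \<theta>) \<longlongrightarrow> 0) ?F" by (simp add: Lim_transform_eventually)
      then have "\<theta> = 0" using at_stolz_angle_neq_bot by (simp add: tendsto_const_iff)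
      moreover have "\<theta> = cx (et i / (ct i - s * et i))" by (simp add: \<theta>_def)
      ultimately have "et i / (ct i - s * et i) = 0" by (simp only: of_real_eq_0_iff)
      then have e0: "et i = 0" using t[OF that(1)] by simp
      then have "0 < q i i" using that(1,2) condA[of i] by simp
      then show ?thesis using that(3) by (simp add: add_nonneg_pos)
    qed
    have good: "\<exists>d. ((\<lambda>\<epsilon>. (0 - cx (- et i / (ct i - s * et i))) /
           (Complex (x i) \<epsilon> - cx (x i))) \<longlongrightarrow> cx d) (at_right 0) \<and> (ct i - s * et i)\<^sup>2 * d \<le> - q i i"
      if "i \<in> A" for i
      using that condA[of i] by (intro exI[of _ 0]) simp
    have main1: "card A \<le> \<kappa>"
      unfolding \<kappa>_def by (rule inertia_of_transform(1)[OF nev_psd_zero holomorphic_on_const _ An]) (fact t good bad)+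
    have main2: "remove_sings g \<in> nev_class (\<kappa> - card A)"
      if "\<exists>z\<in>UHP. denom s (\<lambda>_. 0) z \<noteq> 0"
        "\<And>z. z \<in> UHP \<Longrightarrow> g z = numer s (\<lambda>_. 0) z / denom s (\<lambda>_. 0) z" for g
      unfolding \<kappa>_def by (rule inertia_of_transform(2)[OF nev_psd_zero holomorphic_on_const _ An]) (fact t good bad that)+
    have num: "numer s (\<lambda>_. 0) z = ?\<Theta> z $$ (0, 0)" and den: "denom s (\<lambda>_. 0) z = ?\<Theta> z $$ (1, 0)"
      if "z \<in> UHP" for z
      unfolding numer_def denom_def \<Theta>[OF that] by simp_all
    show ?thesis
    proof (cases "\<forall>z\<in>UHP. ?\<Theta> z $$ (1, 0) = 0")
      case True
      then show ?thesis using main1 2 by (simp add: ext_nev_class_def)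
    next
      case False
      then have ex: "\<exists>z\<in>UHP. denom s (\<lambda>_. 0) z \<noteq> 0" using den by auto
      have "remove_sings (\<lambda>z. ?\<Theta> z $$ (0, 0) / ?\<Theta> z $$ (1, 0)) \<in> nev_class (\<kappa> - card A)"
        by (rule main2[OF ex]) (simp add: num den)
      then show ?thesis using main1 False 2 by (auto simp: ext_nev_class_def)
    qed
  qed
qed

end

theorem theorem2p9:
  fixes n l \<kappa> :: nat and x w \<gamma> \<xi> :: "nat \<Rightarrow> real" and \<phi> :: ext_fun
  assumes "interpolation_data n l x \<xi>"
    and "invertible_mat (pick_matrix n l x w \<gamma> \<xi>)"
    and "num_neg_eigenvalues (of_real_mat (pick_matrix n l x w \<gamma> \<xi>)) = \<kappa>"
    and "\<phi> \<in> ext_nev_class 0"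
  shows "card {i. i < n \<and> cond_C46 n l x w \<gamma> \<xi> \<phi> i} \<le> \<kappa> \<and>
    (\<forall>k. card {i. i < n \<and> cond_C46 n l x w \<gamma> \<xi> \<phi> i} = k \<longrightarrow>
       lin_frac (Theta n l x w \<gamma> \<xi>) \<phi> \<in> ext_nev_class (\<kappa> - k))"
proof -
  interpret pick_data n l x w \<gamma> \<xi> by unfold_locales (fact assms(1,2))+
  show ?thesis using lin_frac_in_nev_class[OF assms(4)] assms(3) by auto
qed

end
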